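(* Let $0<\omega<+\infty$ and let $A:[0,\omega]\to\mathbb{R}^{n\times n}$, $B:[0,\omega]\to\mathbb{R}^{n\times r}$, $H:[0,\omega]\to\mathbb{R}^{m\times n}$ be continuous. Let $\{\psi_k\}$ be a maximal system of linearly independent solutions (a basis of the solution space) of the homogeneous problem $\dot x(t)=A(t)x(t)$, $x(0)=x(\omega)$. If the system of functions $\{H(\cdot)\psi_k(\cdot)\}$ is linearly independent, then for every $\ell\in\mathbb{L}_2([0,\omega],\mathbb{R}^n)$ there exists a unique minimax mean-square estimation $\hat u$, the minimax mean-square error is $\hat\sigma=\int_0^\omega(\ell(t),\hat p(t))\,dt<+\infty$, and $$\hat u(t)=H(t)\hat p(t),$$ where $\hat p$ is the $p$-component of any solution $(z,p)$ of the (solvable) boundary value problem $$\dot z(t)=-A'(t)z(t)+H'(t)H(t)p(t)-\ell(t),\quad \dot p(t)=A(t)p(t)+B(t)B'(t)z(t),\quad z(0)=z(\omega),\ p(0)=p(\omega);$$ equivalently, for every $y\in\mathbb{L}_2([0,\omega],\mathbb{R}^m)$, $$\int_0^\omega(\hat u(t),y(t))\,dt=\int_0^\omega(\ell(t),\hat x(t))\,dt,$$ where $\hat x$ is the $x$-component of any solution $(p,x)$ of $$\dot p(t)=-A'(t)p(t)-H'(t)(y(t)-H(t)x(t)),\quad \dot x(t)=A(t)x(t)+B(t)B'(t)p(t),\quad p(0)=p(\omega),\ x(0)=x(\omega).$$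
   Context: Notation: a prime denotes the transpose, $\mathrm{sp}$ the trace, $M[\cdot]$ the expectation, $(\cdot,\cdot)$ the Euclidean inner product. Solutions of differential equations are absolutely continuous and satisfy the equations almost everywhere. Estimation problem. The state $x$ is an absolutely continuous function $[0,\omega]\to\mathbb{R}^n$ with $\dot x\in\mathbb{L}_2$ solving $\dot x(t)-A(t)x(t)=B(t)f(t)$, $x(0)=x(\omega)$, for some unknown $f\in\mathscr{G}:=\{f\in\mathbb{L}_2([0,\omega],\mathbb{R}^r):\int_0^\omega(f(t),f(t))\,dt\le1\}$ (for a given $f$ there may be no, one or many such $x$). The observation is $y(t)=H(t)x(t)+\eta(t)$ on $[0,\omega]$, where $\eta$ is a mean-square continuous $\mathbb{R}^m$-valued random process with zero expectation and unknown correlation function $R_\eta(t,s)=M[\eta(t)\eta(s)']$ belonging to $\mathscr{G}_2:=\{R_\eta:\int_0^\omega\mathrm{sp}\,R_\eta(t,t)\,dt\le1\}$. Put $\ell(x):=\int_0^\omega(\ell(t),x(t))\,dt$ and, for $u\in\mathbb{L}_2([0,\omega],\mathbb{R}^m)$, $u(y):=\int_0^\omega(u(t),y(t))\,dt$. The guaranteed estimation error is $$\sigma(u):=\sup M[\ell(x)-u(y)]^2\in[0,+\infty],$$ the supremum being over all absolutely continuous $x:[0,\omega]\to\mathbb{R}^n$ with $\dot x\in\mathbb{L}_2$ that solve $\dot x(t)-A(t)x(t)=B(t)f(t)$, $x(0)=x(\omega)$, for some $f\in\mathscr{G}$ and all $R_\eta\in\mathscr{G}_2$. The minimax mean-square error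 is $\hat\sigma:=\inf_{u\in\mathbb{L}_2([0,\omega],\mathbb{R}^m)}\sigma(u)$, and $\hat u$ is a minimax mean-square estimation if $\sigma(\hat u)\le\sigma(u)$ for all $u\in\mathbb{L}_2([0,\omega],\mathbb{R}^m)$. Uniqueness is as an element of $\mathbb{L}_2$. *)

theory Defs
  imports "HOL-Probability.Probability"
begin

definition L2 :: "real \<Rightarrow> (real \<Rightarrow> 'a::euclidean_space) set" where
  "L2 \<omega> = {f. f \<in> borel_measurable (lebesgue_on {0..\<omega>}) \<and>
                integrable (lebesgue_on {0..\<omega>}) (\<lambda>t. (norm (f t))\<^sup>2)}"

definition l2_inner :: "real \<Rightarrow> (real \<Rightarrow> 'a::euclidean_space) \<Rightarrow> (real \<Rightarrow> 'a) \<Rightarrow> real" where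
  "l2_inner \<omega> f g = (LINT t|lebesgue_on {0..\<omega>}. f t \<bullet> g t)"

(* The epsilon-delta notion for functions, not the library's absolutely_continuous for measures.
   D ranges over the finite families of non-overlapping closed subintervals k = {Inf k..Sup k}. *)
definition abs_cont_on :: "real set \<Rightarrow> (real \<Rightarrow> 'a::real_normed_vector) \<Rightarrow> bool" where
  "abs_cont_on S x \<longleftrightarrow>
     (\<forall>\<epsilon>>0. \<exists>\<delta>>0. \<forall>D. D division_of \<Union>D \<and> \<Union>D \<subseteq> S \<and> (\<Sum>k\<in>D. Sup k - Inf k) < \<delta>
        \<longrightarrow> (\<Sum>k\<in>D. norm (x (Sup k) - x (Inf k))) < \<epsilon>)"

(* x is an absolutely continuous solution of x' = g a.e. on [0,omega], x 0 = x omega; for a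
   system, g is the right-hand side evaluated along the solution. *)
definition periodic_solution ::
    "real \<Rightarrow> (real \<Rightarrow> 'a::euclidean_space) \<Rightarrow> (real \<Rightarrow> 'a) \<Rightarrow> bool" where
  "periodic_solution \<omega> g x \<longleftrightarrow>
     abs_cont_on {0..\<omega>} x \<and>
     (AE t in lebesgue_on {0..\<omega>}. (x has_vector_derivative g t) (at t within {0..\<omega>})) \<and>
     x 0 = x \<omega>"

definition lin_indep_family :: "real set \<Rightarrow> nat \<Rightarrow> (nat \<Rightarrow> real \<Rightarrow> 'a::real_vector) \<Rightarrow> bool" where
  "lin_indep_family S N \<phi> \<longleftrightarrow>
     (\<forall>c. (\<forall>t\<in>S. (\<Sum>k<N. c k *\<^sub>R \<phi> k t) = 0) \<longrightarrow> (\<forall>k<N. c k = 0))"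

definition homogeneous_basis ::
    "real \<Rightarrow> (real \<Rightarrow> real^'n^'n) \<Rightarrow> nat \<Rightarrow> (nat \<Rightarrow> real \<Rightarrow> real^'n) \<Rightarrow> bool" where
  "homogeneous_basis \<omega> A N \<psi> \<longleftrightarrow>
     (\<forall>k<N. periodic_solution \<omega> (\<lambda>t. A t *v \<psi> k t) (\<psi> k)) \<and>
     lin_indep_family {0..\<omega>} N \<psi> \<and>
     (\<forall>x. periodic_solution \<omega> (\<lambda>t. A t *v x t) x
        \<longrightarrow> (\<exists>c. \<forall>t\<in>{0..\<omega>}. x t = (\<Sum>k<N. c k *\<^sub>R \<psi> k t)))"

definition admissible_input :: "real \<Rightarrow> (real \<Rightarrow> real^'r) set" where
  "admissible_input \<omega> = {f \<in> L2 \<omega>. l2_inner \<omega> f f \<le> 1}"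

definition admissible_state ::
    "real \<Rightarrow> (real \<Rightarrow> real^'n^'n) \<Rightarrow> (real \<Rightarrow> real^'r^'n) \<Rightarrow> (real \<Rightarrow> real^'n) set" where
  "admissible_state \<omega> A B =
     {x. (\<lambda>t. vector_derivative x (at t within {0..\<omega>})) \<in> L2 \<omega> \<and>
         (\<exists>f\<in>admissible_input \<omega>. periodic_solution \<omega> (\<lambda>t. A t *v x t + B t *v f t) x)}"

definition correlation ::
    "'w measure \<Rightarrow> (real \<Rightarrow> 'w \<Rightarrow> real^'m) \<Rightarrow> real \<Rightarrow> real \<Rightarrow> real^'m^'m" where
  "correlation M \<eta> t s = (\<chi> i j. LINT w|M. \<eta> t w $ i * \<eta> s w $ j)"

definition ms_continuous_process ::
    "real \<Rightarrow> 'w measure \<Rightarrow> (real \<Rightarrow> 'w \<Rightarrow> real^'m) \<Rightarrow> bool" where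
  "ms_continuous_process \<omega> M \<eta> \<longleftrightarrow>
     (\<forall>t\<in>{0..\<omega>}. \<eta> t \<in> borel_measurable M \<and> integrable M (\<lambda>w. (norm (\<eta> t w))\<^sup>2)) \<and>
     (\<forall>t\<in>{0..\<omega>}. ((\<lambda>s. LINT w|M. (norm (\<eta> s w - \<eta> t w))\<^sup>2) \<longlongrightarrow> 0) (at t within {0..\<omega>}))"

(* Joint measurability gives the path integral u(y) a meaning as a random variable. Every
   mean-square continuous process has a jointly measurable modification, which has the same
   correlation function, so the set of correlation functions is not affected. *)
definition admissible_noise ::
    "real \<Rightarrow> 'w measure \<Rightarrow> (real \<Rightarrow> 'w \<Rightarrow> real^'m) \<Rightarrow> bool" where
  "admissible_noise \<omega> M \<eta> \<longleftrightarrow>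
     prob_space M \<and>
     case_prod \<eta> \<in> borel_measurable (lebesgue_on {0..\<omega>} \<Otimes>\<^sub>M M) \<and>
     ms_continuous_process \<omega> M \<eta> \<and>
     (\<forall>t\<in>{0..\<omega>}. (LINT w|M. \<eta> t w) = 0) \<and>
     (LINT t|lebesgue_on {0..\<omega>}. trace (correlation M \<eta> t t)) \<le> 1"

definition ms_error ::
    "real \<Rightarrow> (real \<Rightarrow> real^'n^'m) \<Rightarrow> (real \<Rightarrow> real^'n) \<Rightarrow> (real \<Rightarrow> real^'m) \<Rightarrow>
     (real \<Rightarrow> real^'n) \<Rightarrow> 'w measure \<Rightarrow> (real \<Rightarrow> 'w \<Rightarrow> real^'m) \<Rightarrow> ennreal" where
  "ms_error \<omega> H l u x M \<eta> =
     (\<integral>\<^sup>+ w. ennreal ((l2_inner \<omega> l x - l2_inner \<omega> u (\<lambda>t. H t *v x t + \<eta> t w))\<^sup>2) \<partial>M)"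

(* The mean-square error depends on the noise only through its correlation function, so the
   supremum over correlation functions is taken over the processes realizing them. The
   processes live on probability measures over the sample type 'w; every admissible correlation
   function is realized there as soon as 'w is at least as large as the reals. *)
definition guaranteed_error ::
    "'w itself \<Rightarrow> real \<Rightarrow> (real \<Rightarrow> real^'n^'n) \<Rightarrow> (real \<Rightarrow> real^'r^'n) \<Rightarrow> (real \<Rightarrow> real^'n^'m) \<Rightarrow>
     (real \<Rightarrow> real^'n) \<Rightarrow> (real \<Rightarrow> real^'m) \<Rightarrow> ennreal" where
  "guaranteed_error W \<omega> A B H l u =
     Sup {ms_error \<omega> H l u x M \<eta> | x (M :: 'w measure) \<eta>.
            x \<in> admissible_state \<omega> A B \<and> admissible_noise \<omega> M \<eta>}"

definition minimax_error ::
    "'w itself \<Rightarrow> real \<Rightarrow> (real \<Rightarrow> real^'n^'n) \<Rightarrow> (real \<Rightarrow> real^'r^'n) \<Rightarrow> (real \<Rightarrow> real^'n^'m) \<Rightarrow>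
     (real \<Rightarrow> real^'n) \<Rightarrow> ennreal" where
  "minimax_error W \<omega> A B H l = (INF u\<in>L2 \<omega>. guaranteed_error W \<omega> A B H l u)"

definition minimax_estimation ::
    "'w itself \<Rightarrow> real \<Rightarrow> (real \<Rightarrow> real^'n^'n) \<Rightarrow> (real \<Rightarrow> real^'r^'n) \<Rightarrow> (real \<Rightarrow> real^'n^'m) \<Rightarrow>
     (real \<Rightarrow> real^'n) \<Rightarrow> (real \<Rightarrow> real^'m) \<Rightarrow> bool" where
  "minimax_estimation W \<omega> A B H l u \<longleftrightarrow>
     u \<in> L2 \<omega> \<and>
     (\<forall>v\<in>L2 \<omega>. guaranteed_error W \<omega> A B H l u \<le> guaranteed_error W \<omega> A B H l v)"

definition estimation_bvp ::
    "real \<Rightarrow> (real \<Rightarrow> real^'n^'n) \<Rightarrow> (real \<Rightarrow> real^'r^'n) \<Rightarrow> (real \<Rightarrow> real^'n^'m) \<Rightarrow>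
     (real \<Rightarrow> real^'n) \<Rightarrow> (real \<Rightarrow> real^'n) \<Rightarrow> (real \<Rightarrow> real^'n) \<Rightarrow> bool" where
  "estimation_bvp \<omega> A B H l z p \<longleftrightarrow>
     periodic_solution \<omega>
       (\<lambda>t. - (transpose (A t) *v z t) + transpose (H t) *v (H t *v p t) - l t) z \<and>
     periodic_solution \<omega>
       (\<lambda>t. A t *v p t + B t *v (transpose (B t) *v z t)) p"

definition filtering_bvp ::
    "real \<Rightarrow> (real \<Rightarrow> real^'n^'n) \<Rightarrow> (real \<Rightarrow> real^'r^'n) \<Rightarrow> (real \<Rightarrow> real^'n^'m) \<Rightarrow>
     (real \<Rightarrow> real^'m) \<Rightarrow> (real \<Rightarrow> real^'n) \<Rightarrow> (real \<Rightarrow> real^'n) \<Rightarrow> bool" where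
  "filtering_bvp \<omega> A B H y p x \<longleftrightarrow>
     periodic_solution \<omega>
       (\<lambda>t. - (transpose (A t) *v p t) - transpose (H t) *v (y t - H t *v x t)) p \<and>
     periodic_solution \<omega>
       (\<lambda>t. A t *v x t + B t *v (transpose (B t) *v p t)) x"

end

theory Submission
  imports Defs
begin

text \<open>The worst state and noise separate: the guaranteed error of \<open>u\<close> is \<open>\<parallel>u\<parallel>\<^sup>2\<close> plus the supremum of
  \<open>(\<ell> - H' u, x)\<^sup>2\<close> over the admissible states \<open>x\<close>. If \<open>(z, p)\<close> solves the boundary value problem, Green's
  formula for \<open>x' = A x + B f\<close> and its adjoint gives \<open>(\<ell> - H' H p, x) = (B' z, f)\<close>. So the error of
  \<open>H p\<close> is at most \<open>\<parallel>B' z\<parallel>\<^sup>2 + \<parallel>H p\<parallel>\<^sup>2 = (\<ell>, p)\<close>, and testing any other \<open>v\<close> with multiples of \<open>p\<close> shows that its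
  error is at least \<open>(\<ell>, p) + \<parallel>v - H p\<parallel>\<^sup>2\<close>, which yields optimality and uniqueness at once. Solvability is a
  Fredholm alternative for the Hamiltonian system, whose solution flow is symplectic.\<close>

subsection \<open>Absolutely continuous functions\<close>

text \<open>The states driven by \<open>f = 0\<close> form the span of the \<open>\<psi> k\<close>,
  so the error of \<open>u\<close> is infinite unless \<open>\<ell> - H' u\<close> is orthogonal to
  that span; independence of the \<open>H \<psi> k\<close> is what lets some \<open>u\<close>
  achieve this. In the Hamiltonian system it acts as follows: for \<open>\<ell> = 0\<close> an
  energy identity forces \<open>H p = 0\<close> and \<open>B' z = 0\<close>, so \<open>p\<close> is
  a periodic solution of \<open>x' = A x\<close> invisible to \<open>H\<close>, hence zero. The
  component \<open>z\<close> may survive, so the problem can have several solutions, but the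
  Fredholm condition is \<open>(\<ell>, p) = 0\<close> for the homogeneous ones and holds because
  their \<open>p\<close> vanishes. The worst noise would have amplitude proportional to
  \<open>u\<close>, which is merely square integrable, while noise has to be mean-square continuous;
  hence the density argument. Absolute continuity is the epsilon-delta notion, so both halves of the
  Lebesgue fundamental theorem are needed: integrating derivatives gives Green's formula,
  differentiating integrals solves equations with square integrable forcing.\<close>

lemma AE_lebesgue_on_negligibleE:
  assumes "S \<in> sets lebesgue" "AE t in lebesgue_on S. P t"
  obtains N where "negligible N" "\<And>t. t \<in> S - N \<Longrightarrow> P t"
proof -
  have "AE t in lebesgue. t \<in> S \<longrightarrow> P t"
    using assms by (simp add: AE_restrict_space_iff)
  then obtain N where "negligible N" "{t. \<not> (t \<in> S \<longrightarrow> P t)} \<subseteq> N"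
    by (auto simp: eventually_ae_filter_negligible)
  then show ?thesis using that by blast
qed

lemma AE_lebesgue_on_negligibleI:
  assumes "S \<in> sets lebesgue" "negligible N" "\<And>t. t \<in> S - N \<Longrightarrow> P t"
  shows "AE t in lebesgue_on S. P t"
proof -
  have "AE t in lebesgue. t \<in> S \<longrightarrow> P t"
    using assms by (auto simp: eventually_ae_filter_negligible)
  then show ?thesis
    using assms by (simp add: AE_restrict_space_iff)
qed

text \<open>The derivative is unknown on a null set, and absolute continuity makes the increments
  there harmless. At tags off that set the gauge comes from differentiability; at tags in it the
  gauge confines the intervals to an open set of measure below \<delta>. Integrability of
  \<open>g\<close> is part of the conclusion, as the gauge integral permits.\<close>

lemma has_integral_of_abs_cont_on:
  fixes f :: "real \<Rightarrow> 'a::euclidean_space"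
  assumes "a < b" and ac: "abs_cont_on {a..b} f"
    and deriv: "AE t in lebesgue_on {a..b}. (f has_vector_derivative g t) (at t within {a..b})"
  shows "(g has_integral f b - f a) {a..b}"
proof -
  obtain N where N: "negligible N"
    and d: "\<And>t. t \<in> {a..b} - N \<Longrightarrow> (f has_vector_derivative g t) (at t within {a..b})"
    using AE_lebesgue_on_negligibleE[OF _ deriv] by auto
  \<comment> \<open>Zeroing \<open>g\<close> on \<open>N\<close> removes the Riemann terms of the
    bad tags, so only the increments of \<open>f\<close> are left there; the integral does not see
    the change.\<close>
  define h where "h t = (if t \<in> N then 0 else g t)" for t
  have "(h has_integral f b - f a) (cbox a b)"
    unfolding has_integral
  proof (intro allI impI)
    fix e :: real assume "e > 0"
    define e' where "e' = e / 4 / (b - a)"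
    have "e' > 0" using \<open>e > 0\<close> \<open>a < b\<close> by (simp add: e'_def)
    have "b - a \<noteq> 0" using \<open>a < b\<close> by simp
    then have e'ba: "e' * (b - a) = e / 4"
      using nonzero_eq_divide_eq[of "b - a" e' "e / 4"] e'_def by blast
    have "e / 4 > 0" using \<open>e > 0\<close> by simp
    then obtain \<delta> where "\<delta> > 0" and \<delta>: "\<And>D. D division_of \<Union>D \<Longrightarrow> \<Union>D \<subseteq> {a..b} \<Longrightarrow>
        (\<Sum>k\<in>D. Sup k - Inf k) < \<delta> \<Longrightarrow> (\<Sum>k\<in>D. norm (f (Sup k) - f (Inf k))) < e / 4"
      using ac unfolding abs_cont_on_def by (metis (no_types, lifting))
    have "N \<in> sets lebesgue" using N negligible_imp_sets by blast
    then obtain G where G: "open G" "N \<subseteq> G" "(G - N) \<in> lmeasurable"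
        "emeasure lebesgue (G - N) < ennreal \<delta>"
      using sets_lebesgue_outer_open \<open>\<delta> > 0\<close> by metis
    have GN: "G = (G - N) \<union> N" using G(2) by auto
    have G': "G \<in> lmeasurable"
      using GN G(3) N by (metis fmeasurable.Un negligible_imp_measurable)
    have "measure lebesgue G = measure lebesgue (G - N)"
      using N G' by (simp add: measure_Diff_null_set negligible_iff_null_sets fmeasurableD)
    then have mG: "measure lebesgue G < \<delta>"
      using G(3,4) \<open>\<delta> > 0\<close> by (simp add: emeasure_eq_measure2 ennreal_less_iff)
    have "\<exists>r>0. \<forall>s\<in>{a..b}. norm (s - t) < r \<longrightarrow> norm (f s - f t - (s - t) *\<^sub>R g t) \<le> e' * norm (s - t)"
      if "t \<in> {a..b} - N" for t
      using d[OF that] \<open>e' > 0\<close> unfolding has_vector_derivative_def has_derivative_within_alt by blast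
    then obtain r where r: "\<And>t. t \<in> {a..b} - N \<Longrightarrow> r t > 0"
      "\<And>t s. t \<in> {a..b} - N \<Longrightarrow> s \<in> {a..b} \<Longrightarrow> norm (s - t) < r t \<Longrightarrow>
         norm (f s - f t - (s - t) *\<^sub>R g t) \<le> e' * norm (s - t)"
      by metis
    have "\<exists>q>0. ball t q \<subseteq> G" if "t \<in> N" for t
      using that G(1,2) open_contains_ball by blast
    then obtain q where q: "\<And>t. t \<in> N \<Longrightarrow> q t > 0" "\<And>t. t \<in> N \<Longrightarrow> ball t (q t) \<subseteq> G"
      by metis
    define \<rho> where "\<rho> t = (if t \<in> N then q t else if t \<in> {a..b} then r t else 1)" for t
    define \<gamma> where "\<gamma> t = ball t (\<rho> t)" for t
    have "gauge \<gamma>"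
      unfolding \<gamma>_def by (rule gauge_ball_dependent) (use r q in \<open>auto simp: \<rho>_def\<close>)
    moreover have "norm ((\<Sum>(x,k)\<in>p. measure lborel k *\<^sub>R h x) - (f b - f a)) < e"
      if p: "p tagged_division_of cbox a b" "\<gamma> fine p" for p
    proof -
      note pD = tagged_division_ofD[OF p(1)]
      define T where "T = (\<lambda>(x,k). measure lborel k *\<^sub>R h x - (f (Sup k) - f (Inf k)))"
      have "(\<Sum>(x,k)\<in>p. f (Sup k) - f (Inf k)) = f b - f a"
        using additive_tagged_division_1[of a b p f] p(1) \<open>a < b\<close> by simp
      then have eq: "(\<Sum>(x,k)\<in>p. measure lborel k *\<^sub>R h x) - (f b - f a) = sum T p"
        unfolding T_def by (simp add: sum_subtractf split_def)
      define p1 where "p1 = {xk\<in>p. fst xk \<in> N}"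
      define p2 where "p2 = {xk\<in>p. fst xk \<notin> N}"
      have split: "sum T p = sum T p1 + sum T p2"
        using pD(1) by (subst sum.union_disjoint[symmetric]) (auto simp: p1_def p2_def intro!: sum.cong)
      have ivl: "\<exists>u v. k = {u..v} \<and> u \<le> x \<and> x \<le> v \<and> a \<le> u \<and> v \<le> b \<and> {u..v} \<subseteq> ball x (\<rho> x)"
        if xk: "(x,k) \<in> p" for x k
      proof -
        obtain u v where uv: "k = {u..v}" using pD(4)[OF xk] by auto
        moreover have "x \<in> k" "k \<subseteq> {a..b}" "k \<subseteq> ball x (\<rho> x)"
          using pD(2,3)[OF xk] p(2) xk by (auto simp: fine_def \<gamma>_def)
        ultimately show ?thesis by auto
      qed
      have b2: "norm (T (x,k)) \<le> e' * measure lborel k" if xk: "(x,k) \<in> p2" for x k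
      proof -
        from xk have "(x,k) \<in> p" "x \<notin> N" by (auto simp: p2_def)
        from ivl[OF this(1)] obtain u v where uv: "k = {u..v}" "u \<le> x" "x \<le> v" "a \<le> u" "v \<le> b"
          "{u..v} \<subseteq> ball x (\<rho> x)" by blast
        have x: "x \<in> {a..b} - N" using uv \<open>x \<notin> N\<close> by auto
        have "u \<in> ball x (\<rho> x)" "v \<in> ball x (\<rho> x)" 
          using subsetD[OF uv(6), of u] subsetD[OF uv(6), of v] uv(2,3) by auto
        then have "norm (u - x) < r x" "norm (v - x) < r x"
          using x by (auto simp: \<rho>_def dist_real_def)
        then have "norm (f u - f x - (u - x) *\<^sub>R g x) \<le> e' * norm (u - x)"
             "norm (f v - f x - (v - x) *\<^sub>R g x) \<le> e' * norm (v - x)"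
          using uv by (intro r(2)[OF x]; simp)+
        \<comment> \<open>The tag lies between the endpoints, so the errors on its two sides are at
          most \<open>e'\<close> times \<open>(x - u) + (v - x)\<close>, which is the length of
          \<open>k\<close>.\<close>
        moreover have "T (x,k) = (f u - f x - (u - x) *\<^sub>R g x) - (f v - f x - (v - x) *\<^sub>R g x)"
          using uv x by (simp add: T_def h_def algebra_simps)
        ultimately have "norm (T (x,k)) \<le> e' * norm (u - x) + e' * norm (v - x)"
          by (smt (verit) norm_triangle_ineq4)
        also have "\<dots> = e' * measure lborel k" using uv by (simp add: algebra_simps)
        finally show ?thesis .
      qed
      have "norm (sum T p2) \<le> (\<Sum>xk\<in>p2. e' * measure lborel (snd xk))"
        by (rule sum_norm_le) (use b2 in auto)
      also have "\<dots> \<le> (\<Sum>xk\<in>p. e' * measure lborel (snd xk))"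
        by (rule sum_mono2) (use pD(1) \<open>e' > 0\<close> in \<open>auto simp: p2_def\<close>)
      also have "\<dots> = e' * (\<Sum>(x,k)\<in>p. measure lborel k)"
        by (simp add: sum_distrib_left split_def)
      also have "\<dots> = e / 4"
        using additive_content_tagged_division[OF p(1)] \<open>a < b\<close> e'ba by simp
      finally have s2: "norm (sum T p2) \<le> e / 4" .
      define D where "D = snd ` p1"
      have p1: "p1 tagged_partial_division_of cbox a b"
        using p(1) by (auto simp: p1_def tagged_division_of_def intro: tagged_partial_division_subset)
      have D: "D division_of \<Union>D"
        unfolding D_def by (rule partial_division_of_tagged_division[OF p1])
      have DG: "\<Union>D \<subseteq> G \<inter> {a..b}"
      proof
        fix y assume "y \<in> \<Union>D"
        then obtain x k where xk: "(x,k) \<in> p" "x \<in> N" "y \<in> k" by (auto simp: D_def p1_def)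
        then have "k \<subseteq> ball x (\<rho> x)" using p(2) by (auto simp: fine_def \<gamma>_def)
        then show "y \<in> G \<inter> {a..b}" using xk q(2) pD(3)[OF xk(1)] by (auto simp: \<rho>_def)
      qed
      have "(\<Sum>k\<in>D. Sup k - Inf k) = (\<Sum>k\<in>D. measure lebesgue k)"
      proof (rule sum.cong[OF refl])
        fix k assume "k \<in> D"
        then obtain x where "(x,k) \<in> p" by (auto simp: D_def p1_def)
        from ivl[OF this] show "Sup k - Inf k = measure lebesgue k" by auto
      qed
      also have "\<dots> = measure lebesgue (\<Union>D)" by (rule content_division[OF D])
      also have "\<dots> \<le> measure lebesgue G"
        using D DG G' by (intro measure_mono_fmeasurable) (auto simp: lmeasurable_division fmeasurableD)
      also have "\<dots> < \<delta>" by (rule mG)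
      finally have "(\<Sum>k\<in>D. norm (f (Sup k) - f (Inf k))) < e / 4"
        using D DG by (intro \<delta>) auto
      moreover have "(\<Sum>(x,k)\<in>p1. norm (f (Sup k) - f (Inf k))) = (\<Sum>k\<in>D. norm (f (Sup k) - f (Inf k)))"
      proof -
        \<comment> \<open>Two tags can share an interval only if it is degenerate, where the
          increment is 0, so the tagged sum equals the sum over intervals. The value 0 at
          \<open>{}\<close> replaces the unspecified \<open>Sup {}\<close> and
          \<open>Inf {}\<close>.\<close>
        define \<nu> where "\<nu> k = (if k = {} then 0 else norm (f (Sup k) - f (Inf k)))" for k
        have over: "(\<Sum>(x,k)\<in>p1. \<nu> k) = (\<Sum>k\<in>D. \<nu> k)"
          unfolding D_def
        proof (rule sum.over_tagged_division_lemma[OF tagged_partial_division_of_Union_self[OF p1]])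
          fix u v :: real assume "box u v = {}"
          then have "v \<le> u" by simp
          then show "\<nu> (cbox u v) = 0"
            unfolding \<nu>_def by (cases "u = v") auto
        qed
        have ne: "k \<noteq> {}" if "(x,k) \<in> p1" for x k
          using that pD(2) by (auto simp: p1_def)
        have "(\<Sum>(x,k)\<in>p1. norm (f (Sup k) - f (Inf k))) = (\<Sum>(x,k)\<in>p1. \<nu> k)"
          by (rule sum.cong) (use ne in \<open>auto simp: \<nu>_def\<close>)
        moreover have "(\<Sum>k\<in>D. norm (f (Sup k) - f (Inf k))) = (\<Sum>k\<in>D. \<nu> k)"
          by (rule sum.cong) (use ne in \<open>auto simp: \<nu>_def D_def\<close>)
        ultimately show ?thesis using over by simp
      qed
      moreover have "norm (sum T p1) \<le> (\<Sum>(x,k)\<in>p1. norm (f (Sup k) - f (Inf k)))"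
        by (rule sum_norm_le) (auto simp: p1_def T_def h_def norm_minus_commute)
      ultimately have "norm (sum T p1) < e / 4" by simp
      with s2 have "norm (sum T p) < e"
        unfolding split using \<open>e > 0\<close> norm_triangle_ineq[of "sum T p1" "sum T p2"] by linarith
      then show ?thesis by (simp add: eq)
    qed
    ultimately show "\<exists>\<gamma>. gauge \<gamma> \<and> (\<forall>\<D>. \<D> tagged_division_of cbox a b \<and> \<gamma> fine \<D> \<longrightarrow>
        norm ((\<Sum>(x,k)\<in>\<D>. measure lborel k *\<^sub>R h x) - (f b - f a)) < e)"
      by (intro exI[of _ \<gamma>]) simp
  qed
  then have "(h has_integral f b - f a) {a..b}" by simp
  then show ?thesis
    by (rule has_integral_spike[OF N, rotated]) (auto simp: h_def)
qed

text \<open>The Vitali covering theorem, applied to the intervals on which the Henstock estimate is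
  violated by a fixed proportion, shows that these cover only a negligible set of tags.\<close>

lemma indefinite_integral_has_vector_derivative_AE:
  fixes f :: "real \<Rightarrow> 'a::euclidean_space"
  assumes f: "f integrable_on {a..b}"
  shows "AE t in lebesgue_on {a..b}.
    ((\<lambda>u. integral {a..u} f) has_vector_derivative f t) (at t within {a..b})"
proof -
  \<comment> \<open>The tag is an endpoint because only then does the violated estimate concern a
    difference quotient at \<open>t\<close>. The thresholds \<open>1 / Suc n\<close> exhaust all
    positive tolerances.\<close>
  define bad where "bad n t c s \<longleftrightarrow> c < s \<and> a \<le> c \<and> s \<le> b \<and> (t = c \<or> t = s) \<and>
      norm ((s - c) *\<^sub>R f t - integral {c..s} f) > (s - c) / real (Suc n)" for n t c s
  define E where "E n = {t\<in>{a..b}. \<forall>d>0. \<exists>c s. s - c < d \<and> bad n t c s}" for n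
  have neg: "negligible (E n)" for n
    unfolding negligible_outer_le
  proof (intro allI impI)
    fix e :: real assume "e > 0"
    then have e': "e / real (Suc n) > 0" by simp
    have f': "f integrable_on cbox a b" using f by simp
    obtain \<gamma> where "gauge \<gamma>"
      and \<gamma>: "\<And>p. p tagged_partial_division_of cbox a b \<Longrightarrow> \<gamma> fine p \<Longrightarrow>
          (\<Sum>(x,k)\<in>p. norm (measure lborel k *\<^sub>R f x - integral k f)) < e / real (Suc n)"
      by (rule Henstock_lemma[OF f' e']) blast
    define K where "K = {(t,c,s). t \<in> E n \<and> bad n t c s \<and> {c..s} \<subseteq> \<gamma> t}"
    define m where "m = (\<lambda>(t::real,c::real,s::real). (c + s) / 2)"
    define r where "r = (\<lambda>(t::real,c::real,s::real). (s - c) / 2)"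
    have cb: "cball (m i) (r i) = {fst (snd i)..snd (snd i)}" for i
      by (auto simp: m_def r_def cball_eq_atLeastAtMost split_def field_simps)
    have fine: "\<exists>i. i \<in> K \<and> x \<in> cball (m i) (r i) \<and> r i < d" if x: "x \<in> E n" "0 < d" for x d
    proof -
      obtain q where q: "q > 0" "ball x q \<subseteq> \<gamma> x"
        using \<open>gauge \<gamma>\<close> by (metis gauge_def open_contains_ball)
      then have "min q d > 0" using x by simp
      then obtain c s where cs: "s - c < min q d" "bad n x c s"
        using x unfolding E_def by blast
      have "{c..s} \<subseteq> ball x q" using cs by (auto simp: bad_def dist_real_def)
      then have "(x,c,s) \<in> K" using q cs x by (auto simp: K_def)
      moreover have "x \<in> cball (m (x,c,s)) (r (x,c,s))"
        unfolding cb using cs by (auto simp: bad_def)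
      moreover have "r (x,c,s) < d" using cs by (auto simp: r_def bad_def)
      ultimately show ?thesis by blast
    qed
    have pos: "0 < r i" if "i \<in> K" for i
      using that by (auto simp: K_def r_def bad_def)
    obtain C where C: "countable C" "C \<subseteq> K"
      "pairwise (\<lambda>i j. disjnt (cball (m i) (r i)) (cball (m j) (r j))) C"
      "negligible (E n - (\<Union>i\<in>C. cball (m i) (r i)))"
      by (rule Vitali_covering_theorem_cballs[of K r "E n" m, OF pos fine]) blast
    define U where "U = (\<Union>i\<in>C. cball (m i) (r i))"
    \<comment> \<open>On each selected interval the Henstock error exceeds the length divided by
      \<open>Suc n\<close>. By disjointness a finite selection is a fine partial division, so the
      errors sum to less than \<open>e / Suc n\<close>, and therefore the lengths to less than
      \<open>e\<close>.\<close>
    have bound: "measure lebesgue (\<Union>i\<in>F. cball (m i) (r i)) \<le> e" if F: "F \<subseteq> C" "finite F" for F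
    proof -
      define \<phi> where "\<phi> = (\<lambda>i::real\<times>real\<times>real. (fst i, {fst (snd i)..snd (snd i)}))"
      have ne: "fst (snd i) < snd (snd i)" if "i \<in> F" for i
        using that F C(2) by (auto simp: K_def bad_def)
      have dis: "{fst (snd i)..snd (snd i)} \<inter> {fst (snd j)..snd (snd j)} = {}"
        if "i \<in> F" "j \<in> F" "i \<noteq> j" for i j
      proof -
        have "disjnt (cball (m i) (r i)) (cball (m j) (r j))"
          using C(3) that F unfolding pairwise_def by blast
        then show ?thesis unfolding cb disjnt_def .
      qed
      have inj: "inj_on \<phi> F"
      proof (rule inj_onI)
        fix i j assume "i \<in> F" "j \<in> F" "\<phi> i = \<phi> j"
        then show "i = j" using dis[of i j] ne[of i] unfolding \<phi>_def by force
      qed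
      have "(\<phi> ` F) tagged_partial_division_of cbox a b"
        unfolding tagged_partial_division_of_def
      proof (intro conjI allI impI)
        show "finite (\<phi> ` F)" using F by simp
      next
        fix x k assume "(x, k) \<in> \<phi> ` F"
        then obtain c s where i: "(x,c,s) \<in> F" "k = {c..s}" by (force simp: \<phi>_def)
        then have "(x,c,s) \<in> K" using F C by auto
        then show "x \<in> k" "k \<subseteq> cbox a b" "\<exists>a b. k = cbox a b"
          using i by (auto simp: K_def bad_def)
      next
        fix x1 k1 x2 k2
        assume "(x1, k1) \<in> \<phi> ` F \<and> (x2, k2) \<in> \<phi> ` F \<and> (x1, k1) \<noteq> (x2, k2)"
        then obtain i j where ij: "i \<in> F" "j \<in> F" "(x1, k1) = \<phi> i" "(x2, k2) = \<phi> j" "\<phi> i \<noteq> \<phi> j"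
          by (metis imageE)
        then have "i \<noteq> j" "k1 = {fst (snd i)..snd (snd i)}" "k2 = {fst (snd j)..snd (snd j)}"
          by (auto simp: \<phi>_def)
        with dis[of i j] ij have "k1 \<inter> k2 = {}" by simp
        then show "interior k1 \<inter> interior k2 = {}"
          using interior_subset by blast
      qed
      moreover have "\<gamma> fine (\<phi> ` F)"
        using F C(2) by (force simp: fine_def \<phi>_def K_def)
      ultimately have "(\<Sum>(x,k)\<in>\<phi> ` F. norm (measure lborel k *\<^sub>R f x - integral k f)) < e / real (Suc n)"
        by (rule \<gamma>)
      then have lt: "(\<Sum>i\<in>F. norm (measure lborel {fst (snd i)..snd (snd i)} *\<^sub>R f (fst i)
            - integral {fst (snd i)..snd (snd i)} f)) < e / real (Suc n)"
        unfolding sum.reindex[OF inj] by (simp add: \<phi>_def)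
      have "(\<Sum>i\<in>F. (snd (snd i) - fst (snd i)) / real (Suc n)) \<le>
          (\<Sum>i\<in>F. norm (measure lborel {fst (snd i)..snd (snd i)} *\<^sub>R f (fst i)
            - integral {fst (snd i)..snd (snd i)} f))"
      proof (rule sum_mono)
        fix i assume "i \<in> F"
        then have "i \<in> K" using F C by auto
        then show "(snd (snd i) - fst (snd i)) / real (Suc n) \<le>
          norm (measure lborel {fst (snd i)..snd (snd i)} *\<^sub>R f (fst i)
            - integral {fst (snd i)..snd (snd i)} f)"
          by (auto simp: K_def bad_def split_def less_imp_le)
      qed
      with lt have "(\<Sum>i\<in>F. snd (snd i) - fst (snd i)) / real (Suc n) < e / real (Suc n)"
        by (simp add: sum_divide_distrib)
      then have *: "(\<Sum>i\<in>F. snd (snd i) - fst (snd i)) < e"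
        by (simp add: divide_less_cancel)
      have "measure lebesgue (\<Union>i\<in>F. cball (m i) (r i)) \<le> (\<Sum>i\<in>F. measure lebesgue (cball (m i) (r i)))"
        using F by (intro measure_UNION_le) auto
      also have "\<dots> = (\<Sum>i\<in>F. snd (snd i) - fst (snd i))"
        unfolding cb using ne by (intro sum.cong) (auto simp: less_imp_le)
      finally show ?thesis using * by simp
    qed
    have U: "U \<in> lmeasurable" "measure lebesgue U \<le> e"
      unfolding U_def
      by (rule fmeasurable_UN_bound[OF C(1) lmeasurable_cball bound]
          measure_UN_bound[OF C(1) lmeasurable_cball bound]; assumption)+
    have NU: "negligible (E n - U)" using C(4) by (simp add: U_def)
    have "measure lebesgue (U \<union> (E n - U)) = measure lebesgue U"
      using NU U(1) by (metis measure_Un_null_set negligible_iff_null_sets fmeasurableD)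
    then show "\<exists>T. E n \<subseteq> T \<and> T \<in> lmeasurable \<and> measure lebesgue T \<le> e"
      using U fmeasurable.Un[OF U(1) negligible_imp_measurable[OF NU]]
      by (intro exI[of _ "U \<union> (E n - U)"]) auto
  qed
  show ?thesis
  proof (rule AE_lebesgue_on_negligibleI)
    show "negligible (\<Union>n. E n)" using neg by (intro negligible_countable_Union) auto
    fix t assume t: "t \<in> {a..b} - (\<Union>n. E n)"
    show "((\<lambda>u. integral {a..u} f) has_vector_derivative f t) (at t within {a..b})"
      unfolding has_vector_derivative_def has_derivative_within_alt
    proof (intro conjI allI impI)
      show "bounded_linear (\<lambda>x. x *\<^sub>R f t)" by (simp add: bounded_linear_scaleR_left)
      fix e :: real assume "e > 0"
      then obtain n where n: "inverse (real (Suc n)) < e" using reals_Archimedean by blast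
      from t have "t \<notin> E n" by auto
      with t obtain d where d: "d > 0" "\<And>c s. s - c < d \<Longrightarrow> \<not> bad n t c s"
        unfolding E_def by blast
      have main: "norm ((s - c) *\<^sub>R f t - integral {c..s} f) \<le> e * (s - c)"
        if "a \<le> c" "c < s" "s \<le> b" "s - c < d" "t = c \<or> t = s" for c s
      proof -
        have "norm ((s - c) *\<^sub>R f t - integral {c..s} f) \<le> (s - c) / real (Suc n)"
          using d(2)[of s c] that by (auto simp: bad_def not_less)
        also have "\<dots> \<le> e * (s - c)"
          using mult_right_mono[OF less_imp_le[OF n], of "s - c"] that by (simp add: field_simps)
        finally show ?thesis .
      qed
      have comb: "integral {a..s} f - integral {a..c} f = integral {c..s} f"
        if "a \<le> c" "c \<le> s" "s \<le> b" for c s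
      proof -
        have "f integrable_on {a..s}" using f that
          by (auto intro: integrable_on_subinterval)
        from Henstock_Kurzweil_Integration.integral_combine[OF that(1,2) this] show ?thesis
          by (simp add: algebra_simps)
      qed
      have "norm (integral {a..y} f - integral {a..t} f - (y - t) *\<^sub>R f t) \<le> e * norm (y - t)"
        if y: "y \<in> {a..b}" "norm (y - t) < d" for y
      proof -
        consider "y = t" | "t < y" | "y < t" by linarith
        then show ?thesis
        proof cases
          case 1 then show ?thesis by simp
        next
          case 2
          then show ?thesis using main[of t y] comb[of t y] y t
            by (auto simp: norm_minus_commute)
        next
          case 3
          have "integral {a..y} f - integral {a..t} f - (y - t) *\<^sub>R f t
             = (t - y) *\<^sub>R f t - integral {y..t} f"
            using comb[of y t] 3 y t by (simp add: algebra_simps flip: comb[of y t])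
          then show ?thesis using main[of y t] 3 y t by auto
        qed
      qed
      then show "\<exists>d>0. \<forall>y\<in>{a..b}. norm (y - t) < d \<longrightarrow>
          norm (integral {a..y} f - integral {a..t} f - (y - t) *\<^sub>R f t) \<le> e * norm (y - t)"
        using d(1) by blast
    qed
  qed auto
qed

section \<open>Criteria for absolute continuity\<close>

lemma abs_cont_onE:
  fixes x :: "real \<Rightarrow> 'a::real_normed_vector"
  assumes "abs_cont_on S x" "e > 0"
  obtains d where "d > 0" "\<And>D. D division_of \<Union>D \<Longrightarrow> \<Union>D \<subseteq> S \<Longrightarrow>
     (\<Sum>k\<in>D. Sup k - Inf k) < d \<Longrightarrow> (\<Sum>k\<in>D. norm (x (Sup k) - x (Inf k))) < e"
  using assms unfolding abs_cont_on_def by (metis (no_types, lifting))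

lemma division_of_intervalD:
  fixes D :: "real set set"
  assumes "D division_of \<Union>D" "\<Union>D \<subseteq> S" "k \<in> D"
  shows "Inf k \<in> S" "Sup k \<in> S" "Inf k \<le> Sup k" "k = {Inf k..Sup k}"
proof -
  obtain u v where "k = cbox u v" "k \<noteq> {}" using division_ofD(3,4)[OF assms(1,3)] by blast
  then have uv: "k = {u..v}" "u \<le> v" by auto
  have "k \<subseteq> S" using assms(2,3) by blast
  with uv have "u \<in> S" "v \<in> S" by auto
  with uv show "Inf k \<in> S" "Sup k \<in> S" "Inf k \<le> Sup k" "k = {Inf k..Sup k}" by auto
qed

text \<open>One comparison of increments that yields sums, bounded linear images, inner products
  and, with the identity as \<open>y\<close> and \<open>z\<close>, Lipschitz functions.\<close>

lemma abs_cont_on_dominated: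
  fixes x :: "real \<Rightarrow> 'a::real_normed_vector" and y :: "real \<Rightarrow> 'b::real_normed_vector"
    and z :: "real \<Rightarrow> 'c::real_normed_vector"
  assumes y: "abs_cont_on S y" and z: "abs_cont_on S z"
    and le: "\<And>s t. s \<in> S \<Longrightarrow> t \<in> S \<Longrightarrow> norm (x t - x s) \<le> C * (norm (y t - y s) + norm (z t - z s))"
  shows "abs_cont_on S x"
  unfolding abs_cont_on_def
proof (intro allI impI)
  fix e :: real assume "e > 0"
  \<comment> \<open>The sign of \<open>C\<close> is not prescribed; a positive majorant can be
    divided by.\<close>
  define C' where "C' = max C 1"
  have C': "C' > 0" "C \<le> C'" by (auto simp: C'_def)
  then have e': "e / (2 * C') > 0" using \<open>e > 0\<close> by simp
  obtain d1 where d1: "d1 > 0" "\<And>D. D division_of \<Union>D \<Longrightarrow> \<Union>D \<subseteq> S \<Longrightarrow>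
     (\<Sum>k\<in>D. Sup k - Inf k) < d1 \<Longrightarrow> (\<Sum>k\<in>D. norm (y (Sup k) - y (Inf k))) < e / (2 * C')"
    by (rule abs_cont_onE[OF y e']) blast
  obtain d2 where d2: "d2 > 0" "\<And>D. D division_of \<Union>D \<Longrightarrow> \<Union>D \<subseteq> S \<Longrightarrow>
     (\<Sum>k\<in>D. Sup k - Inf k) < d2 \<Longrightarrow> (\<Sum>k\<in>D. norm (z (Sup k) - z (Inf k))) < e / (2 * C')"
    by (rule abs_cont_onE[OF z e']) blast
  have "(\<Sum>k\<in>D. norm (x (Sup k) - x (Inf k))) < e"
    if D: "D division_of \<Union>D" "\<Union>D \<subseteq> S" "(\<Sum>k\<in>D. Sup k - Inf k) < min d1 d2" for D
  proof -
    have "(\<Sum>k\<in>D. norm (x (Sup k) - x (Inf k))) \<le>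
        (\<Sum>k\<in>D. C' * (norm (y (Sup k) - y (Inf k)) + norm (z (Sup k) - z (Inf k))))"
    proof (rule sum_mono)
      fix k assume "k \<in> D"
      note k = division_of_intervalD[OF D(1,2) this]
      have "norm (x (Sup k) - x (Inf k)) \<le> C * (norm (y (Sup k) - y (Inf k)) + norm (z (Sup k) - z (Inf k)))"
        by (rule le) (use k in auto)
      also have "\<dots> \<le> C' * (norm (y (Sup k) - y (Inf k)) + norm (z (Sup k) - z (Inf k)))"
        by (rule mult_right_mono) (use C' in auto)
      finally show "norm (x (Sup k) - x (Inf k)) \<le> C' * (norm (y (Sup k) - y (Inf k)) + norm (z (Sup k) - z (Inf k)))" .
    qed
    also have "\<dots> = C' * ((\<Sum>k\<in>D. norm (y (Sup k) - y (Inf k))) + (\<Sum>k\<in>D. norm (z (Sup k) - z (Inf k))))"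
      by (simp add: sum.distrib flip: sum_distrib_left)
    also have "\<dots> < C' * (e / (2 * C') + e / (2 * C'))"
      using d1(2)[of D] d2(2)[of D] D C' by (intro mult_strict_left_mono add_strict_mono) auto
    also have "\<dots> = e" using C' by simp
    finally show ?thesis .
  qed
  moreover have "min d1 d2 > 0" using d1 d2 by simp
  ultimately show "\<exists>d>0. \<forall>D. D division_of \<Union>D \<and> \<Union>D \<subseteq> S \<and> (\<Sum>k\<in>D. Sup k - Inf k) < d \<longrightarrow>
      (\<Sum>k\<in>D. norm (x (Sup k) - x (Inf k))) < e"
    by blast
qed

lemma abs_cont_on_imp_continuous_on:
  fixes x :: "real \<Rightarrow> 'a::real_normed_vector"
  assumes "abs_cont_on {a..b} x"
  shows "continuous_on {a..b} x"
  unfolding continuous_on_iff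
proof (intro ballI allI impI)
  fix t e :: real assume t: "t \<in> {a..b}" and "e > 0"
  obtain d where d: "d > 0" "\<And>D. D division_of \<Union>D \<Longrightarrow> \<Union>D \<subseteq> {a..b} \<Longrightarrow>
     (\<Sum>k\<in>D. Sup k - Inf k) < d \<Longrightarrow> (\<Sum>k\<in>D. norm (x (Sup k) - x (Inf k))) < e"
    by (rule abs_cont_onE[OF assms \<open>e > 0\<close>]) blast
  have *: "norm (x v - x u) < e" if "u \<in> {a..b}" "v \<in> {a..b}" "u \<le> v" "v - u < d" for u v
  proof -
    have "{cbox u v} division_of cbox u v"
      by (rule division_of_self) (use that in auto)
    then show ?thesis using d(2)[of "{cbox u v}"] that by auto
  qed
  have "dist (x s) (x t) < e" if "s \<in> {a..b}" "dist s t < d" for s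
    using *[of s t] *[of t s] that t by (cases "s \<le> t") (auto simp: dist_norm dist_real_def norm_minus_commute)
  then show "\<exists>d>0. \<forall>s\<in>{a..b}. dist s t < d \<longrightarrow> dist (x s) (x t) < e"
    using d(1) by blast
qed

lemma abs_cont_on_id: "abs_cont_on S (\<lambda>t::real. t)"
  unfolding abs_cont_on_def
proof (intro allI impI exI conjI)
  fix e :: real and D :: "real set set"
  assume "e > 0" then show "e > 0" .
  assume D: "D division_of \<Union>D \<and> \<Union>D \<subseteq> S \<and> (\<Sum>k\<in>D. Sup k - Inf k) < e"
  have "norm (Sup k - Inf k) = Sup k - Inf k" if "k \<in> D" for k
    using division_of_intervalD(3)[of D S k] D that by simp
  then have "(\<Sum>k\<in>D. norm (Sup k - Inf k)) = (\<Sum>k\<in>D. Sup k - Inf k)"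
    by (rule sum.cong[OF refl])
  then show "(\<Sum>k\<in>D. norm (Sup k - Inf k)) < e" using D by simp
qed

text \<open>A bounded derivative makes \<open>x\<close> Lipschitz. This brings the classical
  solutions found by Picard iteration into the absolutely continuous setting.\<close>

lemma abs_cont_on_C1:
  fixes x :: "real \<Rightarrow> 'a::real_normed_vector"
  assumes x: "\<And>t. t \<in> {a..b} \<Longrightarrow> (x has_vector_derivative g t) (at t within {a..b})"
    and g: "continuous_on {a..b} g"
  shows "abs_cont_on {a..b} x"
proof -
  have "compact (g ` {a..b})" by (rule compact_continuous_image[OF g]) simp
  then obtain L where L: "\<And>t. t \<in> {a..b} \<Longrightarrow> norm (g t) \<le> L"
    by (metis bounded_iff compact_imp_bounded imageI)
  show ?thesis
  proof (rule abs_cont_on_dominated[OF abs_cont_on_id abs_cont_on_id])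
    fix s t assume st: "s \<in> {a..b}" "t \<in> {a..b}"
    have "norm (x t - x s) \<le> L * norm (t - s)"
    proof (rule differentiable_bound[of "{a..b}" x "\<lambda>t h. h *\<^sub>R g t"])
      fix u assume u: "u \<in> {a..b}"
      show "(x has_derivative (\<lambda>h. h *\<^sub>R g u)) (at u within {a..b})"
        using x[OF u] by (simp add: has_vector_derivative_def)
      show "onorm (\<lambda>h. h *\<^sub>R g u) \<le> L"
        using L[OF u] by (simp add: onorm_scaleR_left_lemma onorm_scaleR_left onorm_id)
    qed (use st in auto)
    also have "\<dots> = (L / 2) * (norm (t - s) + norm (t - s))" by simp
    finally show "norm (x t - x s) \<le> (L / 2) * (norm (t - s) + norm (t - s))" .
  qed
qed

lemma abs_cont_on_add:
  fixes x y :: "real \<Rightarrow> 'a::real_normed_vector"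
  assumes "abs_cont_on S x" "abs_cont_on S y"
  shows "abs_cont_on S (\<lambda>t. x t + y t)"
  by (rule abs_cont_on_dominated[OF assms, where C = 1])
    (use norm_triangle_ineq in \<open>simp add: add_diff_add\<close>)

lemma abs_cont_on_bounded_linear:
  assumes "bounded_linear f" "abs_cont_on S x"
  shows "abs_cont_on S (\<lambda>t. f (x t))"
proof -
  interpret bounded_linear f by fact
  obtain K where K: "\<And>v. norm (f v) \<le> norm v * K" using bounded by blast
  show ?thesis
    by (rule abs_cont_on_dominated[OF assms(2) assms(2), where C = "K/2"])
      (use K in \<open>simp add: diff[symmetric] mult.commute\<close>)
qed

lemma abs_cont_on_inner:
  fixes x y :: "real \<Rightarrow> 'a::real_inner"
  assumes x: "abs_cont_on {a..b} x" and y: "abs_cont_on {a..b} y"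
  shows "abs_cont_on {a..b} (\<lambda>t. x t \<bullet> y t)"
proof -
  have "compact (x ` {a..b})" "compact (y ` {a..b})"
    using abs_cont_on_imp_continuous_on[OF x] abs_cont_on_imp_continuous_on[OF y]
    by (auto intro: compact_continuous_image)
  then obtain L M where LM: "\<And>t. t \<in> {a..b} \<Longrightarrow> norm (x t) \<le> L" "\<And>t. t \<in> {a..b} \<Longrightarrow> norm (y t) \<le> M"
    by (metis bounded_iff compact_imp_bounded imageI)
  show ?thesis
  proof (rule abs_cont_on_dominated[OF x y])
    fix s t assume st: "s \<in> {a..b}" "t \<in> {a..b}"
    have "x t \<bullet> y t - x s \<bullet> y s = (x t - x s) \<bullet> y t + x s \<bullet> (y t - y s)"
      by (simp add: inner_diff_left inner_diff_right)
    then have "norm (x t \<bullet> y t - x s \<bullet> y s) \<le> norm (x t - x s) * norm (y t) + norm (x s) * norm (y t - y s)"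
      using Cauchy_Schwarz_ineq2[of "x t - x s" "y t"] Cauchy_Schwarz_ineq2[of "x s" "y t - y s"] by simp
    also have "\<dots> \<le> norm (x t - x s) * max L M + max L M * norm (y t - y s)"
      using LM(1)[OF st(1)] LM(2)[OF st(2)] order_trans[OF norm_ge_zero LM(1)[OF st(1)]]
      by (intro add_mono mult_mono) (auto simp: le_max_iff_disj)
    finally show "norm (x t \<bullet> y t - x s \<bullet> y s) \<le> max L M * (norm (x t - x s) + norm (y t - y s))"
      by (simp add: algebra_simps)
  qed
qed

text \<open>The bound \<open>norm (g t) \<le> h / 2 * (norm (g t))\<^sup>2 + 1 / (2 * h)\<close> replaces the Cauchy-Schwarz
  inequality on finite unions of intervals: it can be integrated interval by interval.\<close>

lemma abs_cont_on_indefinite_integral: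
  fixes g :: "real \<Rightarrow> 'a::euclidean_space"
  assumes g: "g absolutely_integrable_on {a..b}" and g2: "(\<lambda>t. (norm (g t))\<^sup>2) integrable_on {a..b}"
  shows "abs_cont_on {a..b} (\<lambda>u. integral {a..u} g)"
  unfolding abs_cont_on_def
proof (intro allI impI)
  fix e :: real assume "e > 0"
  define J where "J = integral {a..b} (\<lambda>t. (norm (g t))\<^sup>2)"
  have "J \<ge> 0" unfolding J_def by (rule integral_nonneg[OF g2]) simp
  \<comment> \<open>With this weight the quadratic term contributes at most \<open>e / 2\<close>,
    and total length below \<open>e * h\<close> makes the other term less than \<open>e / 2\<close>.
    The summand 1 covers \<open>J = 0\<close>.\<close>
  define h where "h = e / (J + 1)"
  have "h > 0" using \<open>e > 0\<close> \<open>J \<ge> 0\<close> by (simp add: h_def)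
  have hJ: "h / 2 * J \<le> e / 2" using \<open>e > 0\<close> \<open>J \<ge> 0\<close> by (simp add: h_def field_simps)
  have gi: "g integrable_on {a..b}" "(\<lambda>t. norm (g t)) integrable_on {a..b}"
    using g by (auto simp: absolutely_integrable_on_def)
  have pt: "norm (g t) \<le> h / 2 * (norm (g t))\<^sup>2 + 1 / (2 * h)" for t
  proof -
    have "0 \<le> (h * norm (g t) - 1)\<^sup>2" by simp
    then show ?thesis using \<open>h > 0\<close> by (simp add: power2_eq_square field_simps)
  qed
  have "(\<Sum>k\<in>D. norm (integral {a..Sup k} g - integral {a..Inf k} g)) < e"
    if D: "D division_of \<Union>D" "\<Union>D \<subseteq> {a..b}" "(\<Sum>k\<in>D. Sup k - Inf k) < e * h" for D
  proof -
    have "(\<Sum>k\<in>D. norm (integral {a..Sup k} g - integral {a..Inf k} g))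
       \<le> (\<Sum>k\<in>D. h / 2 * integral k (\<lambda>t. (norm (g t))\<^sup>2) + (Sup k - Inf k) / (2 * h))"
    proof (rule sum_mono)
      fix k assume "k \<in> D"
      note k = division_of_intervalD[OF D(1,2) this]
      have sub: "k \<subseteq> {a..b}" using D(2) \<open>k \<in> D\<close> by blast
      have "g integrable_on {a..Sup k}" using gi(1) k by (auto intro: integrable_on_subinterval)
      from Henstock_Kurzweil_Integration.integral_combine[OF _ k(3) this]
      have "integral {a..Sup k} g - integral {a..Inf k} g = integral k g" using k by (auto simp: algebra_simps)
      moreover have gk: "g integrable_on k" "(\<lambda>t. norm (g t)) integrable_on k"
          "(\<lambda>t. (norm (g t))\<^sup>2) integrable_on k"
        using gi g2 sub k(4) by (metis integrable_on_subinterval)+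
      moreover have "norm (integral k g) \<le> integral k (\<lambda>t. norm (g t))"
        by (rule integral_norm_bound_integral) (use gk in auto)
      moreover have hi: "((\<lambda>t. h / 2 * (norm (g t))\<^sup>2 + 1 / (2 * h)) has_integral
          h / 2 * integral k (\<lambda>t. (norm (g t))\<^sup>2) + (Sup k - Inf k) / (2 * h)) k"
      proof (intro has_integral_add has_integral_mult_right integrable_integral gk)
        have "((\<lambda>t. 1 / (2 * h)) has_integral (Sup k - Inf k) / (2 * h)) {Inf k..Sup k}"
          using has_integral_const_real[of "1 / (2 * h)" "Inf k" "Sup k"] k(3) by simp
        then show "((\<lambda>t. 1 / (2 * h)) has_integral (Sup k - Inf k) / (2 * h)) k"
          by (simp only: k(4)[symmetric])
      qed
      moreover have "integral k (\<lambda>t. norm (g t)) \<le> integral k (\<lambda>t. h / 2 * (norm (g t))\<^sup>2 + 1 / (2 * h))"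
        using gk pt hi by (intro integral_le) auto
      moreover note integral_unique[OF hi]
      ultimately show "norm (integral {a..Sup k} g - integral {a..Inf k} g)
         \<le> h / 2 * integral k (\<lambda>t. (norm (g t))\<^sup>2) + (Sup k - Inf k) / (2 * h)" by simp
    qed
    also have "\<dots> = h / 2 * (\<Sum>k\<in>D. integral k (\<lambda>t. (norm (g t))\<^sup>2)) + (\<Sum>k\<in>D. Sup k - Inf k) / (2 * h)"
      by (simp add: sum.distrib sum_distrib_left sum_divide_distrib)
    also have "(\<Sum>k\<in>D. integral k (\<lambda>t. (norm (g t))\<^sup>2)) \<le> J"
    proof -
      have i: "(\<lambda>t. (norm (g t))\<^sup>2) integrable_on \<Union>D"
        using D g2 by (metis integrable_on_subdivision)
      have "(\<Sum>k\<in>D. integral k (\<lambda>t. (norm (g t))\<^sup>2)) = integral (\<Union>D) (\<lambda>t. (norm (g t))\<^sup>2)"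
        using integral_combine_division_topdown[OF i D(1)] by simp
      also have "\<dots> \<le> J"
        unfolding J_def by (rule integral_subset_le[OF D(2) i g2]) simp
      finally show ?thesis .
    qed
    finally have "(\<Sum>k\<in>D. norm (integral {a..Sup k} g - integral {a..Inf k} g))
       \<le> h / 2 * J + (\<Sum>k\<in>D. Sup k - Inf k) / (2 * h)" using \<open>h > 0\<close> by simp
    also have "\<dots> < e / 2 + e * h / (2 * h)"
      using hJ D(3) \<open>h > 0\<close> by (intro add_le_less_mono divide_strict_right_mono) auto
    also have "\<dots> = e" using \<open>h > 0\<close> by simp
    finally show ?thesis .
  qed
  moreover have "e * h > 0" using \<open>e > 0\<close> \<open>h > 0\<close> by simp
  ultimately show "\<exists>d>0. \<forall>D. D division_of \<Union>D \<and> \<Union>D \<subseteq> {a..b} \<and> (\<Sum>k\<in>D. Sup k - Inf k) < d \<longrightarrow>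
      (\<Sum>k\<in>D. norm (integral {a..Sup k} g - integral {a..Inf k} g)) < e" by blast
qed

subsection \<open>Linear differential equations\<close>

text \<open>The contraction acts on \<open>v t = exp (- K * t) *\<^sub>R w t\<close>; the weight makes its Lipschitz constant
  at most \<open>L / K\<close> on the whole interval, so no continuation of local solutions is needed.\<close>

lemma lipschitz_ode_solution:
  fixes F :: "real \<Rightarrow> 'a::euclidean_space \<Rightarrow> 'a"
  assumes "0 \<le> \<omega>"
    and F: "continuous_on ({0..\<omega>} \<times> UNIV) (\<lambda>(t, w). F t w)"
    and lip: "\<And>t w w'. t \<in> {0..\<omega>} \<Longrightarrow> norm (F t w - F t w') \<le> L * norm (w - w')"
  obtains w where "w 0 = w0"
    "\<And>t. t \<in> {0..\<omega>} \<Longrightarrow> (w has_vector_derivative F t (w t)) (at t within {0..\<omega>})"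
proof -
  \<comment> \<open>Twice \<bar>\<open>L\<close>\<bar> yields the contraction factor
    \<open>1 / 2\<close>; the summand 1 keeps the rate positive when \<open>L = 0\<close>.\<close>
  define K where "K = 2 * \<bar>L\<bar> + 1"
  have K: "K > 0" "\<bar>L\<bar> / K \<le> 1 / 2" by (auto simp: K_def field_simps)
  have contF: "continuous_on {0..\<omega>} (\<lambda>t. F t (w t))" if "continuous_on {0..\<omega>} w" for w
  proof -
    have "continuous_on {0..\<omega>} (\<lambda>t. (\<lambda>(t, w). F t w) (t, w t))"
      by (rule continuous_on_compose2[OF F]) (use that in \<open>auto intro!: continuous_intros\<close>)
    then show ?thesis by simp
  qed
  define rhs where "rhs v s = F s (exp (K * s) *\<^sub>R apply_bcontfun v s)" for v s
  have rhs: "continuous_on {0..\<omega>} (rhs v)" for v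
    unfolding rhs_def by (intro contF continuous_intros continuous_on_apply_bcontfun)
  define \<Theta> where "\<Theta> v t = exp (- K * t) *\<^sub>R (w0 + integral {0..t} (rhs v))" for v t
  have "continuous_on {0..\<omega>} (\<Theta> v)" for v
    unfolding \<Theta>_def using rhs
    by (intro continuous_intros indefinite_integral_continuous_1 integrable_continuous_real)
  \<comment> \<open>The fixed point is sought among bounded continuous functions on the whole line;
    clamping the argument extends \<open>\<Theta> v\<close> by constants beyond the
    interval.\<close>
  then have "\<exists>g. \<forall>t. apply_bcontfun g t = \<Theta> v (clamp 0 \<omega> t)" for v
    using continuous_on_cbox_bcontfunE[of 0 \<omega> "\<Theta> v"] by (metis cbox_interval)
  then obtain \<Phi> where \<Phi>: "\<And>v t. apply_bcontfun (\<Phi> v) t = \<Theta> v (clamp 0 \<omega> t)" by metis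
  have contr: "dist (\<Phi> v) (\<Phi> v') \<le> 1 / 2 * dist v v'" for v v'
  proof (rule dist_bound)
    fix x
    define t where "t = clamp 0 \<omega> x"
    have t: "t \<in> {0..\<omega>}" using clamp_in_interval[of 0 \<omega> x] \<open>0 \<le> \<omega>\<close> by (simp add: t_def)
    have sub: "{0..t} \<subseteq> {0..\<omega>}" using t by auto
    have ir: "rhs v integrable_on {0..t}" for v
      using rhs sub by (intro integrable_continuous_real) (rule continuous_on_subset)
    have diff: "\<Theta> v t - \<Theta> v' t = exp (- K * t) *\<^sub>R integral {0..t} (\<lambda>s. rhs v s - rhs v' s)"
      by (simp add: \<Theta>_def integral_diff ir flip: scaleR_diff_right)
    have bound: "norm (integral {0..t} (\<lambda>s. rhs v s - rhs v' s)) \<le>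
        integral {0..t} (\<lambda>s. \<bar>L\<bar> * dist v v' * exp (K * s))"
    proof (rule integral_norm_bound_integral)
      show "(\<lambda>s. rhs v s - rhs v' s) integrable_on {0..t}" by (intro integrable_diff ir)
      show "(\<lambda>s. \<bar>L\<bar> * dist v v' * exp (K * s)) integrable_on {0..t}"
        by (intro integrable_continuous_real continuous_intros)
      fix s assume s: "s \<in> {0..t}"
      have "norm (rhs v s - rhs v' s) \<le> L * norm (exp (K * s) *\<^sub>R apply_bcontfun v s - exp (K * s) *\<^sub>R apply_bcontfun v' s)"
        unfolding rhs_def using s sub by (intro lip) auto
      also have "\<dots> \<le> \<bar>L\<bar> * norm (exp (K * s) *\<^sub>R apply_bcontfun v s - exp (K * s) *\<^sub>R apply_bcontfun v' s)"
        by (intro mult_right_mono) auto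
      also have "\<dots> = \<bar>L\<bar> * (exp (K * s) * dist (apply_bcontfun v s) (apply_bcontfun v' s))"
        by (simp add: dist_norm flip: scaleR_diff_right)
      also have "\<dots> \<le> \<bar>L\<bar> * (exp (K * s) * dist v v')"
        by (intro mult_left_mono dist_bounded) auto
      finally show "norm (rhs v s - rhs v' s) \<le> \<bar>L\<bar> * dist v v' * exp (K * s)"
        by (simp add: mult_ac)
    qed
    \<comment> \<open>Integrating the growing weight gains the factor \<open>1 / K\<close>, which
      turns the Lipschitz bound into a contraction once \<open>exp (- K * t)\<close> cancels the
      growth.\<close>
    have eq: "integral {0..t} (\<lambda>s. \<bar>L\<bar> * dist v v' * exp (K * s)) = \<bar>L\<bar> * dist v v' * ((exp (K * t) - 1) / K)"
    proof -
      have "((\<lambda>s. exp (K * s)) has_integral exp (K * t) / K - exp (K * 0) / K) {0..t}"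
        using t K(1) by (intro fundamental_theorem_of_calculus)
          (auto intro!: derivative_eq_intros simp flip: has_real_derivative_iff_has_vector_derivative)
      then have "((\<lambda>s. \<bar>L\<bar> * dist v v' * exp (K * s)) has_integral
          \<bar>L\<bar> * dist v v' * (exp (K * t) / K - exp (K * 0) / K)) {0..t}"
        by (rule has_integral_mult_right)
      from integral_unique[OF this] show ?thesis by (simp only: diff_divide_distrib mult_zero_right exp_zero)
    qed
    have "dist (\<Theta> v t) (\<Theta> v' t) = exp (- K * t) * norm (integral {0..t} (\<lambda>s. rhs v s - rhs v' s))"
      by (simp add: dist_norm diff)
    also have "\<dots> \<le> exp (- K * t) * (\<bar>L\<bar> * dist v v' * ((exp (K * t) - 1) / K))"
      using bound unfolding eq by (intro mult_left_mono) auto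
    also have "\<dots> = (\<bar>L\<bar> / K) * dist v v' * (1 - exp (- K * t))"
      by (simp add: field_simps exp_minus)
    also have "\<dots> \<le> (\<bar>L\<bar> / K) * dist v v' * 1"
      using K(1) by (intro mult_left_mono) auto
    also have "\<dots> \<le> (1 / 2) * dist v v' * 1"
      using K(2) by (intro mult_right_mono) auto
    finally show "dist (apply_bcontfun (\<Phi> v) x) (apply_bcontfun (\<Phi> v') x) \<le> 1 / 2 * dist v v'"
      by (simp add: \<Phi> t_def)
  qed
  then have "\<exists>!v. \<Phi> v = v" by (intro banach_fix_type[of "1/2"]) auto
  then obtain v where v: "\<Phi> v = v" by blast
  define w where "w t = exp (K * t) *\<^sub>R apply_bcontfun v t" for t
  have rw: "rhs v s = F s (w s)" for s by (simp add: rhs_def w_def)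
  have weq: "w t = w0 + integral {0..t} (rhs v)" if "t \<in> {0..\<omega>}" for t
  proof -
    have "apply_bcontfun v t = \<Theta> v t"
      using \<Phi>[of v t] v that by (simp add: clamp_cancel_cbox)
    then show ?thesis by (simp add: w_def \<Theta>_def flip: exp_add)
  qed
  show ?thesis
  proof
    show "w 0 = w0" using weq[of 0] \<open>0 \<le> \<omega>\<close> by simp
    fix t assume t: "t \<in> {0..\<omega>}"
    have "((\<lambda>u. w0 + integral {0..u} (rhs v)) has_vector_derivative 0 + rhs v t) (at t within {0..\<omega>})"
      by (intro has_vector_derivative_add has_vector_derivative_const
          integral_has_vector_derivative rhs t)
    then have "((\<lambda>u. w0 + integral {0..u} (rhs v)) has_vector_derivative F t (w t)) (at t within {0..\<omega>})"
      by (simp add: rw)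
    then show "(w has_vector_derivative F t (w t)) (at t within {0..\<omega>})"
      by (rule has_vector_derivative_transform[OF t, rotated]) (rule weq)
  qed
qed

text \<open>Time reversal \<open>t \<mapsto> \<omega> - t\<close>. Prescribing terminal states
  directly replaces a proof that the solution flow is invertible.\<close>

lemma lipschitz_ode_solution_terminal:
  fixes F :: "real \<Rightarrow> 'a::euclidean_space \<Rightarrow> 'a"
  assumes "0 \<le> \<omega>"
    and F: "continuous_on ({0..\<omega>} \<times> UNIV) (\<lambda>(t, w). F t w)"
    and lip: "\<And>t w w'. t \<in> {0..\<omega>} \<Longrightarrow> norm (F t w - F t w') \<le> L * norm (w - w')"
  obtains w where "w \<omega> = w1"
    "\<And>t. t \<in> {0..\<omega>} \<Longrightarrow> (w has_vector_derivative F t (w t)) (at t within {0..\<omega>})"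
proof -
  have "continuous_on ({0..\<omega>} \<times> UNIV) (\<lambda>x. (\<lambda>(t, w). F t w) (\<omega> - fst x, snd x))"
    by (rule continuous_on_compose2[OF F]) (auto intro!: continuous_intros)
  then have cont: "continuous_on ({0..\<omega>} \<times> UNIV) (\<lambda>(t, w). - F (\<omega> - t) w)"
    by (simp add: split_def continuous_on_minus)
  have lip': "norm (- F (\<omega> - t) w - - F (\<omega> - t) w') \<le> L * norm (w - w')" if "t \<in> {0..\<omega>}" for t w w'
    using lip[of "\<omega> - t" w w'] that by (simp add: norm_minus_commute)
  obtain v where v: "v 0 = w1"
    "\<And>t. t \<in> {0..\<omega>} \<Longrightarrow> (v has_vector_derivative - F (\<omega> - t) (v t)) (at t within {0..\<omega>})"
    by (rule lipschitz_ode_solution[of \<omega> "\<lambda>t w. - F (\<omega> - t) w" L w1, OF \<open>0 \<le> \<omega>\<close> cont lip']) blast+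
  define w where "w = v \<circ> (\<lambda>t. \<omega> - t)"
  show ?thesis
  proof
    show "w \<omega> = w1" using v by (simp add: w_def)
    fix t assume t: "t \<in> {0..\<omega>}"
    have "((\<lambda>t. \<omega> - t) has_vector_derivative - 1) (at t within {0..\<omega>})"
      by (auto intro!: derivative_eq_intros)
    moreover have "(\<lambda>t. \<omega> - t) ` {0..\<omega>} = {0..\<omega>}" by auto
    then have "(v has_vector_derivative - F t (v (\<omega> - t))) (at (\<omega> - t) within (\<lambda>t. \<omega> - t) ` {0..\<omega>})"
      using v(2)[of "\<omega> - t"] t by simp
    ultimately show "(w has_vector_derivative F t (w t)) (at t within {0..\<omega>})"
      unfolding w_def using vector_diff_chain_within by fastforce
  qed
qed

lemma bounded_bilinear_matrix_vector_mult:
  "bounded_bilinear ((*v) :: real^'n^'m \<Rightarrow> real^'n \<Rightarrow> real^'m)"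
proof -
  have "bilinear ((*v) :: real^'n^'m \<Rightarrow> real^'n \<Rightarrow> real^'m)"
    unfolding bilinear_def
    by (auto intro!: linearI simp: matrix_vector_mult_def vec_eq_iff algebra_simps sum.distrib sum_distrib_left)
  then show ?thesis by (simp add: bilinear_conv_bounded_bilinear)
qed

lemmas continuous_on_matrix_vector_mult [continuous_intros] =
  bounded_bilinear.continuous_on[OF bounded_bilinear_matrix_vector_mult]

lemma continuous_on_transpose [continuous_intros]:
  fixes A :: "'a::topological_space \<Rightarrow> real^'n^'m"
  assumes "continuous_on S A"
  shows "continuous_on S (\<lambda>t. transpose (A t))"
proof -
  have "linear (transpose :: real^'n^'m \<Rightarrow> real^'m^'n)"
    by (auto intro!: linearI simp: transpose_def vec_eq_iff)
  then have "bounded_linear (transpose :: real^'n^'m \<Rightarrow> real^'m^'n)"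
    by (simp add: linear_conv_bounded_linear)
  then show ?thesis by (rule bounded_linear.continuous_on[OF _ assms])
qed

subsection \<open>Square integrable functions\<close>

lemma finite_measure_interval: "finite_measure (lebesgue_on {a..b::real})"
  by (rule finite_measure_lebesgue_on) simp

lemma L2_D:
  assumes "f \<in> L2 \<omega>"
  shows "f \<in> borel_measurable (lebesgue_on {0..\<omega>})" "integrable (lebesgue_on {0..\<omega>}) (\<lambda>t. (norm (f t))\<^sup>2)"
  using assms by (auto simp: L2_def)

text \<open>The membership test behind sums, differences, multiples and matrix products; it rests on
  \<open>(a + b)\<^sup>2 \<le> 2 * (a\<^sup>2 + b\<^sup>2)\<close>.\<close>

lemma L2_dominated:
  fixes f :: "real \<Rightarrow> 'a::euclidean_space" and g :: "real \<Rightarrow> 'b::euclidean_space"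
    and h :: "real \<Rightarrow> 'c::euclidean_space"
  assumes f: "f \<in> L2 \<omega>" and g: "g \<in> L2 \<omega>" and h: "h \<in> borel_measurable (lebesgue_on {0..\<omega>})"
    and le: "\<And>t. t \<in> {0..\<omega>} \<Longrightarrow> norm (h t) \<le> C * (norm (f t) + norm (g t))"
  shows "h \<in> L2 \<omega>"
proof -
  have "integrable (lebesgue_on {0..\<omega>}) (\<lambda>t. (norm (h t))\<^sup>2)"
  proof (rule Bochner_Integration.integrable_bound)
    show "integrable (lebesgue_on {0..\<omega>}) (\<lambda>t. 2 * C\<^sup>2 * ((norm (f t))\<^sup>2 + (norm (g t))\<^sup>2))"
      using L2_D(2)[OF f] L2_D(2)[OF g] by (intro integrable_mult_right Bochner_Integration.integrable_add)
    show "AE t in lebesgue_on {0..\<omega>}. norm ((norm (h t))\<^sup>2) \<le> norm (2 * C\<^sup>2 * ((norm (f t))\<^sup>2 + (norm (g t))\<^sup>2))"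
    proof (rule AE_I2)
      fix t assume "t \<in> space (lebesgue_on {0..\<omega>})"
      then have "(norm (h t))\<^sup>2 \<le> (C * (norm (f t) + norm (g t)))\<^sup>2"
        using le by (intro power_mono) auto
      also have "\<dots> \<le> 2 * C\<^sup>2 * ((norm (f t))\<^sup>2 + (norm (g t))\<^sup>2)"
        using mult_left_mono[OF sum_squares_bound[of "norm (f t)" "norm (g t)"], of "C\<^sup>2"]
        by (simp add: power_mult_distrib power2_sum algebra_simps power2_eq_square[of C])
      finally show "norm ((norm (h t))\<^sup>2) \<le> norm (2 * C\<^sup>2 * ((norm (f t))\<^sup>2 + (norm (g t))\<^sup>2))"
        by simp
    qed
  qed (use h in measurable)
  with h show ?thesis by (simp add: L2_def)
qed

lemma borel_measurable_continuous_on_interval: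
  fixes f :: "real \<Rightarrow> 'a::euclidean_space"
  assumes "continuous_on {a..b} f"
  shows "f \<in> borel_measurable (lebesgue_on {a..b})"
  by (rule continuous_imp_measurable_on_sets_lebesgue[OF assms]) simp

lemma L2_continuous_on:
  fixes f :: "real \<Rightarrow> 'a::euclidean_space"
  assumes f: "continuous_on {0..\<omega>} f"
  shows "f \<in> L2 \<omega>"
proof -
  have "integrable (lebesgue_on {0..\<omega>}) (\<lambda>t. (norm (f t))\<^sup>2)"
    by (rule continuous_imp_integrable_real) (intro continuous_intros f)
  then show ?thesis using borel_measurable_continuous_on_interval[OF f] by (simp add: L2_def)
qed

text \<open>Measurability of \<open>g\<close> comes from completeness of Lebesgue measure. This
  suits the derivative of a state, which is determined only almost everywhere.\<close>

lemma L2_AE_cong: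
  fixes f g :: "real \<Rightarrow> 'a::euclidean_space"
  assumes f: "f \<in> L2 \<omega>" and eq: "AE t in lebesgue_on {0..\<omega>}. g t = f t"
  shows "g \<in> L2 \<omega>"
proof -
  obtain N where N: "negligible N" "\<And>t. t \<in> {0..\<omega>} - N \<Longrightarrow> g t = f t"
    using AE_lebesgue_on_negligibleE[OF _ eq] by auto
  have "f measurable_on {0..\<omega>}"
    using L2_D(1)[OF f] by (simp add: measurable_on_iff_borel_measurable)
  then have "g measurable_on {0..\<omega>}"
    by (rule measurable_on_spike[OF _ N(1)]) (use N in auto)
  then have g: "g \<in> borel_measurable (lebesgue_on {0..\<omega>})"
    by (simp add: measurable_on_iff_borel_measurable)
  have "integrable (lebesgue_on {0..\<omega>}) (\<lambda>t. (norm (g t))\<^sup>2) \<longleftrightarrow> integrable (lebesgue_on {0..\<omega>}) (\<lambda>t. (norm (f t))\<^sup>2)"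
    using g L2_D(1)[OF f] eq by (intro integrable_cong_AE) auto
  then show ?thesis using g L2_D(2)[OF f] by (simp add: L2_def)
qed

lemma L2_diff:
  assumes "f \<in> L2 \<omega>" "g \<in> L2 \<omega>"
  shows "(\<lambda>t. f t - g t) \<in> L2 \<omega>"
  by (rule L2_dominated[OF assms, where C = 1])
    (use L2_D(1)[OF assms(1)] L2_D(1)[OF assms(2)] in \<open>auto intro: norm_triangle_ineq4\<close>)

lemma L2_add:
  assumes "f \<in> L2 \<omega>" "g \<in> L2 \<omega>"
  shows "(\<lambda>t. f t + g t) \<in> L2 \<omega>"
  by (rule L2_dominated[OF assms, where C = 1])
    (use L2_D(1)[OF assms(1)] L2_D(1)[OF assms(2)] in \<open>auto intro: norm_triangle_ineq\<close>)

lemma L2_scaleR: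
  assumes "f \<in> L2 \<omega>"
  shows "(\<lambda>t. c *\<^sub>R f t) \<in> L2 \<omega>"
  by (rule L2_dominated[OF assms assms, where C = "\<bar>c\<bar>"])
    (use L2_D(1)[OF assms] in \<open>auto intro: mult_left_mono\<close>)

lemma L2_matrix_mult:
  fixes C :: "real \<Rightarrow> real^'n^'m"
  assumes C: "continuous_on {0..\<omega>} C" and f: "f \<in> L2 \<omega>"
  shows "(\<lambda>t. C t *v f t) \<in> L2 \<omega>"
proof -
  interpret bb: bounded_bilinear "(*v) :: real^'n^'m \<Rightarrow> real^'n \<Rightarrow> real^'m"
    by (rule bounded_bilinear_matrix_vector_mult)
  obtain K where K: "K > 0" "\<And>(M::real^'n^'m) x. norm (M *v x) \<le> norm M * norm x * K"
    using bb.pos_bounded by metis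
  have "compact (C ` {0..\<omega>})" by (rule compact_continuous_image[OF C]) simp
  then obtain L where L: "\<And>t. t \<in> {0..\<omega>} \<Longrightarrow> norm (C t) \<le> L"
    by (metis bounded_iff compact_imp_bounded imageI)
  have meas: "(\<lambda>t. C t *v f t) \<in> borel_measurable (lebesgue_on {0..\<omega>})"
  proof (rule borel_measurable_continuous_Pair[where H = "(*v)"])
    show "C \<in> borel_measurable (lebesgue_on {0..\<omega>})" by (rule borel_measurable_continuous_on_interval[OF C])
    show "f \<in> borel_measurable (lebesgue_on {0..\<omega>})" by (rule L2_D(1)[OF f])
    show "continuous_on UNIV (\<lambda>x::(real^'n^'m) \<times> (real^'n). fst x *v snd x)"
      by (intro continuous_intros)
  qed
  show ?thesis
  proof (rule L2_dominated[OF f f meas])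
    fix t assume t: "t \<in> {0..\<omega>}"
    have "norm (C t *v f t) \<le> norm (C t) * norm (f t) * K" by (rule K)
    also have "\<dots> \<le> L * norm (f t) * K" using K L[OF t] by (intro mult_right_mono) auto
    finally show "norm (C t *v f t) \<le> (L * K / 2) * (norm (f t) + norm (f t))" by (simp add: mult_ac)
  qed
qed

lemma integrable_L2_inner:
  assumes f: "f \<in> L2 \<omega>" and g: "g \<in> L2 \<omega>"
  shows "integrable (lebesgue_on {0..\<omega>}) (\<lambda>t. f t \<bullet> g t)"
proof (rule Bochner_Integration.integrable_bound)
  show "integrable (lebesgue_on {0..\<omega>}) (\<lambda>t. (norm (f t))\<^sup>2 + (norm (g t))\<^sup>2)"
    using L2_D(2)[OF f] L2_D(2)[OF g] by simp
  show "(\<lambda>t. f t \<bullet> g t) \<in> borel_measurable (lebesgue_on {0..\<omega>})"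
    using L2_D(1)[OF f] L2_D(1)[OF g] by measurable
  have "\<bar>f t \<bullet> g t\<bar> \<le> (norm (f t))\<^sup>2 + (norm (g t))\<^sup>2" for t
    using Cauchy_Schwarz_ineq2[of "f t" "g t"] sum_squares_bound[of "norm (f t)" "norm (g t)"]
      mult_nonneg_nonneg[OF norm_ge_zero norm_ge_zero, of "f t" "g t"] by linarith
  then show "AE t in lebesgue_on {0..\<omega>}. norm (f t \<bullet> g t) \<le> norm ((norm (f t))\<^sup>2 + (norm (g t))\<^sup>2)"
    by (auto intro!: AE_I2)
qed

text \<open>The interval has finite measure, and
  \<open>norm (f t) \<le> 1 + (norm (f t))\<^sup>2\<close>.\<close>

lemma L2_absolutely_integrable_on:
  assumes f: "f \<in> L2 \<omega>"
  shows "f absolutely_integrable_on {0..\<omega>}"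
proof -
  interpret finite_measure "lebesgue_on {0..\<omega>}" by (rule finite_measure_interval)
  have "integrable (lebesgue_on {0..\<omega>}) f"
  proof (rule Bochner_Integration.integrable_bound)
    show "integrable (lebesgue_on {0..\<omega>}) (\<lambda>t. 1 + (norm (f t))\<^sup>2)"
      using L2_D(2)[OF f] by simp
    have "norm (f t) \<le> 1 + (norm (f t))\<^sup>2" for t
      using sum_squares_bound[of 1 "norm (f t)"] norm_ge_zero[of "f t"] by (simp del: norm_ge_zero)
    then show "AE t in lebesgue_on {0..\<omega>}. norm (f t) \<le> norm (1 + (norm (f t))\<^sup>2)"
      by (auto intro!: AE_I2)
  qed (rule L2_D(1)[OF f])
  then show ?thesis by (simp add: integrable_restrict_space set_integrable_def)
qed

lemma l2_inner_commute: "l2_inner \<omega> f g = l2_inner \<omega> g f"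
  by (simp add: l2_inner_def inner_commute)

lemma l2_inner_add_left:
  assumes "f \<in> L2 \<omega>" "g \<in> L2 \<omega>" "h \<in> L2 \<omega>"
  shows "l2_inner \<omega> (\<lambda>t. f t + g t) h = l2_inner \<omega> f h + l2_inner \<omega> g h"
  using assms by (simp add: l2_inner_def inner_add_left integrable_L2_inner)

lemma l2_inner_diff_left:
  assumes "f \<in> L2 \<omega>" "g \<in> L2 \<omega>" "h \<in> L2 \<omega>"
  shows "l2_inner \<omega> (\<lambda>t. f t - g t) h = l2_inner \<omega> f h - l2_inner \<omega> g h"
  using assms by (simp add: l2_inner_def inner_diff_left integrable_L2_inner)

lemma l2_inner_scaleR_left: "l2_inner \<omega> (\<lambda>t. c *\<^sub>R f t) g = c * l2_inner \<omega> f g"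
  by (simp add: l2_inner_def)

lemma l2_inner_add_right:
  assumes "f \<in> L2 \<omega>" "g \<in> L2 \<omega>" "h \<in> L2 \<omega>"
  shows "l2_inner \<omega> h (\<lambda>t. f t + g t) = l2_inner \<omega> h f + l2_inner \<omega> h g"
  using l2_inner_add_left[OF assms] by (simp add: l2_inner_commute[of \<omega> h])

lemma l2_inner_diff_right:
  assumes "f \<in> L2 \<omega>" "g \<in> L2 \<omega>" "h \<in> L2 \<omega>"
  shows "l2_inner \<omega> h (\<lambda>t. f t - g t) = l2_inner \<omega> h f - l2_inner \<omega> h g"
  using l2_inner_diff_left[OF assms] by (simp add: l2_inner_commute[of \<omega> h])

lemma l2_inner_scaleR_right: "l2_inner \<omega> g (\<lambda>t. c *\<^sub>R f t) = c * l2_inner \<omega> g f"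
  by (simp add: l2_inner_def)

lemma l2_inner_self_nonneg: "l2_inner \<omega> f f \<ge> 0"
  by (simp add: l2_inner_def)

lemma l2_inner_transpose_left:
  fixes C :: "real \<Rightarrow> real^'n^'m"
  shows "l2_inner \<omega> (\<lambda>t. transpose (C t) *v f t) g = l2_inner \<omega> f (\<lambda>t. C t *v g t)"
  by (simp add: l2_inner_def dot_lmul_matrix)

lemma l2_inner_AE_cong_left:
  fixes f g h :: "real \<Rightarrow> 'a::euclidean_space"
  assumes "f \<in> L2 \<omega>" "g \<in> L2 \<omega>" "h \<in> L2 \<omega>" "AE t in lebesgue_on {0..\<omega>}. f t = g t"
  shows "l2_inner \<omega> f h = l2_inner \<omega> g h"
  unfolding l2_inner_def
  using assms(4) integrable_L2_inner[OF assms(1,3)] integrable_L2_inner[OF assms(2,3)]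
  by (intro integral_cong_AE) auto

lemma l2_inner_self_eq_0:
  assumes "f \<in> L2 \<omega>"
  shows "l2_inner \<omega> f f = 0 \<longleftrightarrow> (AE t in lebesgue_on {0..\<omega>}. f t = 0)"
  using integral_nonneg_eq_0_iff_AE[OF integrable_L2_inner[OF assms assms]]
  by (simp add: l2_inner_def)

lemma l2_inner_self_eq_0_continuous:
  assumes f: "continuous_on {0..\<omega>} f" and "l2_inner \<omega> f f = 0" and t: "t \<in> {0..\<omega>}" and "0 < \<omega>"
  shows "f t = 0"
proof -
  have "continuous_on {0..\<omega>} (\<lambda>t. f t \<bullet> f t)" by (intro continuous_intros f)
  from integralL_eq_0_iff[OF this \<open>0 < \<omega>\<close>] have "\<forall>t\<in>{0..\<omega>}. f t \<bullet> f t = 0"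
    using assms(2) by (simp add: l2_inner_def)
  with t show ?thesis by auto
qed

lemma l2_inner_diff_self:
  assumes "f \<in> L2 \<omega>" "g \<in> L2 \<omega>"
  shows "l2_inner \<omega> (\<lambda>t. f t - g t) (\<lambda>t. f t - g t) =
    l2_inner \<omega> f f - 2 * l2_inner \<omega> f g + l2_inner \<omega> g g"
  using assms L2_diff[OF assms]
  by (simp add: l2_inner_diff_left l2_inner_diff_right l2_inner_commute[of \<omega> g f])

lemma l2_inner_Cauchy_Schwarz:
  assumes f: "f \<in> L2 \<omega>" and g: "g \<in> L2 \<omega>"
  shows "(l2_inner \<omega> f g)\<^sup>2 \<le> l2_inner \<omega> f f * l2_inner \<omega> g g"
proof (cases "l2_inner \<omega> g g = 0")
  case True
  then have "AE t in lebesgue_on {0..\<omega>}. g t = 0" using g by (simp add: l2_inner_self_eq_0)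
  then have "l2_inner \<omega> g f = 0"
    using l2_inner_AE_cong_left[of g \<omega> "\<lambda>t. 0" f] f g L2_scaleR[OF g, of 0]
    by (simp add: l2_inner_def)
  then show ?thesis using True by (simp add: l2_inner_commute[of \<omega> f g])
next
  case False
  then have pos: "l2_inner \<omega> g g > 0" using l2_inner_self_nonneg[of \<omega> g] by simp
  \<comment> \<open>The coefficient of the orthogonal projection of \<open>f\<close> onto
    \<open>g\<close>; it minimises the squared distance whose nonnegativity is then
    exploited.\<close>
  define s where "s = l2_inner \<omega> f g / l2_inner \<omega> g g"
  have "0 \<le> l2_inner \<omega> (\<lambda>t. f t - s *\<^sub>R g t) (\<lambda>t. f t - s *\<^sub>R g t)"
    by (rule l2_inner_self_nonneg)
  also have "\<dots> = l2_inner \<omega> f f - 2 * s * l2_inner \<omega> f g + s\<^sup>2 * l2_inner \<omega> g g"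
    using l2_inner_diff_self[OF f L2_scaleR[OF g, of s]]
    by (simp add: l2_inner_scaleR_left l2_inner_scaleR_right power2_eq_square)
  also have "\<dots> = l2_inner \<omega> f f - (l2_inner \<omega> f g)\<^sup>2 / l2_inner \<omega> g g"
    using pos by (simp add: s_def power2_eq_square field_simps)
  finally show ?thesis using pos by (simp add: field_simps)
qed

section \<open>Green's formula and linear systems with square integrable forcing\<close>

text \<open>In the derivative of \<open>z t \<bullet> x t\<close> the two terms containing
  \<open>A\<close> cancel, and only the forcings remain to be integrated. No boundary condition is
  imposed, so the formula serves both periodic solutions and solutions with free end states.\<close>

lemma adjoint_equations_Green:
  fixes A :: "real \<Rightarrow> real^'n^'n"
  assumes "0 < \<omega>" and A: "continuous_on {0..\<omega>} A"
    and z: "abs_cont_on {0..\<omega>} z"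
      "AE t in lebesgue_on {0..\<omega>}. (z has_vector_derivative - (transpose (A t) *v z t) + h t) (at t within {0..\<omega>})"
    and x: "abs_cont_on {0..\<omega>} x"
      "AE t in lebesgue_on {0..\<omega>}. (x has_vector_derivative A t *v x t + k t) (at t within {0..\<omega>})"
    and h: "h \<in> L2 \<omega>" and k: "k \<in> L2 \<omega>"
  shows "z \<omega> \<bullet> x \<omega> - z 0 \<bullet> x 0 = l2_inner \<omega> h x + l2_inner \<omega> z k"
proof -
  have zx: "z \<in> L2 \<omega>" "x \<in> L2 \<omega>"
    using z(1) x(1) by (auto intro: L2_continuous_on abs_cont_on_imp_continuous_on)
  have "AE t in lebesgue_on {0..\<omega>}.
      ((\<lambda>t. z t \<bullet> x t) has_vector_derivative (h t \<bullet> x t + z t \<bullet> k t)) (at t within {0..\<omega>})"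
    using z(2) x(2)
  proof eventually_elim
    case (elim t)
    have "((\<lambda>t. z t \<bullet> x t) has_vector_derivative
        z t \<bullet> (A t *v x t + k t) + (- (transpose (A t) *v z t) + h t) \<bullet> x t) (at t within {0..\<omega>})"
      using bounded_bilinear.has_vector_derivative[OF bounded_bilinear_inner elim] .
    moreover have "z t \<bullet> (A t *v x t + k t) + (- (transpose (A t) *v z t) + h t) \<bullet> x t = h t \<bullet> x t + z t \<bullet> k t"
      by (simp add: inner_add_right inner_diff_left dot_lmul_matrix)
    ultimately show ?case by simp
  qed
  then have "((\<lambda>t. h t \<bullet> x t + z t \<bullet> k t) has_integral z \<omega> \<bullet> x \<omega> - z 0 \<bullet> x 0) {0..\<omega>}"
    by (rule has_integral_of_abs_cont_on[OF \<open>0 < \<omega>\<close> abs_cont_on_inner[OF z(1) x(1)]])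
  moreover have int: "integrable (lebesgue_on {0..\<omega>}) (\<lambda>t. h t \<bullet> x t)" "integrable (lebesgue_on {0..\<omega>}) (\<lambda>t. z t \<bullet> k t)"
    using zx h k by (auto intro: integrable_L2_inner)
  have "((\<lambda>t. h t \<bullet> x t + z t \<bullet> k t) has_integral
      (LINT t|lebesgue_on {0..\<omega>}. h t \<bullet> x t + z t \<bullet> k t)) {0..\<omega>}"
    using int by (intro has_integral_integral_lebesgue_on) auto
  ultimately show ?thesis
    using int by (simp add: l2_inner_def has_integral_unique)
qed

text \<open>Compactness of the interval times the unit sphere, then homogeneity. By linearity the
  bound is a Lipschitz constant uniform in \<open>t\<close>.\<close>

lemma continuous_linear_family_bounded:
  fixes M :: "real \<Rightarrow> 'a::euclidean_space \<Rightarrow> 'b::euclidean_space"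
  assumes cont: "continuous_on ({a..b} \<times> UNIV) (\<lambda>(t, w). M t w)" and lin: "\<And>t. linear (M t)"
  obtains L where "\<And>t w. t \<in> {a..b} \<Longrightarrow> norm (M t w) \<le> L * norm w"
proof -
  have "compact ((\<lambda>(t, w). M t w) ` ({a..b} \<times> sphere 0 1))"
    by (intro compact_continuous_image compact_Times compact_sphere continuous_on_subset[OF cont]) auto
  then obtain L where L: "\<And>t w. t \<in> {a..b} \<Longrightarrow> norm w = 1 \<Longrightarrow> norm (M t w) \<le> L"
    by (fastforce dest!: compact_imp_bounded simp: bounded_iff)
  have "norm (M t w) \<le> L * norm w" if t: "t \<in> {a..b}" for t w
  proof (cases "w = 0")
    case True
    then show ?thesis using linear_0[OF lin] by simp
  next
    case False
    then have "norm (M t (inverse (norm w) *\<^sub>R w)) \<le> L" by (intro L t) simp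
    then show ?thesis using False by (simp add: linear_scale[OF lin] field_simps)
  qed
  then show ?thesis using that by blast
qed

text \<open>The forcing may be discontinuous, so Picard iteration does not apply directly. Writing
  \<open>u = w + G\<close> with \<open>G\<close> an antiderivative of \<open>g\<close> leaves
  \<open>w' = M (w + G)\<close>, whose right-hand side is continuous.\<close>

lemma linear_ode_solution:
  fixes M :: "real \<Rightarrow> 'a::euclidean_space \<Rightarrow> 'a"
  assumes "0 \<le> \<omega>" and cont: "continuous_on ({0..\<omega>} \<times> UNIV) (\<lambda>(t, w). M t w)" and lin: "\<And>t. linear (M t)"
    and g: "g \<in> L2 \<omega>"
  obtains u where "u 0 = u0" "abs_cont_on {0..\<omega>} u"
    "AE t in lebesgue_on {0..\<omega>}. (u has_vector_derivative M t (u t) + g t) (at t within {0..\<omega>})"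
proof -
  obtain L where L: "\<And>t w. t \<in> {0..\<omega>} \<Longrightarrow> norm (M t w) \<le> L * norm w"
    by (rule continuous_linear_family_bounded[OF cont lin]) blast
  define G where "G t = integral {0..t} g" for t
  have gi: "g absolutely_integrable_on {0..\<omega>}" by (rule L2_absolutely_integrable_on[OF g])
  have "(\<lambda>t. (norm (g t))\<^sup>2) integrable_on {0..\<omega>}"
    using has_integral_integral_lebesgue_on[OF L2_D(2)[OF g]] by (simp add: has_integral_integrable)
  then have acG: "abs_cont_on {0..\<omega>} G"
    unfolding G_def by (rule abs_cont_on_indefinite_integral[OF gi])
  then have contG: "continuous_on {0..\<omega>} G" by (rule abs_cont_on_imp_continuous_on)
  have cF: "continuous_on ({0..\<omega>} \<times> UNIV) (\<lambda>(t, w). M t (w + G t))"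
  proof -
    have "continuous_on ({0..\<omega>} \<times> UNIV) (\<lambda>x. (\<lambda>(t, w). M t w) (fst x, snd x + G (fst x)))"
      by (rule continuous_on_compose2[OF cont])
        (auto intro!: continuous_intros continuous_on_compose2[OF contG])
    then show ?thesis by (simp add: split_def)
  qed
  have lip: "norm (M t (w + G t) - M t (w' + G t)) \<le> L * norm (w - w')" if "t \<in> {0..\<omega>}" for t w w'
    using L[OF that, of "w - w'"] by (simp add: linear_diff[OF lin] linear_add[OF lin])
  obtain w where w: "w 0 = u0"
    "\<And>t. t \<in> {0..\<omega>} \<Longrightarrow> (w has_vector_derivative M t (w t + G t)) (at t within {0..\<omega>})"
    by (rule lipschitz_ode_solution[of \<omega> "\<lambda>t w. M t (w + G t)" L u0, OF \<open>0 \<le> \<omega>\<close> cF lip]) blast+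
  have "continuous_on {0..\<omega>} w"
    using w(2) by (meson continuous_on_eq_continuous_within has_vector_derivative_continuous)
  then have "continuous_on {0..\<omega>} (\<lambda>t. (\<lambda>(t, w). M t (w + G t)) (t, w t))"
    by (intro continuous_on_compose2[OF cF]) (auto intro!: continuous_intros)
  then have acw: "abs_cont_on {0..\<omega>} w"
    by (intro abs_cont_on_C1[OF w(2)]) auto
  have "AE t in lebesgue_on {0..\<omega>}. (G has_vector_derivative g t) (at t within {0..\<omega>})"
    unfolding G_def using gi
    by (intro indefinite_integral_has_vector_derivative_AE) (simp add: absolutely_integrable_on_def)
  moreover have "AE t in lebesgue_on {0..\<omega>}. t \<in> {0..\<omega>}" by (rule AE_I2) simp
  ultimately have "AE t in lebesgue_on {0..\<omega>}.
      ((\<lambda>t. w t + G t) has_vector_derivative M t (w t + G t) + g t) (at t within {0..\<omega>})"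
    by eventually_elim (intro has_vector_derivative_add w)
  then show ?thesis
    using that[of "\<lambda>t. w t + G t"] w(1) abs_cont_on_add[OF acw acG] by (simp add: G_def)
qed

lemma linear_ode_solution_terminal:
  fixes M :: "real \<Rightarrow> 'a::euclidean_space \<Rightarrow> 'a"
  assumes "0 \<le> \<omega>" and cont: "continuous_on ({0..\<omega>} \<times> UNIV) (\<lambda>(t, w). M t w)" and lin: "\<And>t. linear (M t)"
  obtains u where "u \<omega> = u1" "abs_cont_on {0..\<omega>} u"
    "AE t in lebesgue_on {0..\<omega>}. (u has_vector_derivative M t (u t)) (at t within {0..\<omega>})"
proof -
  obtain L where L: "\<And>t w. t \<in> {0..\<omega>} \<Longrightarrow> norm (M t w) \<le> L * norm w"
    by (rule continuous_linear_family_bounded[OF cont lin]) blast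
  have lip: "norm (M t w - M t w') \<le> L * norm (w - w')" if "t \<in> {0..\<omega>}" for t w w'
    using L[OF that, of "w - w'"] by (simp add: linear_diff[OF lin])
  obtain w where w: "w \<omega> = u1"
    "\<And>t. t \<in> {0..\<omega>} \<Longrightarrow> (w has_vector_derivative M t (w t)) (at t within {0..\<omega>})"
    by (rule lipschitz_ode_solution_terminal[of \<omega> M L u1, OF \<open>0 \<le> \<omega>\<close> cont lip]) blast+
  have "continuous_on {0..\<omega>} w"
    using w(2) by (meson continuous_on_eq_continuous_within has_vector_derivative_continuous)
  then have "continuous_on {0..\<omega>} (\<lambda>t. (\<lambda>(t, w). M t w) (t, w t))"
    by (intro continuous_on_compose2[OF cont]) (auto intro!: continuous_intros)
  then have "abs_cont_on {0..\<omega>} w"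
    by (intro abs_cont_on_C1[OF w(2)]) auto
  moreover have "AE t in lebesgue_on {0..\<omega>}. (w has_vector_derivative M t (w t)) (at t within {0..\<omega>})"
    by (rule AE_I2) (simp add: w(2))
  ultimately show ?thesis using that w(1) by blast
qed

subsection \<open>The Hamiltonian boundary value problem\<close>

locale periodic_estimation =
  fixes \<omega> :: real
    and A :: "real \<Rightarrow> real^'n^'n"
    and B :: "real \<Rightarrow> real^'r^'n"
    and H :: "real \<Rightarrow> real^'n^'m"
  assumes pos: "0 < \<omega>"
    and cont_A: "continuous_on {0..\<omega>} A"
    and cont_B: "continuous_on {0..\<omega>} B"
    and cont_H: "continuous_on {0..\<omega>} H"
begin

text \<open>The boundary value problem stripped of periodicity, so that solutions can start or end
  anywhere. The bracketing displays everything except \<open>A' z\<close> as the forcing term of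
  Green's formula.\<close>

definition hamiltonian_solution ::
    "(real \<Rightarrow> real^'n) \<Rightarrow> (real \<Rightarrow> real^'n) \<Rightarrow> (real \<Rightarrow> real^'n) \<Rightarrow> bool" where
  "hamiltonian_solution l z p \<longleftrightarrow>
     abs_cont_on {0..\<omega>} z \<and> abs_cont_on {0..\<omega>} p \<and>
     (AE t in lebesgue_on {0..\<omega>}. (z has_vector_derivative
        - (transpose (A t) *v z t) + (transpose (H t) *v (H t *v p t) - l t)) (at t within {0..\<omega>})) \<and>
     (AE t in lebesgue_on {0..\<omega>}. (p has_vector_derivative
        A t *v p t + B t *v (transpose (B t) *v z t)) (at t within {0..\<omega>}))"

lemma estimation_bvp_iff:
  "estimation_bvp \<omega> A B H l z p \<longleftrightarrow> hamiltonian_solution l z p \<and> z 0 = z \<omega> \<and> p 0 = p \<omega>"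
  by (auto simp: estimation_bvp_def hamiltonian_solution_def periodic_solution_def add_diff_eq)

text \<open>Filtering the data \<open>y\<close> is the estimation problem for the functional
  \<open>H' y\<close>; solvability and all identities carry over.\<close>

lemma filtering_bvp_iff:
  "filtering_bvp \<omega> A B H y q x \<longleftrightarrow> estimation_bvp \<omega> A B H (\<lambda>t. transpose (H t) *v y t) q x"
proof -
  have eq: "- (transpose (A t) *v q t) + transpose (H t) *v (H t *v x t) - transpose (H t) *v y t =
      - (transpose (A t) *v q t) - transpose (H t) *v (y t - H t *v x t)" for t
    by (simp add: matrix_vector_mult_diff_distrib del: transpose_matrix_vector)
  then show ?thesis
    unfolding filtering_bvp_def estimation_bvp_def by (simp only: eq)
qed

lemma hamiltonian_solution_L2:
  assumes "hamiltonian_solution l z p"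
  shows "continuous_on {0..\<omega>} z" "continuous_on {0..\<omega>} p" "z \<in> L2 \<omega>" "p \<in> L2 \<omega>"
    "(\<lambda>t. H t *v p t) \<in> L2 \<omega>" "(\<lambda>t. transpose (B t) *v z t) \<in> L2 \<omega>"
    "(\<lambda>t. transpose (H t) *v (H t *v p t)) \<in> L2 \<omega>"
    "(\<lambda>t. B t *v (transpose (B t) *v z t)) \<in> L2 \<omega>"
proof -
  show zp: "continuous_on {0..\<omega>} z" "continuous_on {0..\<omega>} p"
    using assms by (auto simp: hamiltonian_solution_def intro: abs_cont_on_imp_continuous_on)
  then show "z \<in> L2 \<omega>" "p \<in> L2 \<omega>" by (auto intro: L2_continuous_on)
  then show Hp: "(\<lambda>t. H t *v p t) \<in> L2 \<omega>" and Bz: "(\<lambda>t. transpose (B t) *v z t) \<in> L2 \<omega>"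
    by (auto intro!: L2_matrix_mult continuous_intros cont_B cont_H simp del: transpose_matrix_vector)
  show "(\<lambda>t. transpose (H t) *v (H t *v p t)) \<in> L2 \<omega>"
    "(\<lambda>t. B t *v (transpose (B t) *v z t)) \<in> L2 \<omega>"
    by (intro L2_matrix_mult continuous_intros cont_B cont_H Hp Bz)+
qed

text \<open>The trajectory \<open>x\<close> may have any input \<open>f\<close>. Admissible states
  are of this kind, and so is the second component of another Hamiltonian solution, with input
  \<open>B' z'\<close>; both uses occur.\<close>

lemma hamiltonian_Green:
  assumes zp: "hamiltonian_solution l z p" and l: "l \<in> L2 \<omega>"
    and x: "abs_cont_on {0..\<omega>} x"
      "AE t in lebesgue_on {0..\<omega>}. (x has_vector_derivative A t *v x t + B t *v f t) (at t within {0..\<omega>})"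
    and f: "f \<in> L2 \<omega>"
  shows "z \<omega> \<bullet> x \<omega> - z 0 \<bullet> x 0 =
    l2_inner \<omega> (\<lambda>t. H t *v p t) (\<lambda>t. H t *v x t) - l2_inner \<omega> l x
    + l2_inner \<omega> (\<lambda>t. transpose (B t) *v z t) f"
proof -
  note L2 = hamiltonian_solution_L2[OF zp]
  have xL: "x \<in> L2 \<omega>" by (intro L2_continuous_on abs_cont_on_imp_continuous_on x)
  have Bf: "(\<lambda>t. B t *v f t) \<in> L2 \<omega>" by (rule L2_matrix_mult[OF cont_B f])
  have "z \<omega> \<bullet> x \<omega> - z 0 \<bullet> x 0 =
      l2_inner \<omega> (\<lambda>t. transpose (H t) *v (H t *v p t) - l t) x + l2_inner \<omega> z (\<lambda>t. B t *v f t)"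
    using zp x L2_diff[OF L2(7) l] Bf
    by (intro adjoint_equations_Green[OF pos cont_A]) (auto simp: hamiltonian_solution_def simp del: transpose_matrix_vector)
  also have "l2_inner \<omega> (\<lambda>t. transpose (H t) *v (H t *v p t) - l t) x =
      l2_inner \<omega> (\<lambda>t. H t *v p t) (\<lambda>t. H t *v x t) - l2_inner \<omega> l x"
    using l2_inner_diff_left[OF L2(7) l xL] by (simp only: l2_inner_transpose_left)
  also have "l2_inner \<omega> z (\<lambda>t. B t *v f t) = l2_inner \<omega> (\<lambda>t. transpose (B t) *v z t) f"
    by (simp only: l2_inner_transpose_left)
  finally show ?thesis .
qed

text \<open>The homogeneous system as one linear map on pairs, the form in which the existence
  results for linear equations apply.\<close>

definition hamiltonian :: "real \<Rightarrow> (real^'n) \<times> (real^'n) \<Rightarrow> (real^'n) \<times> (real^'n)" where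
  "hamiltonian t w = (- (transpose (A t) *v fst w) + transpose (H t) *v (H t *v snd w),
     A t *v snd w + B t *v (transpose (B t) *v fst w))"

lemma linear_hamiltonian: "linear (hamiltonian t)"
  by (rule linearI)
    (simp_all add: hamiltonian_def matrix_vector_right_distrib matrix_vector_mult_scaleR
      algebra_simps del: transpose_matrix_vector)

lemma continuous_on_hamiltonian: "continuous_on ({0..\<omega>} \<times> UNIV) (\<lambda>(t, w). hamiltonian t w)"
  unfolding hamiltonian_def split_def
  by (intro continuous_intros continuous_on_compose2[OF cont_A] continuous_on_compose2[OF cont_B]
      continuous_on_compose2[OF cont_H]) auto

lemma hamiltonian_solutionI:
  assumes u: "abs_cont_on {0..\<omega>} u"
    and d: "AE t in lebesgue_on {0..\<omega>}. (u has_vector_derivative hamiltonian t (u t) + (- l t, 0)) (at t within {0..\<omega>})"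
  shows "hamiltonian_solution l (\<lambda>t. fst (u t)) (\<lambda>t. snd (u t))"
  unfolding hamiltonian_solution_def
proof (intro conjI)
  show "abs_cont_on {0..\<omega>} (\<lambda>t. fst (u t))" "abs_cont_on {0..\<omega>} (\<lambda>t. snd (u t))"
    by (intro abs_cont_on_bounded_linear[OF bounded_linear_fst u] abs_cont_on_bounded_linear[OF bounded_linear_snd u])+
  show "AE t in lebesgue_on {0..\<omega>}. ((\<lambda>t. fst (u t)) has_vector_derivative
      - (transpose (A t) *v fst (u t)) + (transpose (H t) *v (H t *v snd (u t)) - l t)) (at t within {0..\<omega>})"
    using d
  proof eventually_elim
    case (elim t)
    from bounded_linear.has_vector_derivative[OF bounded_linear_fst elim] show ?case
      by (simp add: hamiltonian_def add_diff_eq del: transpose_matrix_vector)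
  qed
  show "AE t in lebesgue_on {0..\<omega>}. ((\<lambda>t. snd (u t)) has_vector_derivative
      A t *v snd (u t) + B t *v (transpose (B t) *v fst (u t))) (at t within {0..\<omega>})"
    using d
  proof eventually_elim
    case (elim t)
    from bounded_linear.has_vector_derivative[OF bounded_linear_snd elim] show ?case
      by (simp add: hamiltonian_def del: transpose_matrix_vector)
  qed
qed

lemma hamiltonian_solution_initial:
  assumes l: "l \<in> L2 \<omega>"
  obtains z p where "hamiltonian_solution l z p" "z 0 = z0" "p 0 = p0"
proof -
  have "(\<lambda>t. (- l t, 0 :: real^'n)) \<in> L2 \<omega>"
    using L2_D(1)[OF l] by (intro L2_dominated[OF l l, where C = 1]) (auto simp: norm_Pair)
  then obtain u where u: "u 0 = (z0, p0)" "abs_cont_on {0..\<omega>} u"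
    "AE t in lebesgue_on {0..\<omega>}. (u has_vector_derivative hamiltonian t (u t) + (- l t, 0)) (at t within {0..\<omega>})"
    by (rule linear_ode_solution[OF less_imp_le[OF pos] continuous_on_hamiltonian linear_hamiltonian]) blast
  from that[OF hamiltonian_solutionI[OF u(2,3)]] u(1) show ?thesis by simp
qed

lemma hamiltonian_solution_terminal:
  obtains z p where "hamiltonian_solution (\<lambda>t. 0) z p" "z \<omega> = z1" "p \<omega> = p1"
proof -
  obtain u where u: "u \<omega> = (z1, p1)" "abs_cont_on {0..\<omega>} u"
    "AE t in lebesgue_on {0..\<omega>}. (u has_vector_derivative hamiltonian t (u t)) (at t within {0..\<omega>})"
    by (rule linear_ode_solution_terminal[OF less_imp_le[OF pos] continuous_on_hamiltonian linear_hamiltonian]) blast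
  then have "hamiltonian_solution (\<lambda>t. 0) (\<lambda>t. fst (u t)) (\<lambda>t. snd (u t))"
    by (intro hamiltonian_solutionI) (simp_all add: zero_prod_def[symmetric])
  from that[OF this] u(1) show ?thesis by simp
qed

lemma hamiltonian_solution_add:
  assumes "hamiltonian_solution l z p" "hamiltonian_solution l' z' p'"
  shows "hamiltonian_solution (\<lambda>t. l t + l' t) (\<lambda>t. z t + z' t) (\<lambda>t. p t + p' t)"
  unfolding hamiltonian_solution_def
proof (intro conjI)
  note [simp del] = transpose_matrix_vector
  show "abs_cont_on {0..\<omega>} (\<lambda>t. z t + z' t)" "abs_cont_on {0..\<omega>} (\<lambda>t. p t + p' t)"
    using assms by (auto simp: hamiltonian_solution_def intro: abs_cont_on_add)
  from assms have d: "AE t in lebesgue_on {0..\<omega>}. (z has_vector_derivative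
        - (transpose (A t) *v z t) + (transpose (H t) *v (H t *v p t) - l t)) (at t within {0..\<omega>})"
    "AE t in lebesgue_on {0..\<omega>}. (z' has_vector_derivative
        - (transpose (A t) *v z' t) + (transpose (H t) *v (H t *v p' t) - l' t)) (at t within {0..\<omega>})"
    "AE t in lebesgue_on {0..\<omega>}. (p has_vector_derivative
        A t *v p t + B t *v (transpose (B t) *v z t)) (at t within {0..\<omega>})"
    "AE t in lebesgue_on {0..\<omega>}. (p' has_vector_derivative
        A t *v p' t + B t *v (transpose (B t) *v z' t)) (at t within {0..\<omega>})"
    by (auto simp: hamiltonian_solution_def)
  show "AE t in lebesgue_on {0..\<omega>}. ((\<lambda>t. z t + z' t) has_vector_derivative
        - (transpose (A t) *v (z t + z' t)) + (transpose (H t) *v (H t *v (p t + p' t)) - (l t + l' t)))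
        (at t within {0..\<omega>})"
    using d(1,2)
  proof eventually_elim
    case (elim t)
    from has_vector_derivative_add[OF elim] show ?case
      by (simp add: matrix_vector_right_distrib algebra_simps)
  qed
  show "AE t in lebesgue_on {0..\<omega>}. ((\<lambda>t. p t + p' t) has_vector_derivative
        A t *v (p t + p' t) + B t *v (transpose (B t) *v (z t + z' t))) (at t within {0..\<omega>})"
    using d(3,4)
  proof eventually_elim
    case (elim t)
    from has_vector_derivative_add[OF elim] show ?case
      by (simp add: matrix_vector_right_distrib algebra_simps)
  qed
qed

lemma hamiltonian_solution_scaleR:
  assumes "hamiltonian_solution l z p"
  shows "hamiltonian_solution (\<lambda>t. c *\<^sub>R l t) (\<lambda>t. c *\<^sub>R z t) (\<lambda>t. c *\<^sub>R p t)"
  unfolding hamiltonian_solution_def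
proof (intro conjI)
  note [simp del] = transpose_matrix_vector
  show "abs_cont_on {0..\<omega>} (\<lambda>t. c *\<^sub>R z t)" "abs_cont_on {0..\<omega>} (\<lambda>t. c *\<^sub>R p t)"
    using assms by (auto simp: hamiltonian_solution_def intro: abs_cont_on_bounded_linear[OF bounded_linear_scaleR_right])
  from assms have d: "AE t in lebesgue_on {0..\<omega>}. (z has_vector_derivative
        - (transpose (A t) *v z t) + (transpose (H t) *v (H t *v p t) - l t)) (at t within {0..\<omega>})"
    "AE t in lebesgue_on {0..\<omega>}. (p has_vector_derivative
        A t *v p t + B t *v (transpose (B t) *v z t)) (at t within {0..\<omega>})"
    by (auto simp: hamiltonian_solution_def)
  show "AE t in lebesgue_on {0..\<omega>}. ((\<lambda>t. c *\<^sub>R z t) has_vector_derivative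
        - (transpose (A t) *v (c *\<^sub>R z t)) + (transpose (H t) *v (H t *v (c *\<^sub>R p t)) - c *\<^sub>R l t))
        (at t within {0..\<omega>})"
    using d(1)
  proof eventually_elim
    case (elim t)
    from bounded_linear.has_vector_derivative[OF bounded_linear_scaleR_right elim, of c] show ?case
      by (simp add: matrix_vector_mult_scaleR algebra_simps)
  qed
  show "AE t in lebesgue_on {0..\<omega>}. ((\<lambda>t. c *\<^sub>R p t) has_vector_derivative
        A t *v (c *\<^sub>R p t) + B t *v (transpose (B t) *v (c *\<^sub>R z t))) (at t within {0..\<omega>})"
    using d(2)
  proof eventually_elim
    case (elim t)
    from bounded_linear.has_vector_derivative[OF bounded_linear_scaleR_right elim, of c] show ?case
      by (simp add: matrix_vector_mult_scaleR algebra_simps)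
  qed
qed

text \<open>Green's formula is applied twice with the two solutions exchanged. The terms with
  \<open>H\<close> and \<open>B\<close> are symmetric in the solutions, so they drop out of the
  difference. For \<open>l = 0\<close> this says that the flow preserves the symplectic
  form.\<close>

lemma hamiltonian_symplectic:
  assumes "hamiltonian_solution (\<lambda>t. 0) z p" and "hamiltonian_solution l z' p'" and l: "l \<in> L2 \<omega>"
  shows "(z \<omega> \<bullet> p' \<omega> - p \<omega> \<bullet> z' \<omega>) - (z 0 \<bullet> p' 0 - p 0 \<bullet> z' 0) = l2_inner \<omega> l p"
proof -
  have 0: "(\<lambda>t. 0 :: real^'n) \<in> L2 \<omega>" by (rule L2_continuous_on) simp
  have "z \<omega> \<bullet> p' \<omega> - z 0 \<bullet> p' 0 =
      l2_inner \<omega> (\<lambda>t. H t *v p t) (\<lambda>t. H t *v p' t) - l2_inner \<omega> (\<lambda>t. 0) p'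
      + l2_inner \<omega> (\<lambda>t. transpose (B t) *v z t) (\<lambda>t. transpose (B t) *v z' t)"
    using assms hamiltonian_solution_L2(6)[OF assms(2)]
    by (intro hamiltonian_Green[OF assms(1) 0]) (simp_all add: hamiltonian_solution_def del: transpose_matrix_vector)
  moreover have "z' \<omega> \<bullet> p \<omega> - z' 0 \<bullet> p 0 =
      l2_inner \<omega> (\<lambda>t. H t *v p' t) (\<lambda>t. H t *v p t) - l2_inner \<omega> l p
      + l2_inner \<omega> (\<lambda>t. transpose (B t) *v z' t) (\<lambda>t. transpose (B t) *v z t)"
    using assms hamiltonian_solution_L2(6)[OF assms(1)]
    by (intro hamiltonian_Green[OF assms(2) l]) (simp_all add: hamiltonian_solution_def del: transpose_matrix_vector)
  moreover have "l2_inner \<omega> (\<lambda>t. 0) p' = 0" by (simp add: l2_inner_def)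
  ultimately show ?thesis
    using l2_inner_commute[of \<omega> "\<lambda>t. H t *v p t" "\<lambda>t. H t *v p' t"]
      l2_inner_commute[of \<omega> "\<lambda>t. transpose (B t) *v z t" "\<lambda>t. transpose (B t) *v z' t"]
    by (simp add: inner_commute[of "p _"] del: transpose_matrix_vector)
qed

text \<open>The linear map from the initial to the terminal state is symplectic. Hence a vector orthogonal
  to all increments \<open>w \<omega> - w 0\<close> of homogeneous solutions is, up to the symplectic rotation, the initial state
  of a periodic homogeneous solution, and such a solution has \<open>p = 0\<close>.\<close>

lemma estimation_bvp_solvable:
  assumes obs: "\<And>z p t. estimation_bvp \<omega> A B H (\<lambda>t. 0) z p \<Longrightarrow> t \<in> {0..\<omega>} \<Longrightarrow> p t = 0"
    and l: "l \<in> L2 \<omega>"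
  obtains z p where "estimation_bvp \<omega> A B H l z p"
proof -
  \<comment> \<open>The range of the monodromy map minus the identity.\<close>
  define R where "R = {(z \<omega> - z 0, p \<omega> - p 0) | z p. hamiltonian_solution (\<lambda>t. 0) z p}"
  have z0: "(\<lambda>t. 0 :: real^'n) \<in> L2 \<omega>" by (rule L2_continuous_on) simp
  have R: "subspace R"
    unfolding subspace_def
  proof (intro conjI ballI allI)
    obtain z p where zp: "hamiltonian_solution (\<lambda>t. 0) z p" "z 0 = 0" "p 0 = 0"
      by (rule hamiltonian_solution_initial[OF z0])
    from hamiltonian_solution_scaleR[OF zp(1), of 0] have "hamiltonian_solution (\<lambda>t. 0) (\<lambda>t. 0) (\<lambda>t. 0)" by simp
    then show "0 \<in> R" unfolding R_def zero_prod_def by force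
  next
    fix x y assume "x \<in> R" "y \<in> R"
    then obtain z p z' p' where "x = (z \<omega> - z 0, p \<omega> - p 0)" "y = (z' \<omega> - z' 0, p' \<omega> - p' 0)"
      and h: "hamiltonian_solution (\<lambda>t. 0) z p" "hamiltonian_solution (\<lambda>t. 0) z' p'" by (auto simp: R_def)
    then show "x + y \<in> R"
      using hamiltonian_solution_add[OF h] unfolding R_def
      by (intro CollectI exI[of _ "\<lambda>t. z t + z' t"] exI[of _ "\<lambda>t. p t + p' t"]) simp
  next
    fix c x assume "x \<in> R"
    then obtain z p where "x = (z \<omega> - z 0, p \<omega> - p 0)"
      and h: "hamiltonian_solution (\<lambda>t. 0) z p" by (auto simp: R_def)
    then show "c *\<^sub>R x \<in> R"
      using hamiltonian_solution_scaleR[OF h, of c] unfolding R_def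
      by (intro CollectI exI[of _ "\<lambda>t. c *\<^sub>R z t"] exI[of _ "\<lambda>t. c *\<^sub>R p t"]) (simp add: scaleR_diff_right)
  qed
  obtain z1 p1 where zp1: "hamiltonian_solution l z1 p1" "z1 0 = 0" "p1 0 = 0"
    by (rule hamiltonian_solution_initial[OF l])
  \<comment> \<open>A particular solution starting at 0 becomes periodic after adding a homogeneous
    solution exactly when the increment of the latter is \<open>v\<close>. So the claim is
    \<open>v \<in> R\<close>, and the component \<open>e\<close> of \<open>v\<close> orthogonal to
    \<open>R\<close> has to vanish.\<close>
  define v where "v = - (z1 \<omega>, p1 \<omega>)"
  have "v \<in> R"
  proof -
    obtain y e where ye: "y \<in> span R" "\<And>w. w \<in> span R \<Longrightarrow> orthogonal e w" "v = y + e"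
      by (rule orthogonal_subspace_decomp_exists[of R v]) blast
    have "span R = R" using R by (simp add: span_eq_iff)
    \<comment> \<open>This terminal state is \<open>e\<close> rotated so that the symplectic form of
      \<open>(z, p)\<close> with any solution \<open>(z', p')\<close>, taken at
      \<open>\<omega>\<close>, is the inner product of \<open>e\<close> with
      \<open>(z' \<omega>, p' \<omega>)\<close>.\<close>
    obtain z p where zp: "hamiltonian_solution (\<lambda>t. 0) z p" "z \<omega> = snd e" "p \<omega> = - fst e"
      by (rule hamiltonian_solution_terminal)
    have "(snd e - z 0) \<bullet> b + (p 0 + fst e) \<bullet> a = 0" for a b
    proof -
      obtain z' p' where zp': "hamiltonian_solution (\<lambda>t. 0) z' p'" "z' 0 = a" "p' 0 = b"
        by (rule hamiltonian_solution_initial[OF z0])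
      have "(z' \<omega> - a, p' \<omega> - b) \<in> span R"
        unfolding \<open>span R = R\<close> using zp' by (auto simp: R_def)
      then have "e \<bullet> (z' \<omega> - a, p' \<omega> - b) = 0"
        using ye(2) by (simp add: orthogonal_def)
      then have "fst e \<bullet> (z' \<omega> - a) + snd e \<bullet> (p' \<omega> - b) = 0"
        by (simp add: inner_prod_def)
      moreover have "(z \<omega> \<bullet> p' \<omega> - p \<omega> \<bullet> z' \<omega>) - (z 0 \<bullet> p' 0 - p 0 \<bullet> z' 0) = l2_inner \<omega> (\<lambda>t. 0) p"
        by (rule hamiltonian_symplectic[OF zp(1) zp'(1) z0])
      moreover have "l2_inner \<omega> (\<lambda>t. 0) p = 0" by (simp add: l2_inner_def)
      ultimately show ?thesis
        using zp zp' by (simp add: inner_diff_left inner_diff_right inner_add_left)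
    qed
    \<comment> \<open>The form at time 0 therefore agrees, for every initial state
      \<open>(a, b)\<close>, with the form computed from the terminal state; testing each component
      against itself shows that the solution is periodic.\<close>
    from this[where a = "p 0 + fst e" and b = 0] this[where a = 0 and b = "snd e - z 0"]
    have "z 0 = snd e" "p 0 = - fst e" by (auto simp: eq_neg_iff_add_eq_0)
    then have "z 0 = z \<omega>" "p 0 = p \<omega>" using zp by auto
    then have "estimation_bvp \<omega> A B H (\<lambda>t. 0) z p" using zp(1) by (simp add: estimation_bvp_iff)
    then have p0: "\<And>t. t \<in> {0..\<omega>} \<Longrightarrow> p t = 0" by (rule obs)
    \<comment> \<open>Pairing with the particular solution, which vanishes at 0, turns the left-hand
      side into \<open>- (e \<bullet> v)\<close>. The right-hand side is 0 because \<open>p\<close>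
      is, and \<open>e \<bullet> v = e \<bullet> e\<close>.\<close>
    have "(z \<omega> \<bullet> p1 \<omega> - p \<omega> \<bullet> z1 \<omega>) - (z 0 \<bullet> p1 0 - p 0 \<bullet> z1 0) = l2_inner \<omega> l p"
      by (rule hamiltonian_symplectic[OF zp(1) zp1(1) l])
    moreover have "l2_inner \<omega> l p = 0"
      unfolding l2_inner_def using p0
      by (subst Bochner_Integration.integral_cong[where g = "\<lambda>_. 0"]) auto
    ultimately have "e \<bullet> v = 0"
      using zp zp1 by (simp add: v_def inner_prod_def)
    moreover have "e \<bullet> y = 0" using ye(1,2) by (simp add: orthogonal_def)
    ultimately have "e = 0" using ye(3) by (simp add: inner_add_right)
    then show ?thesis using ye \<open>span R = R\<close> by simp
  qed
  then obtain z p where zp: "v = (z \<omega> - z 0, p \<omega> - p 0)" "hamiltonian_solution (\<lambda>t. 0) z p"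
    by (auto simp: R_def)
  have "estimation_bvp \<omega> A B H l (\<lambda>t. z t + z1 t) (\<lambda>t. p t + p1 t)"
    using hamiltonian_solution_add[OF zp(2) zp1(1)] zp(1) zp1(2,3)
    by (auto simp: estimation_bvp_iff v_def algebra_simps)
  then show ?thesis using that by blast
qed

end

subsection \<open>Density of the continuous functions\<close>

text \<open>Used twice below: for truncations, with \<open>w\<close> the norm of \<open>f\<close>,
  and for approximations of a bounded function, with \<open>w\<close> constant.\<close>

lemma integral_norm_diff_tendsto_0:
  fixes g :: "nat \<Rightarrow> real \<Rightarrow> 'a::euclidean_space"
  assumes f: "f \<in> borel_measurable (lebesgue_on {0..\<omega>})" and g: "\<And>n. g n \<in> borel_measurable (lebesgue_on {0..\<omega>})"
    and lim: "AE t in lebesgue_on {0..\<omega>}. (\<lambda>n. g n t) \<longlonglongrightarrow> f t"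
    and w: "integrable (lebesgue_on {0..\<omega>}) w" and bound: "\<And>n t. norm (f t - g n t) \<le> w t"
    and w2: "integrable (lebesgue_on {0..\<omega>}) (\<lambda>t. (w t)\<^sup>2)"
  shows "(\<lambda>n. LINT t|lebesgue_on {0..\<omega>}. (norm (f t - g n t))\<^sup>2) \<longlonglongrightarrow> 0"
proof -
  have "(\<lambda>n. LINT t|lebesgue_on {0..\<omega>}. (norm (f t - g n t))\<^sup>2) \<longlonglongrightarrow> (LINT t|lebesgue_on {0..\<omega>}. 0)"
  proof (rule integral_dominated_convergence[OF _ _ w2])
    show "AE t in lebesgue_on {0..\<omega>}. (\<lambda>n. (norm (f t - g n t))\<^sup>2) \<longlonglongrightarrow> 0"
      using lim
    proof eventually_elim
      case (elim t)
      then have "(\<lambda>n. (norm (f t - g n t))\<^sup>2) \<longlonglongrightarrow> (norm (f t - f t))\<^sup>2"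
        by (intro tendsto_intros)
      then show ?case by simp
    qed
    show "AE t in lebesgue_on {0..\<omega>}. norm ((norm (f t - g n t))\<^sup>2) \<le> (w t)\<^sup>2" for n
      using bound by (intro AE_I2) (simp add: power_mono)
  qed (use f g in measurable)
  then show ?thesis by simp
qed

text \<open>Measurability provides continuous functions converging almost everywhere, but without
  domination. Truncating both the function and its approximants supplies a constant bound. Each of
  the two errors is below \<open>e / 4\<close>, as squaring their sum costs a factor 2.\<close>

lemma L2_continuous_dense:
  fixes f :: "real \<Rightarrow> 'a::euclidean_space"
  assumes f: "f \<in> L2 \<omega>" and "e > 0"
  obtains c where "continuous_on {0..\<omega>} c" "l2_inner \<omega> (\<lambda>t. f t - c t) (\<lambda>t. f t - c t) < e"
proof -
  interpret finite_measure "lebesgue_on {0..\<omega>}" by (rule finite_measure_interval)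
  \<comment> \<open>The radial retraction onto the ball of radius \<open>Suc k\<close>; the maximum
    avoids dividing by zero and keeps the map continuous.\<close>
  define T :: "nat \<Rightarrow> 'a \<Rightarrow> 'a" where "T k v = (real (Suc k) / max (real (Suc k)) (norm v)) *\<^sub>R v" for k v
  have contT: "continuous_on UNIV (T k)" for k
    unfolding T_def by (intro continuous_intros) (auto simp: max_def)
  have T1: "norm (T k v) \<le> real (Suc k)" for k v
  proof -
    have "norm (T k v) = real (Suc k) * (norm v / max (real (Suc k)) (norm v))"
      by (simp add: T_def)
    also have "\<dots> \<le> real (Suc k) * 1"
      by (intro mult_left_mono) (auto simp: max_def divide_le_eq)
    finally show ?thesis by simp
  qed
  have T2: "norm (v - T k v) \<le> norm v" for k v
  proof -
    have "v - T k v = (1 - real (Suc k) / max (real (Suc k)) (norm v)) *\<^sub>R v"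
      by (simp add: T_def scaleR_diff_left)
    moreover have "0 \<le> real (Suc k) / max (real (Suc k)) (norm v)" "real (Suc k) / max (real (Suc k)) (norm v) \<le> 1"
      by (simp_all add: divide_le_eq_1 less_max_iff_disj)
    then have "\<bar>1 - real (Suc k) / max (real (Suc k)) (norm v)\<bar> \<le> 1" by linarith
    ultimately show ?thesis by (simp only: norm_scaleR mult_left_le_one_le norm_ge_zero abs_ge_zero)
  qed
  have T3: "(\<lambda>k. T k v) \<longlonglongrightarrow> v" for v
  proof (rule tendsto_eventually)
    obtain n where n: "norm v \<le> real n" using real_arch_simple by blast
    show "\<forall>\<^sub>F k in sequentially. T k v = v"
      using eventually_ge_at_top[of n]
    proof eventually_elim
      case (elim k)
      then have "norm v \<le> real (Suc k)" using n by linarith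
      then have "max (real (Suc k)) (norm v) = real (Suc k)" by simp
      then show ?case by (simp add: T_def del: of_nat_Suc)
    qed
  qed
  have mf: "f \<in> borel_measurable (lebesgue_on {0..\<omega>})" by (rule L2_D[OF f])
  have mT: "(\<lambda>t. T k (h t)) \<in> borel_measurable (lebesgue_on {0..\<omega>})"
    if "h \<in> borel_measurable (lebesgue_on {0..\<omega>})" for h k
    using measurable_compose[OF that borel_measurable_continuous_onI[OF contT]] .
  have ni: "integrable (lebesgue_on {0..\<omega>}) (\<lambda>t. norm (f t))"
    using L2_absolutely_integrable_on[OF f]
    by (intro integrable_norm) (simp add: integrable_restrict_space set_integrable_def)
  have "(\<lambda>k. LINT t|lebesgue_on {0..\<omega>}. (norm (f t - T k (f t)))\<^sup>2) \<longlonglongrightarrow> 0"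
    by (rule integral_norm_diff_tendsto_0[OF mf mT[OF mf] _ ni T2 L2_D(2)[OF f]]) (simp add: T3)
  then have "\<forall>\<^sub>F k in sequentially. (LINT t|lebesgue_on {0..\<omega>}. (norm (f t - T k (f t)))\<^sup>2) < e / 4"
    using \<open>e > 0\<close> by (intro order_tendstoD) auto
  then obtain k where k: "(LINT t|lebesgue_on {0..\<omega>}. (norm (f t - T k (f t)))\<^sup>2) < e / 4"
    using eventually_happens' sequentially_bot by blast
  have "f measurable_on {0..\<omega>}" using mf by (simp add: measurable_on_iff_borel_measurable)
  then obtain N g where N: "negligible N" and g: "\<And>n. continuous_on UNIV (g n)"
    "\<And>t. t \<notin> N \<Longrightarrow> (\<lambda>n. g n t) \<longlonglongrightarrow> (if t \<in> {0..\<omega>} then f t else 0)"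
    unfolding measurable_on_def by blast
  have cTg: "continuous_on {0..\<omega>} (\<lambda>t. T k (g n t))" for n
    by (rule continuous_on_compose2[OF contT]) (auto intro: continuous_on_subset[OF g(1)])
  have "(\<lambda>n. LINT t|lebesgue_on {0..\<omega>}. (norm (T k (f t) - T k (g n t)))\<^sup>2) \<longlonglongrightarrow> 0"
  proof (rule integral_norm_diff_tendsto_0[OF mT[OF mf]])
    show "(\<lambda>t. T k (g n t)) \<in> borel_measurable (lebesgue_on {0..\<omega>})" for n
      by (rule borel_measurable_continuous_on_interval[OF cTg])
    show "AE t in lebesgue_on {0..\<omega>}. (\<lambda>n. T k (g n t)) \<longlonglongrightarrow> T k (f t)"
    proof (rule AE_lebesgue_on_negligibleI[OF _ N])
      fix t assume "t \<in> {0..\<omega>} - N"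
      then have "(\<lambda>n. g n t) \<longlonglongrightarrow> f t" using g(2)[of t] by simp
      then show "(\<lambda>n. T k (g n t)) \<longlonglongrightarrow> T k (f t)"
        using contT by (intro continuous_on_tendsto_compose[OF contT]) auto
    qed simp
    show "norm (T k (f t) - T k (g n t)) \<le> 2 * real (Suc k)" for n t
      using order_trans[OF norm_triangle_ineq4 add_mono[OF T1[of k "f t"] T1[of k "g n t"]]] by simp
  qed auto
  then have "\<forall>\<^sub>F n in sequentially. (LINT t|lebesgue_on {0..\<omega>}. (norm (T k (f t) - T k (g n t)))\<^sup>2) < e / 4"
    using \<open>e > 0\<close> by (intro order_tendstoD) auto
  then obtain n where n: "(LINT t|lebesgue_on {0..\<omega>}. (norm (T k (f t) - T k (g n t)))\<^sup>2) < e / 4"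
    using eventually_happens' sequentially_bot by blast
  define c where "c t = T k (g n t)" for t
  have Tf: "(\<lambda>t. T k (f t)) \<in> L2 \<omega>"
  proof (rule L2_dominated[OF f f mT[OF mf]])
    fix t
    show "norm (T k (f t)) \<le> 1 * (norm (f t) + norm (f t))"
      using T2[of "f t" k] norm_triangle_ineq3[of "T k (f t)" "f t"] by (simp add: norm_minus_commute)
  qed
  have cL: "c \<in> L2 \<omega>" unfolding c_def by (rule L2_continuous_on[OF cTg])
  have i: "integrable (lebesgue_on {0..\<omega>}) (\<lambda>t. (norm (f t - T k (f t)))\<^sup>2)"
      "integrable (lebesgue_on {0..\<omega>}) (\<lambda>t. (norm (T k (f t) - c t))\<^sup>2)"
      "integrable (lebesgue_on {0..\<omega>}) (\<lambda>t. (norm (f t - c t))\<^sup>2)"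
    using L2_D(2)[OF L2_diff[OF f Tf]] L2_D(2)[OF L2_diff[OF Tf cL]] L2_D(2)[OF L2_diff[OF f cL]] by auto
  have "(LINT t|lebesgue_on {0..\<omega>}. (norm (f t - c t))\<^sup>2) \<le>
     (LINT t|lebesgue_on {0..\<omega>}. 2 * (norm (f t - T k (f t)))\<^sup>2 + 2 * (norm (T k (f t) - c t))\<^sup>2)"
  proof (rule integral_mono)
    fix t
    have "norm (f t - c t) \<le> norm (f t - T k (f t)) + norm (T k (f t) - c t)"
      using norm_triangle_ineq[of "f t - T k (f t)" "T k (f t) - c t"] by simp
    then have "(norm (f t - c t))\<^sup>2 \<le> (norm (f t - T k (f t)) + norm (T k (f t) - c t))\<^sup>2"
      by (intro power_mono) auto
    also have "\<dots> \<le> 2 * (norm (f t - T k (f t)))\<^sup>2 + 2 * (norm (T k (f t) - c t))\<^sup>2"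
      using sum_squares_bound[of "norm (f t - T k (f t))" "norm (T k (f t) - c t)"] by (simp add: power2_sum)
    finally show "(norm (f t - c t))\<^sup>2 \<le> 2 * (norm (f t - T k (f t)))\<^sup>2 + 2 * (norm (T k (f t) - c t))\<^sup>2" .
  qed (use i in auto)
  also have "\<dots> < e" using i k n by (simp add: c_def)
  finally have "l2_inner \<omega> (\<lambda>t. f t - c t) (\<lambda>t. f t - c t) < e"
    by (simp add: l2_inner_def power2_norm_eq_inner)
  then show ?thesis using that cTg[of n] by (simp add: c_def)
qed

text \<open>Duality for the norm with continuous test functions only. It supplies amplitudes of
  mean-square continuous noise that nearly attain \<open>l2_inner \<omega> u u\<close>, although
  \<open>u\<close> itself may be discontinuous.\<close>

lemma L2_norm_approx_continuous:
  fixes u :: "real \<Rightarrow> 'a::euclidean_space"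
  assumes u: "u \<in> L2 \<omega>" and "e > 0"
  obtains c where "continuous_on {0..\<omega>} c" "l2_inner \<omega> c c \<le> 1" "l2_inner \<omega> u u - e < (l2_inner \<omega> u c)\<^sup>2"
proof (cases "l2_inner \<omega> u u = 0")
  case True
  then show ?thesis using that[of "\<lambda>t. 0"] \<open>e > 0\<close> by (simp add: l2_inner_def)
next
  case False
  define J where "J = l2_inner \<omega> u u"
  have J: "J > 0" using False l2_inner_self_nonneg[of \<omega> u] by (simp add: J_def)
  have "\<exists>c. continuous_on {0..\<omega>} c \<and> l2_inner \<omega> (\<lambda>t. u t - c t) (\<lambda>t. u t - c t) < inverse (real (Suc n))" for n
    using L2_continuous_dense[OF u, of "inverse (real (Suc n))"] by (metis inverse_positive_iff_positive of_nat_0_less_iff zero_less_Suc)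
  then obtain c where c: "\<And>n. continuous_on {0..\<omega>} (c n)"
    "\<And>n. l2_inner \<omega> (\<lambda>t. u t - c n t) (\<lambda>t. u t - c n t) < inverse (real (Suc n))" by metis
  have cL: "c n \<in> L2 \<omega>" for n by (rule L2_continuous_on[OF c(1)])
  define d where "d n = l2_inner \<omega> (\<lambda>t. u t - c n t) (\<lambda>t. u t - c n t)" for n
  have d: "d \<longlonglongrightarrow> 0"
    using c(2) l2_inner_self_nonneg unfolding d_def
    by (intro real_tendsto_sandwich[OF _ _ tendsto_const LIMSEQ_inverse_real_of_nat] always_eventually allI)
      (auto intro: less_imp_le)
  have ud: "(J - l2_inner \<omega> u (c n))\<^sup>2 \<le> J * d n" for n
    using l2_inner_Cauchy_Schwarz[OF u L2_diff[OF u cL[of n]]]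
    by (simp add: J_def d_def l2_inner_diff_right[OF u cL u])
  have "(\<lambda>n. (J - l2_inner \<omega> u (c n))\<^sup>2) \<longlonglongrightarrow> 0"
    by (rule real_tendsto_sandwich[OF _ _ tendsto_const tendsto_mult_right_zero[OF d, of J]])
      (use ud in auto)
  from tendsto_real_sqrt[OF this] have "(\<lambda>n. J - l2_inner \<omega> u (c n)) \<longlonglongrightarrow> 0"
    by (simp add: tendsto_rabs_zero_iff)
  from tendsto_diff[OF tendsto_const[of J] this] have uc: "(\<lambda>n. l2_inner \<omega> u (c n)) \<longlonglongrightarrow> J" by simp
  have "l2_inner \<omega> (c n) (c n) = d n + 2 * l2_inner \<omega> u (c n) - J" for n
    using l2_inner_diff_self[OF u cL[of n]] by (simp add: d_def J_def)
  moreover have "(\<lambda>n. d n + 2 * l2_inner \<omega> u (c n) - J) \<longlonglongrightarrow> 0 + 2 * J - J"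
    by (intro tendsto_intros d uc)
  ultimately have cc: "(\<lambda>n. l2_inner \<omega> (c n) (c n)) \<longlonglongrightarrow> J" by simp
  \<comment> \<open>The quotient is the squared pairing of \<open>u\<close> with the normalised
    \<open>c n\<close>, so normalisation can wait until an index has been fixed.\<close>
  have "(\<lambda>n. (l2_inner \<omega> u (c n))\<^sup>2 / l2_inner \<omega> (c n) (c n)) \<longlonglongrightarrow> J\<^sup>2 / J"
    using J by (intro tendsto_intros uc cc) auto
  then have "\<forall>\<^sub>F n in sequentially. J - e < (l2_inner \<omega> u (c n))\<^sup>2 / l2_inner \<omega> (c n) (c n)"
    using J \<open>e > 0\<close> by (intro order_tendstoD(1)) (auto simp: power2_eq_square)
  moreover have "\<forall>\<^sub>F n in sequentially. 0 < l2_inner \<omega> (c n) (c n)"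
    using J by (intro order_tendstoD(1)[OF cc])
  ultimately have "\<forall>\<^sub>F n in sequentially. J - e < (l2_inner \<omega> u (c n))\<^sup>2 / l2_inner \<omega> (c n) (c n) \<and> 0 < l2_inner \<omega> (c n) (c n)"
    by (rule eventually_conj)
  then obtain n where n: "J - e < (l2_inner \<omega> u (c n))\<^sup>2 / l2_inner \<omega> (c n) (c n)" "0 < l2_inner \<omega> (c n) (c n)"
    using eventually_happens' sequentially_bot by blast
  define s where "s = 1 / sqrt (l2_inner \<omega> (c n) (c n))"
  have s: "s\<^sup>2 = 1 / l2_inner \<omega> (c n) (c n)" using n(2) by (simp add: s_def power_divide)
  show ?thesis
  proof
    show "continuous_on {0..\<omega>} (\<lambda>t. s *\<^sub>R c n t)" by (intro continuous_intros c)
    show "l2_inner \<omega> (\<lambda>t. s *\<^sub>R c n t) (\<lambda>t. s *\<^sub>R c n t) \<le> 1"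
      using s n(2) by (simp add: l2_inner_scaleR_left l2_inner_scaleR_right flip: mult.assoc power2_eq_square)
    show "l2_inner \<omega> u u - e < (l2_inner \<omega> u (\<lambda>t. s *\<^sub>R c n t))\<^sup>2"
      using s n(1) by (simp add: l2_inner_scaleR_right power_mult_distrib J_def)
  qed
qed

subsection \<open>The observation noise\<close>

lemma trace_correlation:
  fixes \<eta> :: "real \<Rightarrow> 'w \<Rightarrow> real^'m"
  assumes "\<eta> t \<in> borel_measurable M" "integrable M (\<lambda>w. (norm (\<eta> t w))\<^sup>2)"
  shows "trace (correlation M \<eta> t t) = (LINT w|M. (norm (\<eta> t w))\<^sup>2)"
proof -
  have eq: "(norm (\<eta> t w))\<^sup>2 = (\<Sum>i\<in>UNIV. \<eta> t w $ i * \<eta> t w $ i)" for w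
    by (simp add: power2_norm_eq_inner inner_vec_def)
  have "integrable M (\<lambda>w. \<eta> t w $ i * \<eta> t w $ i)" for i
  proof (rule Bochner_Integration.integrable_bound[OF assms(2)])
    show "(\<lambda>w. \<eta> t w $ i * \<eta> t w $ i) \<in> borel_measurable M"
      by (rule measurable_compose[OF assms(1)], rule borel_measurable_continuous_onI) (intro continuous_intros)
    have "\<eta> t w $ i * \<eta> t w $ i \<le> (norm (\<eta> t w))\<^sup>2" for w
      unfolding eq by (rule member_le_sum) auto
    then show "AE w in M. norm (\<eta> t w $ i * \<eta> t w $ i) \<le> norm ((norm (\<eta> t w))\<^sup>2)"
      by (intro AE_I2) simp
  qed
  then show ?thesis
    by (simp add: trace_def correlation_def eq Bochner_Integration.integral_sum)
qed

text \<open>Compactness of the interval turns local bounds into a global one. It gives content to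
  the trace constraint on the noise: the integral of a nonintegrable function is 0 by convention,
  and boundedness rules this case out.\<close>

lemma ms_continuous_process_bounded:
  fixes \<eta> :: "real \<Rightarrow> 'w \<Rightarrow> real^'m"
  assumes "ms_continuous_process \<omega> M \<eta>"
  obtains C where "\<And>t. t \<in> {0..\<omega>} \<Longrightarrow> (LINT w|M. (norm (\<eta> t w))\<^sup>2) \<le> C"
proof -
  define m where "m t = (LINT w|M. (norm (\<eta> t w))\<^sup>2)" for t
  have \<eta>: "\<eta> t \<in> borel_measurable M" "integrable M (\<lambda>w. (norm (\<eta> t w))\<^sup>2)"
    "((\<lambda>s. LINT w|M. (norm (\<eta> s w - \<eta> t w))\<^sup>2) \<longlongrightarrow> 0) (at t within {0..\<omega>})" if "t \<in> {0..\<omega>}" for t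
    using assms that by (auto simp: ms_continuous_process_def)
  \<comment> \<open>Near \<open>t\<close> the increment has mean square at most 1, and squaring a
    sum doubles both parts; hence the two constants 2.\<close>
  have "\<exists>r>0. \<forall>s\<in>ball t r \<inter> {0..\<omega>}. m s \<le> 2 * m t + 2" if t: "t \<in> {0..\<omega>}" for t
  proof -
    have "\<forall>\<^sub>F s in at t within {0..\<omega>}. (LINT w|M. (norm (\<eta> s w - \<eta> t w))\<^sup>2) < 1"
      using \<eta>(3)[OF t] by (rule order_tendstoD) simp
    then obtain r where r: "r > 0" "\<And>s. s \<in> {0..\<omega>} \<Longrightarrow> s \<noteq> t \<Longrightarrow> dist s t < r \<Longrightarrow>
        (LINT w|M. (norm (\<eta> s w - \<eta> t w))\<^sup>2) < 1"
      unfolding eventually_at by blast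
    have "m s \<le> 2 * m t + 2" if s: "s \<in> ball t r" "s \<in> {0..\<omega>}" for s
    proof -
      have le1: "(LINT w|M. (norm (\<eta> s w - \<eta> t w))\<^sup>2) \<le> 1"
        using r(2)[of s] s by (cases "s = t") (auto simp: dist_commute)
      have i: "integrable M (\<lambda>w. (norm (\<eta> s w - \<eta> t w))\<^sup>2)"
      proof (rule Bochner_Integration.integrable_bound)
        show "integrable M (\<lambda>w. 2 * (norm (\<eta> s w))\<^sup>2 + 2 * (norm (\<eta> t w))\<^sup>2)"
          using \<eta>(2)[OF t] \<eta>(2)[OF s(2)] by simp
        show "(\<lambda>w. (norm (\<eta> s w - \<eta> t w))\<^sup>2) \<in> borel_measurable M"
          using \<eta>(1)[OF t] \<eta>(1)[OF s(2)] by measurable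
        have "(norm (a - b))\<^sup>2 \<le> 2 * (norm a)\<^sup>2 + 2 * (norm b)\<^sup>2" for a b :: "real^'m"
        proof -
          have "(norm (a - b))\<^sup>2 \<le> (norm a + norm b)\<^sup>2" by (intro power_mono norm_triangle_ineq4) auto
          then show ?thesis using sum_squares_bound[of "norm a" "norm b"] by (simp add: power2_sum)
        qed
        then show "AE w in M. norm ((norm (\<eta> s w - \<eta> t w))\<^sup>2) \<le> norm (2 * (norm (\<eta> s w))\<^sup>2 + 2 * (norm (\<eta> t w))\<^sup>2)"
          by (intro AE_I2) simp
      qed
      have "m s \<le> (LINT w|M. 2 * (norm (\<eta> s w - \<eta> t w))\<^sup>2 + 2 * (norm (\<eta> t w))\<^sup>2)"
        unfolding m_def
      proof (rule integral_mono)
        fix w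
        have "norm (\<eta> s w) \<le> norm (\<eta> s w - \<eta> t w) + norm (\<eta> t w)"
          using norm_triangle_ineq[of "\<eta> s w - \<eta> t w" "\<eta> t w"] by simp
        then have "(norm (\<eta> s w))\<^sup>2 \<le> (norm (\<eta> s w - \<eta> t w) + norm (\<eta> t w))\<^sup>2" by (intro power_mono) auto
        then show "(norm (\<eta> s w))\<^sup>2 \<le> 2 * (norm (\<eta> s w - \<eta> t w))\<^sup>2 + 2 * (norm (\<eta> t w))\<^sup>2"
          using sum_squares_bound[of "norm (\<eta> s w - \<eta> t w)" "norm (\<eta> t w)"] by (simp add: power2_sum)
      qed (use i \<eta>(2)[OF t] \<eta>(2)[OF s(2)] in auto)
      also have "\<dots> \<le> 2 * m t + 2" using i \<eta>(2)[OF t] le1 by (simp add: m_def)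
      finally show ?thesis .
    qed
    then show ?thesis using r(1) by blast
  qed
  then obtain r where r: "\<And>t. t \<in> {0..\<omega>} \<Longrightarrow> r t > 0"
    "\<And>t s. t \<in> {0..\<omega>} \<Longrightarrow> s \<in> ball t (r t) \<inter> {0..\<omega>} \<Longrightarrow> m s \<le> 2 * m t + 2" by metis
  obtain F where F: "F \<subseteq> {0..\<omega>}" "finite F" "{0..\<omega>} \<subseteq> (\<Union>t\<in>F. ball t (r t))"
    by (rule compactE_image[of "{0..\<omega>}" "{0..\<omega>}" "\<lambda>t. ball t (r t)"]) (use r(1) in auto)
  have "m s \<le> (\<Sum>t\<in>F. 2 * m t + 2)" if s: "s \<in> {0..\<omega>}" for s
  proof -
    obtain t where t: "t \<in> F" "s \<in> ball t (r t)" using F(3) s by blast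
    have "m s \<le> 2 * m t + 2" using r(2)[of t s] t F(1) s by blast
    also have "\<dots> \<le> (\<Sum>t\<in>F. 2 * m t + 2)"
      using F(2) t(1) by (intro member_le_sum) (auto simp: m_def intro!: add_nonneg_nonneg)
    finally show ?thesis .
  qed
  then show ?thesis using that unfolding m_def by blast
qed

text \<open>Tonelli's theorem: the second moments are measurable and bounded in \<open>t\<close>, so
  the iterated integral is finite and equals the integral of the trace.\<close>

lemma admissible_noise_integrable:
  fixes \<eta> :: "real \<Rightarrow> 'w \<Rightarrow> real^'m"
  assumes "admissible_noise \<omega> M \<eta>"
  shows "integrable (lebesgue_on {0..\<omega>} \<Otimes>\<^sub>M M) (\<lambda>(t, w). (norm (\<eta> t w))\<^sup>2)"
    and "(LINT x|(lebesgue_on {0..\<omega>} \<Otimes>\<^sub>M M). (case x of (t, w) \<Rightarrow> (norm (\<eta> t w))\<^sup>2)) \<le> 1"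
proof -
  from assms have M: "prob_space M" and meas: "case_prod \<eta> \<in> borel_measurable (lebesgue_on {0..\<omega>} \<Otimes>\<^sub>M M)"
    and ms: "ms_continuous_process \<omega> M \<eta>"
    and tr: "(LINT t|lebesgue_on {0..\<omega>}. trace (correlation M \<eta> t t)) \<le> 1"
    by (auto simp: admissible_noise_def)
  interpret M: prob_space M by fact
  interpret L: finite_measure "lebesgue_on {0..\<omega>}" by (rule finite_measure_interval)
  interpret P: pair_sigma_finite "lebesgue_on {0..\<omega>}" M ..
  define m where "m t = (LINT w|M. (norm (\<eta> t w))\<^sup>2)" for t
  have \<eta>: "\<eta> t \<in> borel_measurable M" "integrable M (\<lambda>w. (norm (\<eta> t w))\<^sup>2)" if "t \<in> {0..\<omega>}" for t
    using ms that by (auto simp: ms_continuous_process_def)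
  obtain C where C: "\<And>t. t \<in> {0..\<omega>} \<Longrightarrow> m t \<le> C"
    using ms_continuous_process_bounded[OF ms] unfolding m_def by metis
  have meas2: "(\<lambda>(t, w). (norm (\<eta> t w))\<^sup>2) \<in> borel_measurable (lebesgue_on {0..\<omega>} \<Otimes>\<^sub>M M)"
    using meas by (simp add: split_def)
  have mm: "m \<in> borel_measurable (lebesgue_on {0..\<omega>})"
    unfolding m_def by (rule M.borel_measurable_lebesgue_integral[OF meas2])
  have im: "integrable (lebesgue_on {0..\<omega>}) m"
    using C mm by (intro L.integrable_const_bound[of _ C]) (auto simp: m_def)
  have "(LINT t|lebesgue_on {0..\<omega>}. trace (correlation M \<eta> t t)) = (LINT t|lebesgue_on {0..\<omega>}. m t)"
    by (rule Bochner_Integration.integral_cong) (simp_all add: trace_correlation[OF \<eta>] m_def)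
  then have m1: "(LINT t|lebesgue_on {0..\<omega>}. m t) \<le> 1" using tr by simp
  have "(\<integral>\<^sup>+x. ennreal (case x of (t, w) \<Rightarrow> (norm (\<eta> t w))\<^sup>2) \<partial>(lebesgue_on {0..\<omega>} \<Otimes>\<^sub>M M))
      = (\<integral>\<^sup>+t. (\<integral>\<^sup>+w. ennreal ((norm (\<eta> t w))\<^sup>2) \<partial>M) \<partial>lebesgue_on {0..\<omega>})"
    using meas2 by (subst M.nn_integral_fst[symmetric]) auto
  also have "\<dots> = (\<integral>\<^sup>+t. ennreal (m t) \<partial>lebesgue_on {0..\<omega>})"
    by (rule nn_integral_cong) (simp add: m_def nn_integral_eq_integral[OF \<eta>(2)])
  also have "\<dots> = ennreal (LINT t|lebesgue_on {0..\<omega>}. m t)"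
    by (rule nn_integral_eq_integral[OF im]) (simp add: m_def)
  finally have nn: "(\<integral>\<^sup>+x. ennreal (case x of (t, w) \<Rightarrow> (norm (\<eta> t w))\<^sup>2) \<partial>(lebesgue_on {0..\<omega>} \<Otimes>\<^sub>M M))
      = ennreal (LINT t|lebesgue_on {0..\<omega>}. m t)" .
  show int: "integrable (lebesgue_on {0..\<omega>} \<Otimes>\<^sub>M M) (\<lambda>(t, w). (norm (\<eta> t w))\<^sup>2)"
    by (rule integrableI_nn_integral_finite[OF meas2 _ nn]) (auto simp: m_def intro!: AE_I2)
  show "(LINT x|(lebesgue_on {0..\<omega>} \<Otimes>\<^sub>M M). (case x of (t, w) \<Rightarrow> (norm (\<eta> t w))\<^sup>2)) \<le> 1"
    using m1 by (subst integral_eq_nn_integral[OF meas2]) (auto simp: nn m_def intro!: AE_I2)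
qed

text \<open>The mean of the noise is zero, so deterministic and random errors add without a cross
  term. The random part is estimated path by path with the Cauchy-Schwarz inequality, and the
  expected path energy is at most 1.\<close>

lemma ms_error_le:
  fixes \<eta> :: "real \<Rightarrow> 'w \<Rightarrow> real^'m" and H :: "real \<Rightarrow> real^'n^'m"
  assumes \<eta>: "admissible_noise \<omega> M \<eta>" and u: "u \<in> L2 \<omega>" and Hx: "(\<lambda>t. H t *v x t) \<in> L2 \<omega>"
  shows "ms_error \<omega> H l u x M \<eta> \<le>
    ennreal ((l2_inner \<omega> l x - l2_inner \<omega> u (\<lambda>t. H t *v x t))\<^sup>2 + l2_inner \<omega> u u)"
proof -
  from \<eta> have M: "prob_space M" and meas: "case_prod \<eta> \<in> borel_measurable (lebesgue_on {0..\<omega>} \<Otimes>\<^sub>M M)"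
    and ms: "ms_continuous_process \<omega> M \<eta>" and mean: "\<And>t. t \<in> {0..\<omega>} \<Longrightarrow> (LINT w|M. \<eta> t w) = 0"
    by (auto simp: admissible_noise_def)
  interpret M: prob_space M by fact
  interpret L: finite_measure "lebesgue_on {0..\<omega>}" by (rule finite_measure_interval)
  interpret P: pair_sigma_finite "lebesgue_on {0..\<omega>}" M ..
  note mu [measurable] = L2_D(1)[OF u]
  note meas [measurable]
  note N = admissible_noise_integrable[OF \<eta>]
  have Mu: "integrable (lebesgue_on {0..\<omega>} \<Otimes>\<^sub>M M) (\<lambda>(t, w). (norm (u t))\<^sup>2)"
  proof (rule integrableI_bounded)
    show "(\<lambda>(t, w). (norm (u t))\<^sup>2) \<in> borel_measurable (lebesgue_on {0..\<omega>} \<Otimes>\<^sub>M M)" by measurable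
    have "(\<integral>\<^sup>+x. ennreal (norm (case x of (t, w) \<Rightarrow> (norm (u t))\<^sup>2)) \<partial>(lebesgue_on {0..\<omega>} \<Otimes>\<^sub>M M))
       = (\<integral>\<^sup>+t. (\<integral>\<^sup>+w. ennreal ((norm (u t))\<^sup>2) \<partial>M) \<partial>lebesgue_on {0..\<omega>})"
      by (subst M.nn_integral_fst[symmetric]) auto
    also have "\<dots> = ennreal (LINT t|lebesgue_on {0..\<omega>}. (norm (u t))\<^sup>2)"
      using L2_D(2)[OF u] by (simp add: M.emeasure_space_1 nn_integral_eq_integral)
    finally show "(\<integral>\<^sup>+x. ennreal (norm (case x of (t, w) \<Rightarrow> (norm (u t))\<^sup>2)) \<partial>(lebesgue_on {0..\<omega>} \<Otimes>\<^sub>M M)) < \<infinity>"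
      by simp
  qed
  have u\<eta>: "integrable (lebesgue_on {0..\<omega>} \<Otimes>\<^sub>M M) (\<lambda>(t, w). u t \<bullet> \<eta> t w)"
  proof (rule Bochner_Integration.integrable_bound[OF Bochner_Integration.integrable_add[OF Mu N(1)]])
    show "(\<lambda>(t, w). u t \<bullet> \<eta> t w) \<in> borel_measurable (lebesgue_on {0..\<omega>} \<Otimes>\<^sub>M M)"
      using meas by (simp add: split_def)
    have "\<bar>a \<bullet> b\<bar> \<le> (norm a)\<^sup>2 + (norm b)\<^sup>2" for a b :: "real^'m"
      using Cauchy_Schwarz_ineq2[of a b] sum_squares_bound[of "norm a" "norm b"]
        mult_nonneg_nonneg[OF norm_ge_zero norm_ge_zero, of a b] by linarith
    then show "AE x in lebesgue_on {0..\<omega>} \<Otimes>\<^sub>M M. norm (case x of (t, w) \<Rightarrow> u t \<bullet> \<eta> t w) \<le>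
        norm ((case x of (t, w) \<Rightarrow> (norm (u t))\<^sup>2) + (case x of (t, w) \<Rightarrow> (norm (\<eta> t w))\<^sup>2))"
      by (intro AE_I2) (simp add: split_def)
  qed
  \<comment> \<open>\<open>X\<close> is the random part of \<open>u(y)\<close> and \<open>Q\<close>
    the energy of a noise path.\<close>
  define X where "X w = l2_inner \<omega> u (\<lambda>t. \<eta> t w)" for w
  define Q where "Q w = l2_inner \<omega> (\<lambda>t. \<eta> t w) (\<lambda>t. \<eta> t w)" for w
  have Q_eq: "Q w = (LINT t|lebesgue_on {0..\<omega>}. (norm (\<eta> t w))\<^sup>2)" for w
    by (simp add: Q_def l2_inner_def power2_norm_eq_inner)
  have intX: "integrable M X" using P.integrable_snd[OF u\<eta>] by (simp add: X_def[abs_def] l2_inner_def)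
  have intQ: "integrable M Q" using P.integrable_snd[OF N(1)] by (simp add: Q_eq[abs_def])
  have Q1: "(LINT w|M. Q w) \<le> 1" using P.integral_snd[OF N(1)] N(2) by (simp add: Q_eq)
  have "(LINT w|M. X w) = (LINT t|lebesgue_on {0..\<omega>}. LINT w|M. u t \<bullet> \<eta> t w)"
    using P.Fubini_integral[OF u\<eta>] by (simp add: X_def l2_inner_def)
  also have "\<dots> = (LINT t|lebesgue_on {0..\<omega>}. 0)"
  proof (rule Bochner_Integration.integral_cong[OF refl])
    fix t assume "t \<in> space (lebesgue_on {0..\<omega>})"
    then have t: "t \<in> {0..\<omega>}" by simp
    have "integrable M (\<eta> t)"
    proof (rule Bochner_Integration.integrable_bound)
      show "integrable M (\<lambda>w. 1 + (norm (\<eta> t w))\<^sup>2)" "\<eta> t \<in> borel_measurable M"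
        using ms t by (auto simp: ms_continuous_process_def)
      have "norm (\<eta> t w) \<le> 1 + (norm (\<eta> t w))\<^sup>2" for w
        using sum_squares_bound[of 1 "norm (\<eta> t w)"] norm_ge_zero[of "\<eta> t w"] by (simp del: norm_ge_zero)
      then show "AE w in M. norm (\<eta> t w) \<le> norm (1 + (norm (\<eta> t w))\<^sup>2)" by (intro AE_I2) simp
    qed
    then show "(LINT w|M. u t \<bullet> \<eta> t w) = 0" using mean[OF t] by simp
  qed
  finally have EX: "(LINT w|M. X w) = 0" by simp
  \<comment> \<open>Only almost every path is known to be square integrable, so additivity of
    \<open>l2_inner\<close> and the Cauchy-Schwarz inequality are available just for those
    paths.\<close>
  have "AE w in M. integrable (lebesgue_on {0..\<omega>}) (\<lambda>t. (norm (\<eta> t w))\<^sup>2)"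
    using P.AE_integrable_snd[OF N(1)] .
  then have L2: "AE w in M. (\<lambda>t. \<eta> t w) \<in> L2 \<omega>"
  proof (rule AE_mp, intro AE_I2 impI)
    fix w assume "w \<in> space M" "integrable (lebesgue_on {0..\<omega>}) (\<lambda>t. (norm (\<eta> t w))\<^sup>2)"
    moreover have "(\<lambda>t. \<eta> t w) \<in> borel_measurable (lebesgue_on {0..\<omega>})"
      using measurable_compose[OF measurable_Pair2'[OF \<open>w \<in> space M\<close>] meas] by simp
    ultimately show "(\<lambda>t. \<eta> t w) \<in> L2 \<omega>" by (simp add: L2_def)
  qed
  have CS: "AE w in M. (X w)\<^sup>2 \<le> l2_inner \<omega> u u * Q w"
    using L2 by eventually_elim (simp add: X_def Q_def l2_inner_Cauchy_Schwarz[OF u])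
  have intX2: "integrable M (\<lambda>w. (X w)\<^sup>2)"
  proof (rule Bochner_Integration.integrable_bound)
    show "integrable M (\<lambda>w. l2_inner \<omega> u u * Q w)" using intQ by simp
    show "AE w in M. norm ((X w)\<^sup>2) \<le> norm (l2_inner \<omega> u u * Q w)"
      using CS by eventually_elim simp
  qed (use intX in measurable)
  have "(LINT w|M. (X w)\<^sup>2) \<le> (LINT w|M. l2_inner \<omega> u u * Q w)"
    using CS intX2 intQ by (intro integral_mono_AE) auto
  also have "\<dots> \<le> l2_inner \<omega> u u * 1"
    using Q1 l2_inner_self_nonneg[of \<omega> u] by (simp add: mult_left_le)
  finally have EX2: "(LINT w|M. (X w)\<^sup>2) \<le> l2_inner \<omega> u u" by simp
  define a where "a = l2_inner \<omega> l x - l2_inner \<omega> u (\<lambda>t. H t *v x t)"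
  have "ms_error \<omega> H l u x M \<eta> = (\<integral>\<^sup>+w. ennreal ((a - X w)\<^sup>2) \<partial>M)"
    unfolding ms_error_def
  proof (rule nn_integral_cong_AE, use L2 in eventually_elim)
    case (elim w)
    then show ?case by (simp add: a_def X_def l2_inner_add_right[OF Hx elim u] diff_diff_eq)
  qed
  also have "\<dots> = ennreal (LINT w|M. (a - X w)\<^sup>2)"
  proof (rule nn_integral_eq_integral)
    show "integrable M (\<lambda>w. (a - X w)\<^sup>2)" using intX intX2 by (simp add: power2_diff)
  qed simp
  also have "(LINT w|M. (a - X w)\<^sup>2) = a\<^sup>2 + (LINT w|M. (X w)\<^sup>2)"
    using intX intX2 EX by (simp add: power2_diff M.prob_space)
  also have "ennreal (a\<^sup>2 + (LINT w|M. (X w)\<^sup>2)) \<le> ennreal (a\<^sup>2 + l2_inner \<omega> u u)"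
    using EX2 by (intro ennreal_leI) simp
  finally show ?thesis by (simp only: a_def)
qed

text \<open>A fair random sign times \<open>c\<close>: the mean is zero, the correlation is
  \<open>c t\<close> times the transpose of \<open>c s\<close>, and averaging over the sign removes
  the cross term of the error.\<close>

lemma two_point_noise:
  fixes c :: "real \<Rightarrow> real^'m" and w1 w2 :: 'w
  assumes c: "continuous_on {0..\<omega>} c" "l2_inner \<omega> c c \<le> 1" and "w1 \<noteq> w2"
    and u: "u \<in> L2 \<omega>" and Hx: "(\<lambda>t. H t *v x t) \<in> L2 \<omega>"
  obtains M :: "'w measure" and \<eta> where "admissible_noise \<omega> M \<eta>"
    "ms_error \<omega> H l u x M \<eta> =
      ennreal ((l2_inner \<omega> l x - l2_inner \<omega> u (\<lambda>t. H t *v x t))\<^sup>2 + (l2_inner \<omega> u c)\<^sup>2)"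
proof -
  define M where "M = measure_pmf (pmf_of_set {w1, w2})"
  define \<xi> where "\<xi> w = (if w = w1 then 1 else - 1 :: real)" for w
  define \<eta> where "\<eta> t w = \<xi> w *\<^sub>R c t" for t w
  have \<xi>2: "\<xi> w * \<xi> w = 1" "(\<xi> w)\<^sup>2 = 1" "\<bar>\<xi> w\<bar> = 1" for w by (auto simp: \<xi>_def)
  interpret M: prob_space M unfolding M_def by (rule measure_pmf.prob_space_axioms)
  have E\<xi>: "(LINT w|M. \<xi> w) = 0"
    unfolding M_def using \<open>w1 \<noteq> w2\<close> by (subst integral_pmf_of_set) (auto simp: \<xi>_def)
  \<comment> \<open>Every subset of the sample space is measurable for \<open>M\<close>, so every
    function on it is a random variable.\<close>
  have m\<xi>: "f \<in> measurable M N" if "space N = UNIV" for f :: "'w \<Rightarrow> 'b" and N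
    using that by (simp add: M_def)
  have mc: "c \<in> borel_measurable (lebesgue_on {0..\<omega>})"
    by (rule borel_measurable_continuous_on_interval[OF c(1)])
  have cL: "c \<in> L2 \<omega>" by (rule L2_continuous_on[OF c(1)])
  have norm_\<eta>: "norm (\<eta> t w) = norm (c t)" for t w by (simp add: \<eta>_def \<xi>2)
  have "admissible_noise \<omega> M \<eta>"
    unfolding admissible_noise_def
  proof (intro conjI ballI)
    show "prob_space M" by (rule M.prob_space_axioms)
    have "(\<lambda>p. \<xi> (snd p) *\<^sub>R c (fst p)) \<in> borel_measurable (lebesgue_on {0..\<omega>} \<Otimes>\<^sub>M M)"
      by (intro borel_measurable_scaleR measurable_compose[OF measurable_snd m\<xi>] measurable_compose[OF measurable_fst mc]) simp
    then show "case_prod \<eta> \<in> borel_measurable (lebesgue_on {0..\<omega>} \<Otimes>\<^sub>M M)"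
      by (simp add: \<eta>_def split_def)
    show "ms_continuous_process \<omega> M \<eta>"
      unfolding ms_continuous_process_def
    proof (intro conjI ballI)
      fix t assume t: "t \<in> {0..\<omega>}"
      show "\<eta> t \<in> borel_measurable M" by (rule m\<xi>) simp
      show "integrable M (\<lambda>w. (norm (\<eta> t w))\<^sup>2)" by (simp add: norm_\<eta>)
      have "norm (\<eta> s w - \<eta> t w) = norm (c s - c t)" for s w
        by (simp add: \<eta>_def \<xi>2 flip: scaleR_diff_right)
      then have "(\<lambda>s. LINT w|M. (norm (\<eta> s w - \<eta> t w))\<^sup>2) = (\<lambda>s. (norm (c s - c t))\<^sup>2)"
        by (simp add: M.prob_space)
      moreover have "((\<lambda>s. (norm (c s - c t))\<^sup>2) \<longlongrightarrow> (norm (c t - c t))\<^sup>2) (at t within {0..\<omega>})"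
        using c(1) t by (intro tendsto_intros) (auto simp: continuous_on_def)
      ultimately show "((\<lambda>s. LINT w|M. (norm (\<eta> s w - \<eta> t w))\<^sup>2) \<longlongrightarrow> 0) (at t within {0..\<omega>})" by simp
    qed
    show "(LINT w|M. \<eta> t w) = 0" for t
    proof -
      have "integrable M \<xi>"
        by (rule M.integrable_const_bound[of _ 1]) (auto simp: \<xi>2 intro!: m\<xi>)
      then show ?thesis by (simp add: \<eta>_def E\<xi>)
    qed
    have "trace (correlation M \<eta> t t) = c t \<bullet> c t" for t
      by (subst trace_correlation) (auto simp: norm_\<eta> power2_norm_eq_inner M.prob_space intro!: m\<xi>)
    then show "(LINT t|lebesgue_on {0..\<omega>}. trace (correlation M \<eta> t t)) \<le> 1"
      using c(2) by (simp add: l2_inner_def)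
  qed
  moreover have "ms_error \<omega> H l u x M \<eta> =
      ennreal ((l2_inner \<omega> l x - l2_inner \<omega> u (\<lambda>t. H t *v x t))\<^sup>2 + (l2_inner \<omega> u c)\<^sup>2)"
  proof -
    define a where "a = l2_inner \<omega> l x - l2_inner \<omega> u (\<lambda>t. H t *v x t)"
    define b where "b = l2_inner \<omega> u c"
    have "l2_inner \<omega> u (\<lambda>t. H t *v x t + \<eta> t w) = l2_inner \<omega> u (\<lambda>t. H t *v x t) + \<xi> w * b" for w
      unfolding \<eta>_def b_def
      by (simp add: l2_inner_add_right[OF Hx L2_scaleR[OF cL] u] l2_inner_scaleR_right)
    then have "ms_error \<omega> H l u x M \<eta> = (\<integral>\<^sup>+w. ennreal ((a - \<xi> w * b)\<^sup>2) \<partial>M)"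
      by (simp add: ms_error_def a_def algebra_simps)
    also have "\<dots> = ennreal (LINT w|M. (a - \<xi> w * b)\<^sup>2)"
    proof (rule nn_integral_eq_integral)
      show "integrable M (\<lambda>w. (a - \<xi> w * b)\<^sup>2)"
        unfolding M_def by (rule integrable_measure_pmf_finite) simp
    qed simp
    also have "(LINT w|M. (a - \<xi> w * b)\<^sup>2) = a\<^sup>2 + b\<^sup>2"
      unfolding M_def using \<open>w1 \<noteq> w2\<close>
      by (subst integral_pmf_of_set) (auto simp: \<xi>_def power2_eq_square field_simps)
    finally show ?thesis by (simp add: a_def b_def)
  qed
  ultimately show ?thesis by (rule that)
qed

subsection \<open>The guaranteed error\<close>

text \<open>With the state fixed, the noise alone can raise the error arbitrarily close to the bound
  of \<open>ms_error_le\<close>. The slack \<open>e\<close> is there because no continuous amplitude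
  need attain it.\<close>

lemma guaranteed_error_ge:
  fixes u :: "real \<Rightarrow> real^'m" and H :: "real \<Rightarrow> real^'n^'m" and B :: "real \<Rightarrow> real^'r^'n"
  assumes two: "\<exists>w1 w2 :: 'w. w1 \<noteq> w2" and u: "u \<in> L2 \<omega>"
    and x: "x \<in> admissible_state \<omega> A B" and Hx: "(\<lambda>t. H t *v x t) \<in> L2 \<omega>"
  shows "ennreal ((l2_inner \<omega> l x - l2_inner \<omega> u (\<lambda>t. H t *v x t))\<^sup>2 + l2_inner \<omega> u u)
    \<le> guaranteed_error TYPE('w) \<omega> A B H l u"
proof (rule ennreal_le_epsilon)
  fix e :: real assume "0 < e"
  define a where "a = l2_inner \<omega> l x - l2_inner \<omega> u (\<lambda>t. H t *v x t)"
  obtain c where c: "continuous_on {0..\<omega>} c" "l2_inner \<omega> c c \<le> 1"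
      "l2_inner \<omega> u u - e < (l2_inner \<omega> u c)\<^sup>2"
    by (rule L2_norm_approx_continuous[OF u \<open>0 < e\<close>])
  obtain w1 w2 :: 'w where "w1 \<noteq> w2" using two by blast
  then obtain M :: "'w measure" and \<eta> where M: "admissible_noise \<omega> M \<eta>"
    "ms_error \<omega> H l u x M \<eta> = ennreal (a\<^sup>2 + (l2_inner \<omega> u c)\<^sup>2)"
    unfolding a_def by (rule two_point_noise[OF c(1,2) _ u Hx])
  have "ennreal (a\<^sup>2 + l2_inner \<omega> u u) \<le> ennreal (a\<^sup>2 + (l2_inner \<omega> u c)\<^sup>2 + e)"
    using c(3) by (intro ennreal_leI) simp
  also have "\<dots> = ms_error \<omega> H l u x M \<eta> + ennreal e"
    using \<open>0 < e\<close> M(2) by (simp del: ennreal_plus add: ennreal_plus[symmetric])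
  also have "ms_error \<omega> H l u x M \<eta> \<le> guaranteed_error TYPE('w) \<omega> A B H l u"
    unfolding guaranteed_error_def using x M(1) by (intro Sup_upper) blast
  finally show "ennreal ((l2_inner \<omega> l x - l2_inner \<omega> u (\<lambda>t. H t *v x t))\<^sup>2 + l2_inner \<omega> u u)
      \<le> guaranteed_error TYPE('w) \<omega> A B H l u + ennreal e"
    by (simp add: a_def add_right_mono)
qed

section \<open>Error bounds from solutions of the boundary value problem\<close>

context periodic_estimation
begin

text \<open>Square integrability of the derivative is automatic: almost everywhere it equals the
  right-hand side, which is square integrable.\<close>

lemma admissible_stateI:
  assumes f: "f \<in> L2 \<omega>" "l2_inner \<omega> f f \<le> 1"
    and x: "periodic_solution \<omega> (\<lambda>t. A t *v x t + B t *v f t) x"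
  shows "x \<in> admissible_state \<omega> A B"
proof -
  have "continuous_on {0..\<omega>} x"
    using x by (auto simp: periodic_solution_def intro: abs_cont_on_imp_continuous_on)
  then have L: "(\<lambda>t. A t *v x t + B t *v f t) \<in> L2 \<omega>"
    using f by (intro L2_add L2_matrix_mult cont_A cont_B) (auto intro: L2_continuous_on)
  have "AE t in lebesgue_on {0..\<omega>}. (x has_vector_derivative A t *v x t + B t *v f t) (at t within {0..\<omega>})"
    using x by (simp add: periodic_solution_def)
  moreover have "AE t in lebesgue_on {0..\<omega>}. t \<in> {0..\<omega>}" by (rule AE_I2) simp
  ultimately have "AE t in lebesgue_on {0..\<omega>}.
      vector_derivative x (at t within {0..\<omega>}) = A t *v x t + B t *v f t"
    by eventually_elim (use pos in \<open>auto intro!: vector_derivative_within_cbox[where a=0 and b=\<omega>, simplified]\<close>)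
  with L have "(\<lambda>t. vector_derivative x (at t within {0..\<omega>})) \<in> L2 \<omega>" by (rule L2_AE_cong)
  then show ?thesis
    using f x by (auto simp: admissible_state_def admissible_input_def)
qed

lemma L2_observation:
  assumes "x \<in> admissible_state \<omega> A B"
  shows "(\<lambda>t. H t *v x t) \<in> L2 \<omega>"
proof (rule L2_matrix_mult[OF cont_H L2_continuous_on])
  show "continuous_on {0..\<omega>} x"
    using assms by (auto simp: admissible_state_def periodic_solution_def intro: abs_cont_on_imp_continuous_on)
qed

text \<open>Periodicity cancels the boundary terms, so the unknown initial state leaves the error
  and only the bounded input \<open>f\<close> remains.\<close>

lemma estimation_bvp_Green:
  assumes zp: "estimation_bvp \<omega> A B H l z p" and l: "l \<in> L2 \<omega>" and f: "f \<in> L2 \<omega>"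
    and x: "periodic_solution \<omega> (\<lambda>t. A t *v x t + B t *v f t) x"
  shows "l2_inner \<omega> l x - l2_inner \<omega> (\<lambda>t. H t *v p t) (\<lambda>t. H t *v x t) =
    l2_inner \<omega> (\<lambda>t. transpose (B t) *v z t) f"
  using hamiltonian_Green[of l z p x f] assms
  by (simp add: estimation_bvp_iff periodic_solution_def del: transpose_matrix_vector)

text \<open>Green's formula with \<open>x = p\<close>: the second component is itself a periodic
  trajectory, driven by \<open>B' z\<close>.\<close>

lemma estimation_bvp_energy:
  assumes zp: "estimation_bvp \<omega> A B H l z p" and l: "l \<in> L2 \<omega>"
  shows "l2_inner \<omega> l p = l2_inner \<omega> (\<lambda>t. H t *v p t) (\<lambda>t. H t *v p t) +
    l2_inner \<omega> (\<lambda>t. transpose (B t) *v z t) (\<lambda>t. transpose (B t) *v z t)"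
proof -
  have "hamiltonian_solution l z p" using zp by (simp add: estimation_bvp_iff)
  moreover have "periodic_solution \<omega> (\<lambda>t. A t *v p t + B t *v (transpose (B t) *v z t)) p"
    using zp by (simp only: estimation_bvp_def)
  ultimately show ?thesis
    using estimation_bvp_Green[OF zp l hamiltonian_solution_L2(6)] by fastforce
qed

lemma guaranteed_error_optimal_le:
  assumes zp: "estimation_bvp \<omega> A B H l z p" and l: "l \<in> L2 \<omega>"
  shows "guaranteed_error TYPE('w) \<omega> A B H l (\<lambda>t. H t *v p t) \<le> ennreal (l2_inner \<omega> l p)"
  unfolding guaranteed_error_def
proof (rule Sup_least, clarify)
  fix x and M :: "'w measure" and \<eta> :: "real \<Rightarrow> 'w \<Rightarrow> real^'m"
  assume x: "x \<in> admissible_state \<omega> A B" and \<eta>: "admissible_noise \<omega> M \<eta>"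
  define u where "u t = H t *v p t" for t
  define b where "b t = transpose (B t) *v z t" for t
  from zp have "hamiltonian_solution l z p" by (simp add: estimation_bvp_iff)
  then have u: "u \<in> L2 \<omega>" and b: "b \<in> L2 \<omega>"
    unfolding u_def b_def by (auto dest: hamiltonian_solution_L2 simp del: transpose_matrix_vector)
  obtain f where f: "f \<in> L2 \<omega>" "l2_inner \<omega> f f \<le> 1"
    and sol: "periodic_solution \<omega> (\<lambda>t. A t *v x t + B t *v f t) x"
    using x by (auto simp: admissible_state_def admissible_input_def)
  have "ms_error \<omega> H l u x M \<eta> \<le>
      ennreal ((l2_inner \<omega> l x - l2_inner \<omega> u (\<lambda>t. H t *v x t))\<^sup>2 + l2_inner \<omega> u u)"
    by (rule ms_error_le[OF \<eta> u L2_observation[OF x]])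
  also have "l2_inner \<omega> l x - l2_inner \<omega> u (\<lambda>t. H t *v x t) = l2_inner \<omega> b f"
    unfolding u_def b_def by (rule estimation_bvp_Green[OF zp l f(1) sol])
  also have "ennreal ((l2_inner \<omega> b f)\<^sup>2 + l2_inner \<omega> u u) \<le> ennreal (l2_inner \<omega> l p)"
  proof (rule ennreal_leI)
    have "(l2_inner \<omega> b f)\<^sup>2 \<le> l2_inner \<omega> b b * l2_inner \<omega> f f"
      by (rule l2_inner_Cauchy_Schwarz[OF b f(1)])
    also have "\<dots> \<le> l2_inner \<omega> b b"
      using f(2) l2_inner_self_nonneg[of \<omega> b] by (intro mult_left_le)
    finally show "(l2_inner \<omega> b f)\<^sup>2 + l2_inner \<omega> u u \<le> l2_inner \<omega> l p"
      using estimation_bvp_energy[OF zp l] unfolding u_def b_def by linarith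
  qed
  finally show "ms_error \<omega> H l (\<lambda>t. H t *v p t) x M \<eta> \<le> ennreal (l2_inner \<omega> l p)"
    by (simp add: u_def)
qed

text \<open>The states \<open>s *\<^sub>R p\<close>, driven by the inputs \<open>s *\<^sub>R B' z\<close>, are the worst ones. Completing the
  square in the error they produce leaves the distance from \<open>v\<close> to the optimal estimate.\<close>

lemma guaranteed_error_lower_bound:
  assumes two: "\<exists>w1 w2 :: 'w. w1 \<noteq> w2"
    and zp: "estimation_bvp \<omega> A B H l z p" and l: "l \<in> L2 \<omega>" and v: "v \<in> L2 \<omega>"
  shows "ennreal (l2_inner \<omega> l p + l2_inner \<omega> (\<lambda>t. v t - H t *v p t) (\<lambda>t. v t - H t *v p t))
    \<le> guaranteed_error TYPE('w) \<omega> A B H l v"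
proof -
  define u where "u t = H t *v p t" for t
  define b where "b t = transpose (B t) *v z t" for t
  \<comment> \<open>This is \<open>(u - v, u)\<close>. With the energy \<open>c\<close> of the input
    \<open>B' z\<close>, the deterministic error of \<open>v\<close> on the state \<open>p\<close>
    becomes \<open>c + g\<close>.\<close>
  define g where "g = l2_inner \<omega> u u - l2_inner \<omega> v u"
  define c where "c = l2_inner \<omega> b b"
  define D where "D = l2_inner \<omega> (\<lambda>t. v t - u t) (\<lambda>t. v t - u t)"
  from zp have ham: "hamiltonian_solution l z p" by (simp add: estimation_bvp_iff)
  then have u: "u \<in> L2 \<omega>" and b: "b \<in> L2 \<omega>"
    unfolding u_def b_def by (auto dest: hamiltonian_solution_L2 simp del: transpose_matrix_vector)
  have lp: "l2_inner \<omega> l p = l2_inner \<omega> u u + c"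
    unfolding u_def b_def c_def by (rule estimation_bvp_energy[OF zp l])
  have vv: "l2_inner \<omega> v v = D + l2_inner \<omega> u u - 2 * g"
    using l2_inner_diff_self[OF v u] by (simp add: D_def g_def)
  have "c \<ge> 0" "D \<ge> 0" by (auto simp: c_def D_def l2_inner_self_nonneg)
  have bound: "ennreal ((s * (c + g))\<^sup>2 + l2_inner \<omega> v v) \<le> guaranteed_error TYPE('w) \<omega> A B H l v"
    if s: "s\<^sup>2 * c \<le> 1" for s
  proof -
    define x where "x t = s *\<^sub>R p t" for t
    have hx: "hamiltonian_solution (\<lambda>t. s *\<^sub>R l t) (\<lambda>t. s *\<^sub>R z t) x"
      unfolding x_def by (rule hamiltonian_solution_scaleR[OF ham])
    have "periodic_solution \<omega> (\<lambda>t. A t *v x t + B t *v (s *\<^sub>R b t)) x"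
      using hx zp by (simp add: periodic_solution_def hamiltonian_solution_def estimation_bvp_iff b_def x_def
          matrix_vector_mult_scaleR del: transpose_matrix_vector)
    then have x: "x \<in> admissible_state \<omega> A B"
      using s by (intro admissible_stateI[OF L2_scaleR[OF b, of s]])
        (simp_all add: l2_inner_scaleR_left l2_inner_scaleR_right c_def power2_eq_square mult.assoc)
    have "(\<lambda>t. H t *v x t) = (\<lambda>t. s *\<^sub>R u t)" by (simp add: x_def u_def matrix_vector_mult_scaleR)
    then have "l2_inner \<omega> l x - l2_inner \<omega> v (\<lambda>t. H t *v x t) = s * (c + g)"
      unfolding x_def[abs_def] by (simp add: l2_inner_scaleR_right lp g_def algebra_simps)
    then show ?thesis
      using guaranteed_error_ge[OF two v x L2_observation[OF x], of l] by simp
  qed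
  have "ennreal (l2_inner \<omega> l p + D) \<le> guaranteed_error TYPE('w) \<omega> A B H l v"
  proof (cases "c = 0")
    case False
    then have "c > 0" using \<open>c \<ge> 0\<close> by simp
    \<comment> \<open>The multiple \<open>1 / sqrt c\<close> exhausts the input constraint. The term
      \<open>2 * g\<close> cancels the one in \<open>vv\<close>, leaving the nonnegative surplus
      \<open>g\<^sup>2 / c\<close>.\<close>
    have "(1 / sqrt c * (c + g))\<^sup>2 = c + 2 * g + g\<^sup>2 / c"
      using \<open>c > 0\<close> by (simp add: power_mult_distrib power_divide power2_sum field_simps power2_eq_square)
    moreover have "g\<^sup>2 / c \<ge> 0" using \<open>c > 0\<close> by simp
    ultimately have "l2_inner \<omega> l p + D \<le> (1 / sqrt c * (c + g))\<^sup>2 + l2_inner \<omega> v v"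
      unfolding lp vv by linarith
    then have "ennreal (l2_inner \<omega> l p + D) \<le> ennreal ((1 / sqrt c * (c + g))\<^sup>2 + l2_inner \<omega> v v)"
      by (rule ennreal_leI)
    also have "\<dots> \<le> guaranteed_error TYPE('w) \<omega> A B H l v"
      by (rule bound) (use \<open>c > 0\<close> in \<open>simp add: power_divide\<close>)
    finally show ?thesis .
  next
    \<comment> \<open>Now \<open>B' z\<close> vanishes almost everywhere, so \<open>p\<close> solves
      the homogeneous problem and all its multiples are admissible. Either \<open>v\<close>
      reproduces the pairing with \<open>p\<close> exactly and the noise part suffices, or its error
      is unbounded.\<close>
    case c0: True
    show ?thesis
    proof (cases "g = 0")
      case True
      then show ?thesis using bound[of 0] c0 by (simp add: lp vv add.commute)
    next
      case False
      \<comment> \<open>Scaled so that the deterministic error alone already equals the required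
        bound.\<close>
      define s where "s = sqrt (l2_inner \<omega> u u + D) / g"
      have "(s * (c + g))\<^sup>2 = l2_inner \<omega> u u + D"
        using False c0 \<open>D \<ge> 0\<close> l2_inner_self_nonneg[of \<omega> u] by (simp add: s_def)
      then have "ennreal (l2_inner \<omega> l p + D) \<le> ennreal ((s * (c + g))\<^sup>2 + l2_inner \<omega> v v)"
        using c0 l2_inner_self_nonneg[of \<omega> v] by (intro ennreal_leI) (simp add: lp)
      also have "\<dots> \<le> guaranteed_error TYPE('w) \<omega> A B H l v" by (rule bound) (simp add: c0)
      finally show ?thesis .
    qed
  qed
  then show ?thesis by (simp add: D_def u_def)
qed

text \<open>The linear independence of the observed basis enters only here.\<close>

lemma homogeneous_estimation_bvp:
  assumes basis: "homogeneous_basis \<omega> A N \<psi>"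
    and indep: "lin_indep_family {0..\<omega>} N (\<lambda>k t. H t *v \<psi> k t)"
    and zp: "estimation_bvp \<omega> A B H (\<lambda>t. 0) z p" and t: "t \<in> {0..\<omega>}"
  shows "p t = 0"
proof -
  note [simp del] = transpose_matrix_vector
  have 0: "(\<lambda>t. 0 :: real^'n) \<in> L2 \<omega>" by (rule L2_continuous_on) simp
  from zp have ham: "hamiltonian_solution (\<lambda>t. 0) z p" by (simp add: estimation_bvp_iff)
  have "l2_inner \<omega> (\<lambda>t. 0) p = 0" by (simp add: l2_inner_def)
  \<comment> \<open>For \<open>l = 0\<close> the energy identity says that two squared norms add up
    to 0. Continuity then gives vanishing at every point, as the pointwise notion of independence
    requires.\<close>
  then have nul: "l2_inner \<omega> (\<lambda>t. H t *v p t) (\<lambda>t. H t *v p t) = 0"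
      "l2_inner \<omega> (\<lambda>t. transpose (B t) *v z t) (\<lambda>t. transpose (B t) *v z t) = 0"
    using estimation_bvp_energy[OF zp 0] l2_inner_self_nonneg[of \<omega> "\<lambda>t. H t *v p t"]
      l2_inner_self_nonneg[of \<omega> "\<lambda>t. transpose (B t) *v z t"] by linarith+
  have Hp: "H s *v p s = 0" if "s \<in> {0..\<omega>}" for s
    by (rule l2_inner_self_eq_0_continuous[OF _ nul(1) that pos])
      (intro continuous_intros cont_H hamiltonian_solution_L2[OF ham])
  have Bz: "transpose (B s) *v z s = 0" if "s \<in> {0..\<omega>}" for s
    by (rule l2_inner_self_eq_0_continuous[OF _ nul(2) that pos])
      (intro continuous_intros cont_B hamiltonian_solution_L2[OF ham])
  have "AE s in lebesgue_on {0..\<omega>}. s \<in> {0..\<omega>}" by (rule AE_I2) simp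
  moreover have "AE s in lebesgue_on {0..\<omega>}. (p has_vector_derivative
      A s *v p s + B s *v (transpose (B s) *v z s)) (at s within {0..\<omega>})"
    using ham by (simp add: hamiltonian_solution_def)
  ultimately have "AE s in lebesgue_on {0..\<omega>}. (p has_vector_derivative A s *v p s) (at s within {0..\<omega>})"
    by eventually_elim (simp add: Bz)
  then have "periodic_solution \<omega> (\<lambda>t. A t *v p t) p"
    using ham zp by (simp add: periodic_solution_def hamiltonian_solution_def estimation_bvp_iff)
  then obtain c where c: "\<And>t. t \<in> {0..\<omega>} \<Longrightarrow> p t = (\<Sum>k<N. c k *\<^sub>R \<psi> k t)"
    using basis unfolding homogeneous_basis_def by blast
  have "(\<Sum>k<N. c k *\<^sub>R (H s *v \<psi> k s)) = 0" if "s \<in> {0..\<omega>}" for s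
    using Hp[OF that] c[OF that] by (simp add: matrix_vector_mult_scaleR linear_sum[OF matrix_vector_mul_linear])
  then have "\<forall>k<N. c k = 0" using indep unfolding lin_indep_family_def by blast
  then show ?thesis using c[OF t] by simp
qed

text \<open>Each problem serves as trajectory in Green's formula for the other. The terms with
  \<open>H\<close> and \<open>B\<close> are symmetric, so the two functionals agree.\<close>

lemma estimation_filtering_duality:
  assumes zp: "estimation_bvp \<omega> A B H l z p" and l: "l \<in> L2 \<omega>"
    and y: "y \<in> L2 \<omega>" and qx: "filtering_bvp \<omega> A B H y q x"
  shows "l2_inner \<omega> (\<lambda>t. H t *v p t) y = l2_inner \<omega> l x"
proof -
  note [simp del] = transpose_matrix_vector
  define h where "h t = transpose (H t) *v y t" for t
  have h: "h \<in> L2 \<omega>" unfolding h_def by (intro L2_matrix_mult continuous_intros cont_H y)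
  have qx': "estimation_bvp \<omega> A B H h q x" using qx unfolding filtering_bvp_iff h_def .
  from zp qx' have ham: "hamiltonian_solution l z p" "hamiltonian_solution h q x"
    by (auto simp: estimation_bvp_iff)
  have "l2_inner \<omega> l x - l2_inner \<omega> (\<lambda>t. H t *v p t) (\<lambda>t. H t *v x t) =
      l2_inner \<omega> (\<lambda>t. transpose (B t) *v z t) (\<lambda>t. transpose (B t) *v q t)"
    using qx' by (intro estimation_bvp_Green[OF zp l hamiltonian_solution_L2(6)[OF ham(2)]])
      (simp add: estimation_bvp_def)
  moreover have "l2_inner \<omega> h p - l2_inner \<omega> (\<lambda>t. H t *v x t) (\<lambda>t. H t *v p t) =
      l2_inner \<omega> (\<lambda>t. transpose (B t) *v q t) (\<lambda>t. transpose (B t) *v z t)"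
    using zp by (intro estimation_bvp_Green[OF qx' h hamiltonian_solution_L2(6)[OF ham(1)]])
      (simp add: estimation_bvp_def)
  moreover have "l2_inner \<omega> h p = l2_inner \<omega> (\<lambda>t. H t *v p t) y"
    unfolding h_def l2_inner_transpose_left by (rule l2_inner_commute)
  ultimately show ?thesis
    using l2_inner_commute[of \<omega> "\<lambda>t. H t *v p t" "\<lambda>t. H t *v x t"]
      l2_inner_commute[of \<omega> "\<lambda>t. transpose (B t) *v z t" "\<lambda>t. transpose (B t) *v q t"] by linarith
qed

end

theorem corollary2:
  fixes \<omega> :: real
    and A :: "real \<Rightarrow> real^'n^'n"
    and B :: "real \<Rightarrow> real^'r^'n"
    and H :: "real \<Rightarrow> real^'n^'m"
    and N :: nat
    and \<psi> :: "nat \<Rightarrow> real \<Rightarrow> real^'n"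
    and l :: "real \<Rightarrow> real^'n"
  assumes sample_type: "\<exists>i :: real \<Rightarrow> 'w. inj i"
    and "0 < \<omega>"
    and "continuous_on {0..\<omega>} A" and "continuous_on {0..\<omega>} B" and "continuous_on {0..\<omega>} H"
    and "homogeneous_basis \<omega> A N \<psi>"
    and "lin_indep_family {0..\<omega>} N (\<lambda>k t. H t *v \<psi> k t)"
    and "l \<in> L2 \<omega>"
  shows "minimax_error TYPE('w) \<omega> A B H l < \<infinity> \<and>
    (\<exists>z p. estimation_bvp \<omega> A B H l z p) \<and>
    (\<forall>y\<in>L2 \<omega>. \<exists>p x. filtering_bvp \<omega> A B H y p x) \<and>
    (\<exists>u. minimax_estimation TYPE('w) \<omega> A B H l u \<and>
       (\<forall>v. minimax_estimation TYPE('w) \<omega> A B H l v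
          \<longrightarrow> (AE t in lebesgue_on {0..\<omega>}. v t = u t)) \<and>
       (\<forall>z p. estimation_bvp \<omega> A B H l z p \<longrightarrow>
          enn2real (minimax_error TYPE('w) \<omega> A B H l) = l2_inner \<omega> l p \<and>
          (AE t in lebesgue_on {0..\<omega>}. u t = H t *v p t)) \<and>
       (\<forall>v\<in>L2 \<omega>. (AE t in lebesgue_on {0..\<omega>}. v t = u t) \<longleftrightarrow>
          (\<forall>y\<in>L2 \<omega>. \<forall>p x. filtering_bvp \<omega> A B H y p x
             \<longrightarrow> l2_inner \<omega> v y = l2_inner \<omega> l x)))"
proof -
  interpret periodic_estimation \<omega> A B H by standard fact+
  note l = \<open>l \<in> L2 \<omega>\<close>
  \<comment> \<open>Two sample points carry the random sign of the extremal noise.\<close>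
  have two: "\<exists>w1 w2 :: 'w. w1 \<noteq> w2"
  proof -
    obtain i :: "real \<Rightarrow> 'w" where "inj i" using sample_type by blast
    then have "i 0 \<noteq> i 1" by (simp add: inj_eq)
    then show ?thesis by blast
  qed
  let ?\<sigma> = "guaranteed_error TYPE('w) \<omega> A B H l"
  have solvable: "\<exists>z p. estimation_bvp \<omega> A B H h z p" if "h \<in> L2 \<omega>" for h
    by (rule estimation_bvp_solvable[OF _ that]) (use homogeneous_estimation_bvp[OF assms(6,7)] in blast)+
  have filtering: "\<exists>q x. filtering_bvp \<omega> A B H y q x" if y: "y \<in> L2 \<omega>" for y
    unfolding filtering_bvp_iff by (intro solvable L2_matrix_mult continuous_intros cont_H y)
  have estL2: "(\<lambda>t. H t *v p t) \<in> L2 \<omega>" if "estimation_bvp \<omega> A B H l z p" for z p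
    using that hamiltonian_solution_L2(5) by (auto simp: estimation_bvp_iff)
  have lower: "ennreal (l2_inner \<omega> l p) \<le> ?\<sigma> v"
    if "estimation_bvp \<omega> A B H l z p" "v \<in> L2 \<omega>" for z p v
  proof -
    have "ennreal (l2_inner \<omega> l p) \<le>
        ennreal (l2_inner \<omega> l p + l2_inner \<omega> (\<lambda>t. v t - H t *v p t) (\<lambda>t. v t - H t *v p t))"
      by (intro ennreal_leI) (simp add: l2_inner_self_nonneg)
    then show ?thesis using guaranteed_error_lower_bound[OF two that(1) l that(2)] by (rule order_trans)
  qed
  have minimax: "minimax_estimation TYPE('w) \<omega> A B H l (\<lambda>t. H t *v p t)"
    if "estimation_bvp \<omega> A B H l z p" for z p
    using lower[OF that] guaranteed_error_optimal_le[OF that l] estL2[OF that]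
    unfolding minimax_estimation_def by (blast intro: order_trans)
  have opt_value: "minimax_error TYPE('w) \<omega> A B H l = ennreal (l2_inner \<omega> l p)"
    if "estimation_bvp \<omega> A B H l z p" for z p
    unfolding minimax_error_def
  proof (rule antisym)
    show "(INF u\<in>L2 \<omega>. ?\<sigma> u) \<le> ennreal (l2_inner \<omega> l p)"
      by (rule order_trans[OF INF_lower[OF estL2[OF that], of ?\<sigma>] guaranteed_error_optimal_le[OF that l]])
    show "ennreal (l2_inner \<omega> l p) \<le> (INF u\<in>L2 \<omega>. ?\<sigma> u)"
      by (rule INF_greatest) (rule lower[OF that])
  qed
  \<comment> \<open>\<open>ennreal\<close> sends negative numbers to 0, so the sign is needed to
    read inequalities and values back as statements about reals.\<close>
  have nonneg: "l2_inner \<omega> l p \<ge> 0" if "estimation_bvp \<omega> A B H l z p" for z p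
    unfolding estimation_bvp_energy[OF that l] by (intro add_nonneg_nonneg l2_inner_self_nonneg)
  \<comment> \<open>The lower bound for \<open>v\<close> contains the excess
    \<open>\<parallel>v - H p\<parallel>\<^sup>2\<close> over the optimal value, so optimality of
    \<open>v\<close> forces that excess to be 0.\<close>
  have unique: "AE t in lebesgue_on {0..\<omega>}. v t = H t *v p t"
    if zp: "estimation_bvp \<omega> A B H l z p" and v: "minimax_estimation TYPE('w) \<omega> A B H l v" for z p v
  proof -
    have vL: "v \<in> L2 \<omega>" using v by (simp add: minimax_estimation_def)
    have "ennreal (l2_inner \<omega> l p + l2_inner \<omega> (\<lambda>t. v t - H t *v p t) (\<lambda>t. v t - H t *v p t)) \<le> ?\<sigma> v"
      by (rule guaranteed_error_lower_bound[OF two zp l vL])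
    also have "\<dots> \<le> ?\<sigma> (\<lambda>t. H t *v p t)"
      using v estL2[OF zp] by (simp add: minimax_estimation_def)
    also have "\<dots> \<le> ennreal (l2_inner \<omega> l p)" by (rule guaranteed_error_optimal_le[OF zp l])
    finally have "l2_inner \<omega> l p + l2_inner \<omega> (\<lambda>t. v t - H t *v p t) (\<lambda>t. v t - H t *v p t) \<le> l2_inner \<omega> l p"
      using nonneg[OF zp] by (simp only: ennreal_le_iff)
    then have "l2_inner \<omega> (\<lambda>t. v t - H t *v p t) (\<lambda>t. v t - H t *v p t) = 0"
      by (intro antisym l2_inner_self_nonneg) simp
    then show ?thesis using l2_inner_self_eq_0[OF L2_diff[OF vL estL2[OF zp]]] by simp
  qed
  obtain z p where zp: "estimation_bvp \<omega> A B H l z p" using solvable[OF l] by blast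
  define u where "u t = H t *v p t" for t
  have uL: "u \<in> L2 \<omega>" unfolding u_def by (rule estL2[OF zp])
  have dual: "l2_inner \<omega> u y = l2_inner \<omega> l x" if "y \<in> L2 \<omega>" "filtering_bvp \<omega> A B H y q x" for y q x
    unfolding u_def by (rule estimation_filtering_duality[OF zp l that])
  have "minimax_estimation TYPE('w) \<omega> A B H l u" unfolding u_def by (rule minimax[OF zp])
  moreover have "AE t in lebesgue_on {0..\<omega>}. v t = u t"
    if "minimax_estimation TYPE('w) \<omega> A B H l v" for v
    unfolding u_def by (rule unique[OF zp that])
  moreover have "enn2real (minimax_error TYPE('w) \<omega> A B H l) = l2_inner \<omega> l p' \<and>
      (AE t in lebesgue_on {0..\<omega>}. u t = H t *v p' t)" if "estimation_bvp \<omega> A B H l z' p'" for z' p'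
    using opt_value[OF that] nonneg[OF that] unique[OF that minimax[OF zp]] by (simp add: u_def)
  moreover have "(AE t in lebesgue_on {0..\<omega>}. v t = u t) \<longleftrightarrow>
      (\<forall>y\<in>L2 \<omega>. \<forall>q x. filtering_bvp \<omega> A B H y q x \<longrightarrow> l2_inner \<omega> v y = l2_inner \<omega> l x)"
    if v: "v \<in> L2 \<omega>" for v
  proof
    assume "AE t in lebesgue_on {0..\<omega>}. v t = u t"
    then show "\<forall>y\<in>L2 \<omega>. \<forall>q x. filtering_bvp \<omega> A B H y q x \<longrightarrow> l2_inner \<omega> v y = l2_inner \<omega> l x"
      using l2_inner_AE_cong_left[OF v uL] dual by metis
  next
    assume *: "\<forall>y\<in>L2 \<omega>. \<forall>q x. filtering_bvp \<omega> A B H y q x \<longrightarrow> l2_inner \<omega> v y = l2_inner \<omega> l x"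
    have d: "(\<lambda>t. v t - u t) \<in> L2 \<omega>" by (rule L2_diff[OF v uL])
    \<comment> \<open>Testing with the data \<open>y = v - u\<close>, for which the filtering
      problem is solvable, turns equality of the two functionals into a vanishing norm.\<close>
    obtain q x where "filtering_bvp \<omega> A B H (\<lambda>t. v t - u t) q x" using filtering[OF d] by blast
    then have "l2_inner \<omega> v (\<lambda>t. v t - u t) = l2_inner \<omega> u (\<lambda>t. v t - u t)" using * d dual by metis
    then have "l2_inner \<omega> (\<lambda>t. v t - u t) (\<lambda>t. v t - u t) = 0"
      by (simp add: l2_inner_diff_left[OF v uL d])
    then show "AE t in lebesgue_on {0..\<omega>}. v t = u t" using l2_inner_self_eq_0[OF d] by simp
  qed
  ultimately show ?thesis
    using opt_value[OF zp] zp filtering by (intro conjI exI[of _ u]) auto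
qed

end
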